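(* Let $\Phi$ be an indecomposable root system of rank $>1$ and $G_\pi(\Phi,\mathbb R)$ the Chevalley group over the field of real numbers $\mathbb R$. If $A$ is a computable ordered subfield of $\mathbb R$, then the first-order theory $Th(G_\pi(\Phi,\mathbb R))$ with constants from $G_\pi(\Phi,A)$ is decidable. In particular, the Diophantine problem in $G_\pi(\Phi,\mathbb R)$ with constants from $G_\pi(\Phi,A)$ is decidable (under a proper enumeration of $G_\pi(\Phi,A)$).
   Context: A countable structure $\mathcal A$ of finite signature is computable with respect to an enumeration (surjective map) $\nu:\mathbb N\to\mathcal A$ if all basic operations and predicates of $\mathcal A$, including equality, are computable with respect to $\nu$; it is computable if it has such an enumeration. A computable ordered subfield of $\mathbb R$ is a subfield which, with the order induced from $\mathbb R$, is a computable structure (as an ordered field). A proper enumeration of $G_\pi(\Phi,A)$ is one arising from an enumeration making the ordered field $A$ computable, by representing elements of $G_\pi(\Phi,A)$ as matrices over $A$. The theory with constants from $G_\pi(\Phi,A)$ is the first-order theory in the group language expanded by names for the elements of $G_\pi(\Phi,A)$. Root systems are reduced. Let $\pi$ be a faithful finite-dimensional representation of the complex semisimple Lie algebra with root system $\Phi$, with weight lattice $\Lambda_\pi$. $G_\pi(\Phi,K)$ denotes the Chevalley group of type $(\Phi,\Lambda_\pi)$ over a commutative ring $K$ with $1$, i.e. the group of $K$-points of the Chevalley--Demazure group scheme, realized as the subgroup of $\mathrm{SL}_n(K)$, $n=\dim\pi$, given by polynomial equations with integer coefficients in the matrix entries. The Diophantine problem in a group $G$ with constants from an enumerated countable subset $C$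 is decidable if there is an algorithm which, given a finite system of group equations with coefficients in $C$ (presented through the enumeration), decides whether the system has a solution in $G$. *)

theory Defs
  imports
    "HOL-Analysis.Analysis"
    "HOL-Algebra.Generated_Groups"
    "HOL-Library.Poly_Mapping"
    "HOL-Library.Nat_Bijection"
begin

section \<open>Computability\<close>

text \<open>Kleene's general recursive functions: only total functions occur, since minimisation is
  restricted to regular functions.  An \<open>n\<close>-ary function is a function on lists whose values on
  lists of length other than \<open>n\<close> are irrelevant (rule \<open>ext\<close>).\<close>

inductive recursive :: "nat \<Rightarrow> (nat list \<Rightarrow> nat) \<Rightarrow> bool" where
  zero: "recursive n (\<lambda>xs. 0)"
| suc: "recursive 1 (\<lambda>xs. Suc (xs ! 0))"
| proj: "i < n \<Longrightarrow> recursive n (\<lambda>xs. xs ! i)"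
| comp: "recursive (length fs) g \<Longrightarrow> \<forall>f\<in>set fs. recursive n f \<Longrightarrow>
    recursive n (\<lambda>xs. g (map (\<lambda>f. f xs) fs))"
| prim_rec: "recursive n g \<Longrightarrow> recursive (n + 2) h \<Longrightarrow>
    recursive (Suc n) (\<lambda>xs. rec_nat (g (tl xs)) (\<lambda>k r. h (k # r # tl xs)) (hd xs))"
| mu: "recursive (Suc n) g \<Longrightarrow> \<forall>xs. length xs = n \<longrightarrow> (\<exists>k. g (k # xs) = 0) \<Longrightarrow>
    recursive n (\<lambda>xs. LEAST k. g (k # xs) = 0)"
| ext: "recursive n f \<Longrightarrow> \<forall>xs. length xs = n \<longrightarrow> f xs = f' xs \<Longrightarrow> recursive n f'"

definition decidable_pred :: "nat \<Rightarrow> (nat list \<Rightarrow> bool) \<Rightarrow> bool" where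
  "decidable_pred n P \<longleftrightarrow> recursive n (\<lambda>xs. if P xs then 1 else 0)"

definition decidable_set :: "nat set \<Rightarrow> bool" where
  "decidable_set S \<longleftrightarrow> decidable_pred 1 (\<lambda>xs. xs ! 0 \<in> S)"


section \<open>Computable ordered subfields of the reals\<close>

definition real_subfield :: "real set \<Rightarrow> bool" where
  "real_subfield A \<longleftrightarrow> 0 \<in> A \<and> 1 \<in> A \<and>
     (\<forall>x\<in>A. \<forall>y\<in>A. x + y \<in> A \<and> x * y \<in> A) \<and>
     (\<forall>x\<in>A. - x \<in> A \<and> inverse x \<in> A)"

text \<open>The signature of ordered fields is \<open>0, 1, +, -, \<cdot>, <\<close>; nullary operations are trivially
  computable, and inversion is computable by search.\<close>

definition computable_enumeration :: "(nat \<Rightarrow> real) \<Rightarrow> real set \<Rightarrow> bool" where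
  "computable_enumeration \<nu> A \<longleftrightarrow> range \<nu> = A \<and>
     (\<exists>r. recursive 2 r \<and> (\<forall>i j. \<nu> i + \<nu> j = \<nu> (r [i, j]))) \<and>
     (\<exists>r. recursive 2 r \<and> (\<forall>i j. \<nu> i * \<nu> j = \<nu> (r [i, j]))) \<and>
     (\<exists>r. recursive 1 r \<and> (\<forall>i. - \<nu> i = \<nu> (r [i]))) \<and>
     decidable_pred 2 (\<lambda>xs. \<nu> (xs ! 0) = \<nu> (xs ! 1)) \<and>
     decidable_pred 2 (\<lambda>xs. \<nu> (xs ! 0) < \<nu> (xs ! 1))"

text \<open>An enumeration of a set of matrices over the range of \<open>\<nu>\<close> in which the
  \<open>\<nu>\<close>-codes of the matrix entries are computed from the code of the matrix.\<close>

definition proper_enumeration ::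
    "(nat \<Rightarrow> real) \<Rightarrow> (real^'n^'n) set \<Rightarrow> (nat \<Rightarrow> real^'n^'n) \<Rightarrow> bool" where
  "proper_enumeration \<nu> S \<mu> \<longleftrightarrow> range \<mu> = S \<and>
     (\<forall>i j. \<exists>r. recursive 1 r \<and> (\<forall>m. \<mu> m $ i $ j = \<nu> (r [m])))"


section \<open>The language of groups with constants\<close>

text \<open>Variables and constants are both numbered; the \<open>k\<close>-th constant denotes \<open>c k\<close>
  for a given enumeration \<open>c\<close> of the named elements.\<close>

datatype gterm = Var nat | Const nat | One | Inverse gterm | Times gterm gterm

datatype gformula =
  Equal gterm gterm | Neg gformula | Conj gformula gformula | Exists nat gformula

primrec term_code :: "gterm \<Rightarrow> nat" where
  "term_code (Var i) = prod_encode (0, i)"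
| "term_code (Const k) = prod_encode (1, k)"
| "term_code One = prod_encode (2, 0)"
| "term_code (Inverse t) = prod_encode (3, term_code t)"
| "term_code (Times s t) = prod_encode (4, prod_encode (term_code s, term_code t))"

primrec formula_code :: "gformula \<Rightarrow> nat" where
  "formula_code (Equal s t) = prod_encode (0, prod_encode (term_code s, term_code t))"
| "formula_code (Neg p) = prod_encode (1, formula_code p)"
| "formula_code (Conj p q) = prod_encode (2, prod_encode (formula_code p, formula_code q))"
| "formula_code (Exists i p) = prod_encode (3, prod_encode (i, formula_code p))"

primrec term_vars :: "gterm \<Rightarrow> nat set" where
  "term_vars (Var i) = {i}"
| "term_vars (Const k) = {}"
| "term_vars One = {}"
| "term_vars (Inverse t) = term_vars t"
| "term_vars (Times s t) = term_vars s \<union> term_vars t"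

primrec free_vars :: "gformula \<Rightarrow> nat set" where
  "free_vars (Equal s t) = term_vars s \<union> term_vars t"
| "free_vars (Neg p) = free_vars p"
| "free_vars (Conj p q) = free_vars p \<union> free_vars q"
| "free_vars (Exists i p) = free_vars p - {i}"

primrec term_value :: "('a, 'b) monoid_scheme \<Rightarrow> (nat \<Rightarrow> 'a) \<Rightarrow> (nat \<Rightarrow> 'a) \<Rightarrow> gterm \<Rightarrow> 'a" where
  "term_value G c e (Var i) = e i"
| "term_value G c e (Const k) = c k"
| "term_value G c e One = \<one>\<^bsub>G\<^esub>"
| "term_value G c e (Inverse t) = inv\<^bsub>G\<^esub> (term_value G c e t)"
| "term_value G c e (Times s t) = term_value G c e s \<otimes>\<^bsub>G\<^esub> term_value G c e t"

primrec satisfies ::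
    "('a, 'b) monoid_scheme \<Rightarrow> (nat \<Rightarrow> 'a) \<Rightarrow> (nat \<Rightarrow> 'a) \<Rightarrow> gformula \<Rightarrow> bool" where
  "satisfies G c e (Equal s t) \<longleftrightarrow> term_value G c e s = term_value G c e t"
| "satisfies G c e (Neg p) \<longleftrightarrow> \<not> satisfies G c e p"
| "satisfies G c e (Conj p q) \<longleftrightarrow> satisfies G c e p \<and> satisfies G c e q"
| "satisfies G c e (Exists i p) \<longleftrightarrow> (\<exists>a\<in>carrier G. satisfies G c (e(i := a)) p)"

definition theory_of :: "('a, 'b) monoid_scheme \<Rightarrow> (nat \<Rightarrow> 'a) \<Rightarrow> gformula set" where
  "theory_of G c = {p. free_vars p = {} \<and> (\<forall>e. range e \<subseteq> carrier G \<longrightarrow> satisfies G c e p)}"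

definition theory_decidable :: "('a, 'b) monoid_scheme \<Rightarrow> (nat \<Rightarrow> 'a) \<Rightarrow> bool" where
  "theory_decidable G c \<longleftrightarrow> decidable_set (formula_code ` theory_of G c)"

type_synonym equation_system = "(gterm \<times> gterm) list"

definition system_code :: "equation_system \<Rightarrow> nat" where
  "system_code E = list_encode (map (\<lambda>(s, t). prod_encode (term_code s, term_code t)) E)"

definition solvable_system ::
    "('a, 'b) monoid_scheme \<Rightarrow> (nat \<Rightarrow> 'a) \<Rightarrow> equation_system \<Rightarrow> bool" where
  "solvable_system G c E \<longleftrightarrow>
     (\<exists>e. range e \<subseteq> carrier G \<and> (\<forall>(s, t)\<in>set E. term_value G c e s = term_value G c e t))"

definition diophantine_decidable :: "('a, 'b) monoid_scheme \<Rightarrow> (nat \<Rightarrow> 'a) \<Rightarrow> bool" where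
  "diophantine_decidable G c \<longleftrightarrow> decidable_set (system_code ` {E. solvable_system G c E})"


section \<open>Root systems\<close>

definition cartan_integer :: "'e::euclidean_space \<Rightarrow> 'e \<Rightarrow> real" where
  "cartan_integer \<beta> \<alpha> = 2 * (\<beta> \<bullet> \<alpha>) / (\<alpha> \<bullet> \<alpha>)"

definition root_system :: "'e::euclidean_space set \<Rightarrow> bool" where
  "root_system \<Phi> \<longleftrightarrow> finite \<Phi> \<and> 0 \<notin> \<Phi> \<and> span \<Phi> = UNIV \<and>
     (\<forall>\<alpha>\<in>\<Phi>. \<forall>\<beta>\<in>\<Phi>. \<beta> - cartan_integer \<beta> \<alpha> *\<^sub>R \<alpha> \<in> \<Phi> \<and> cartan_integer \<beta> \<alpha> \<in> \<int>) \<and>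
     (\<forall>\<alpha>\<in>\<Phi>. \<forall>r. r *\<^sub>R \<alpha> \<in> \<Phi> \<longrightarrow> r = 1 \<or> r = - 1)"

definition indecomposable :: "'e::euclidean_space set \<Rightarrow> bool" where
  "indecomposable \<Phi> \<longleftrightarrow> \<Phi> \<noteq> {} \<and>
     \<not> (\<exists>\<Phi>1 \<Phi>2. \<Phi>1 \<noteq> {} \<and> \<Phi>2 \<noteq> {} \<and> \<Phi> = \<Phi>1 \<union> \<Phi>2 \<and> (\<forall>\<alpha>\<in>\<Phi>1. \<forall>\<beta>\<in>\<Phi>2. \<alpha> \<bullet> \<beta> = 0))"


section \<open>Complex Lie algebras and Chevalley bases\<close>

locale complex_lie_algebra = vector_space scale
  for scale :: "complex \<Rightarrow> 'l::ab_group_add \<Rightarrow> 'l" +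
  fixes bracket :: "'l \<Rightarrow> 'l \<Rightarrow> 'l"
  assumes finite_dimensional: "\<exists>B. finite B \<and> span B = UNIV"
    and bracket_linear_left: "Vector_Spaces.linear scale scale (\<lambda>x. bracket x y)"
    and bracket_linear_right: "Vector_Spaces.linear scale scale (bracket x)"
    and bracket_self: "bracket x x = 0"
    and jacobi: "bracket x (bracket y z) + bracket y (bracket z x) + bracket z (bracket x y) = 0"
begin

definition commutator :: "'l set \<Rightarrow> 'l set \<Rightarrow> 'l set" where
  "commutator I J = span {bracket x y | x y. x \<in> I \<and> y \<in> J}"

definition lie_ideal :: "'l set \<Rightarrow> bool" where
  "lie_ideal I \<longleftrightarrow> subspace I \<and> (\<forall>x. \<forall>y\<in>I. bracket x y \<in> I)"

definition lie_subalgebra :: "'l set \<Rightarrow> bool" where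
  "lie_subalgebra S \<longleftrightarrow> subspace S \<and> (\<forall>x\<in>S. \<forall>y\<in>S. bracket x y \<in> S)"

definition lie_solvable :: "'l set \<Rightarrow> bool" where
  "lie_solvable S \<longleftrightarrow> (\<exists>k. ((\<lambda>J. commutator J J) ^^ k) S = {0})"

definition lie_nilpotent :: "'l set \<Rightarrow> bool" where
  "lie_nilpotent S \<longleftrightarrow> (\<exists>k. (commutator S ^^ k) S = {0})"

definition semisimple :: bool where
  "semisimple \<longleftrightarrow> (\<forall>I. lie_ideal I \<and> lie_solvable I \<longrightarrow> I = {0})"

definition cartan_subalgebra :: "'l set \<Rightarrow> bool" where
  "cartan_subalgebra H \<longleftrightarrow> lie_subalgebra H \<and> lie_nilpotent H \<and>
     {x. \<forall>h\<in>H. bracket x h \<in> H} = H"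

text \<open>Linear functionals on \<open>H\<close> are normalised to be \<open>undefined\<close> outside \<open>H\<close>.\<close>

definition dual :: "'l set \<Rightarrow> ('l \<Rightarrow> complex) set" where
  "dual H = {f \<in> extensional H.
     (\<forall>x\<in>H. \<forall>y\<in>H. f (x + y) = f x + f y) \<and> (\<forall>c. \<forall>x\<in>H. f (scale c x) = c * f x)}"

definition root_space :: "'l set \<Rightarrow> ('l \<Rightarrow> complex) \<Rightarrow> 'l set" where
  "root_space H f = {x. \<forall>h\<in>H. bracket h x = scale (f h) x}"

definition roots :: "'l set \<Rightarrow> ('l \<Rightarrow> complex) set" where
  "roots H = {f \<in> dual H. (\<exists>h\<in>H. f h \<noteq> 0) \<and> root_space H f \<noteq> {0}}"

definition coroot :: "'l set \<Rightarrow> ('l \<Rightarrow> complex) \<Rightarrow> 'l" where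
  "coroot H f =
     (THE t. t \<in> commutator (root_space H f) (root_space H (\<lambda>h. - f h)) \<and> f t = 2)"

text \<open>An isomorphism of root systems from \<open>\<Phi>\<close> to the roots of the Lie algebra: a bijection
  preserving the Cartan integers (it then extends to a linear isomorphism of the spans).\<close>

definition root_identification ::
    "'l set \<Rightarrow> 'e::euclidean_space set \<Rightarrow> ('e \<Rightarrow> 'l \<Rightarrow> complex) \<Rightarrow> bool" where
  "root_identification H \<Phi> \<rho> \<longleftrightarrow> bij_betw \<rho> \<Phi> (roots H) \<and>
     (\<forall>\<alpha>\<in>\<Phi>. \<forall>\<beta>\<in>\<Phi>. \<rho> \<beta> (coroot H (\<rho> \<alpha>)) = of_real (cartan_integer \<beta> \<alpha>))"

text \<open>The root vectors of a Chevalley basis.  The remaining basis vectors are the coroots of the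
  simple roots for some base of \<open>\<Phi>\<close>; they do not enter the construction of the group.\<close>

definition chevalley_root_vectors ::
    "'l set \<Rightarrow> 'e::euclidean_space set \<Rightarrow> ('e \<Rightarrow> 'l \<Rightarrow> complex) \<Rightarrow> ('e \<Rightarrow> 'l) \<Rightarrow> bool" where
  "chevalley_root_vectors H \<Phi> \<rho> x \<longleftrightarrow>
     (\<forall>\<alpha>\<in>\<Phi>. x \<alpha> \<in> root_space H (\<rho> \<alpha>) \<and> bracket (x \<alpha>) (x (- \<alpha>)) = coroot H (\<rho> \<alpha>)) \<and>
     (\<forall>\<alpha>\<in>\<Phi>. \<forall>\<beta>\<in>\<Phi>. \<alpha> + \<beta> \<in> \<Phi> \<longrightarrow>
        (\<exists>c. bracket (x \<alpha>) (x \<beta>) = scale c (x (\<alpha> + \<beta>)) \<and>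
             bracket (x (- \<alpha>)) (x (- \<beta>)) = scale (- c) (x (- \<alpha> - \<beta>))))"

definition faithful_representation ::
    "(complex \<Rightarrow> 'v::ab_group_add \<Rightarrow> 'v) \<Rightarrow> ('l \<Rightarrow> 'v \<Rightarrow> 'v) \<Rightarrow> bool" where
  "faithful_representation scaleV \<pi> \<longleftrightarrow> vector_space scaleV \<and>
     (\<forall>x. Vector_Spaces.linear scaleV scaleV (\<pi> x)) \<and>
     (\<forall>v. Vector_Spaces.linear scale scaleV (\<lambda>x. \<pi> x v)) \<and>
     (\<forall>x y v. \<pi> (bracket x y) v = \<pi> x (\<pi> y v) - \<pi> y (\<pi> x v)) \<and>
     inj \<pi>"

end


section \<open>Chevalley groups\<close>

text \<open>A basis \<open>b\<close> of the representation space whose \<open>\<int>\<close>-span is an admissible lattice, i.e.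
  stable under all divided powers of the operators \<open>X \<alpha>\<close> of the root vectors.  Since \<open>b\<close> is
  indexed by \<open>'n\<close>, the dimension of the representation is \<open>CARD('n)\<close>.\<close>

definition integer_span ::
    "(complex \<Rightarrow> 'v::ab_group_add \<Rightarrow> 'v) \<Rightarrow> ('n::finite \<Rightarrow> 'v) \<Rightarrow> 'v set" where
  "integer_span scaleV b = range (\<lambda>k :: 'n \<Rightarrow> int. \<Sum>i\<in>UNIV. scaleV (of_int (k i)) (b i))"

definition admissible_basis ::
    "(complex \<Rightarrow> 'v::ab_group_add \<Rightarrow> 'v) \<Rightarrow> 'e set \<Rightarrow> ('e \<Rightarrow> 'v \<Rightarrow> 'v) \<Rightarrow> ('n::finite \<Rightarrow> 'v) \<Rightarrow> bool"
  where
  "admissible_basis scaleV \<Phi> X b \<longleftrightarrow>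
     inj b \<and> \<not> module.dependent scaleV (range b) \<and> module.span scaleV (range b) = UNIV \<and>
     (\<forall>\<alpha>\<in>\<Phi>. \<forall>m. \<forall>v\<in>integer_span scaleV b.
        scaleV (1 / fact m) ((X \<alpha> ^^ m) v) \<in> integer_span scaleV b)"

definition matrix_in_basis ::
    "(complex \<Rightarrow> 'v::ab_group_add \<Rightarrow> 'v) \<Rightarrow> ('n::finite \<Rightarrow> 'v) \<Rightarrow> ('v \<Rightarrow> 'v) \<Rightarrow> complex^'n^'n" where
  "matrix_in_basis scaleV b f =
     (\<chi> i j. module.representation scaleV (range b) (f (b j)) (b i))"

text \<open>The matrix of \<open>exp (t X)\<close>; the operators \<open>X\<close> of interest are nilpotent.\<close>

definition exp_matrix ::
    "(complex \<Rightarrow> 'v::ab_group_add \<Rightarrow> 'v) \<Rightarrow> ('n::finite \<Rightarrow> 'v) \<Rightarrow> ('v \<Rightarrow> 'v) \<Rightarrow> complex \<Rightarrow> complex^'n^'n"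
  where
  "exp_matrix scaleV b X t =
     suminf (\<lambda>k. \<chi> i j. t ^ k / fact k * matrix_in_basis scaleV b (X ^^ k) $ i $ j)"

definition matrix_monoid :: "('k::comm_ring_1^'n^'n) set \<Rightarrow> ('k^'n^'n) monoid" where
  "matrix_monoid S = \<lparr>carrier = S, mult = (\<lambda>g h. g ** h), one = mat 1\<rparr>"

text \<open>The subgroup of \<open>SL\<close> over \<open>\<complex>\<close> generated by the root elements; this is the complex
  Chevalley group.\<close>

definition elementary_group ::
    "(complex \<Rightarrow> 'v::ab_group_add \<Rightarrow> 'v) \<Rightarrow> 'e set \<Rightarrow> ('e \<Rightarrow> 'v \<Rightarrow> 'v) \<Rightarrow> ('n::finite \<Rightarrow> 'v) \<Rightarrow>
     (complex^'n^'n) set" where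
  "elementary_group scaleV \<Phi> X b =
     generate (matrix_monoid {g. det g = 1}) {exp_matrix scaleV b (X \<alpha>) t | \<alpha> t. \<alpha> \<in> \<Phi>}"

text \<open>Integer polynomials in the matrix entries.\<close>

type_synonym 'n entry_poly = "('n \<times> 'n \<Rightarrow>\<^sub>0 nat) \<Rightarrow>\<^sub>0 int"

definition poly_value :: "'n::finite entry_poly \<Rightarrow> 'k::comm_ring_1^'n^'n \<Rightarrow> 'k" where
  "poly_value p g = (\<Sum>m\<in>Poly_Mapping.keys p.
     of_int (Poly_Mapping.lookup p m) *
       (\<Prod>(i, j)\<in>Poly_Mapping.keys m. (g $ i $ j) ^ Poly_Mapping.lookup m (i, j)))"

text \<open>The coordinate ring of the Chevalley--Demazure group scheme is the quotient of the integer
  polynomials in the matrix entries by the ideal of those vanishing on the complex Chevalley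
  group.  The points over a subring \<open>A\<close> of \<open>'k\<close>:\<close>

definition chevalley_points ::
    "(complex \<Rightarrow> 'v::ab_group_add \<Rightarrow> 'v) \<Rightarrow> 'e set \<Rightarrow> ('e \<Rightarrow> 'v \<Rightarrow> 'v) \<Rightarrow> ('n::finite \<Rightarrow> 'v) \<Rightarrow>
     'k::comm_ring_1 set \<Rightarrow> ('k^'n^'n) set" where
  "chevalley_points scaleV \<Phi> X b A =
     {g. (\<forall>i j. g $ i $ j \<in> A) \<and> det g = 1 \<and>
         (\<forall>p. (\<forall>h\<in>elementary_group scaleV \<Phi> X b. poly_value p h = 0) \<longrightarrow> poly_value p g = 0)}"

definition chevalley_group ::
    "(complex \<Rightarrow> 'v::ab_group_add \<Rightarrow> 'v) \<Rightarrow> 'e set \<Rightarrow> ('e \<Rightarrow> 'v \<Rightarrow> 'v) \<Rightarrow> ('n::finite \<Rightarrow> 'v) \<Rightarrow>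
     'k::comm_ring_1 set \<Rightarrow> ('k^'n^'n) monoid" where
  "chevalley_group scaleV \<Phi> X b A = matrix_monoid (chevalley_points scaleV \<Phi> X b A)"

end

theory Submission
  imports Defs "HOL-Library.Function_Algebras" "HOL-Computational_Algebra.Polynomial"
begin

text \<open>The root elements of the group are matrices \<open>exp (t X)\<close> whose coefficients
  \<open>X\<^sup>k / k!\<close> are integral in the given basis; being integral and tending to \<open>0\<close>, they
  vanish for large \<open>k\<close>.  Hence the complex group is the Zariski closure of the group \<open>Z\<close>
  generated by the elements with integral parameter, and \<open>G(\<real>)\<close> is the real Zariski closure
  of \<open>Z\<close>: a real polynomial vanishing on \<open>Z\<close> splits, by a basis of \<open>\<real>\<close> over \<open>\<rat>\<close>, into
  integral ones.  So \<open>G(\<real>)\<close> is a group and, by the Hilbert basis theorem, is defined by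
  finitely many integral equations, which interprets its theory in the ordered field of reals.

  Sentences about the reals are decided by Tarski's quantifier elimination in the form due to
  Muchnik.  The family of polynomials in the eliminated variable is closed under truncation,
  differentiation and pseudo-remainder; then the signs of the coefficients determine the sign
  table of the whole family, adding the polynomials in the order of their degrees.  Since a
  quantifier-free formula may be given by all admitted sign vectors of finitely many terms, the
  sign vectors of the coefficients are simply run through, and no term is ever normalised.
  Without quantifiers and free variables, a formula is evaluated by the operations of the
  computable field.

  For the computability, a function given by a well-founded recursion with computable arguments
  of the recursive calls is evaluated by a stack machine whose running time is found by
  minimisation.\<close>

section \<open>Recursive functions on codes\<close>

text \<open>The real points are defined through polynomials that vanish on the complex group, so
  real and complex matrices have to be compared; the integral group \<open>Z\<close> lies in both
  and serves as the bridge. From it the decision procedure takes just this: a set of real matrices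
  of determinant 1 that contains \<open>mat 1\<close>, is closed under product and adjugate, and is
  cut out by a finite list of integral equations. This list is never computed; it belongs to the
  fixed group, like the index functions of the matrix entries, so choice operators are harmless and
  the procedure is not uniform in the group. A group variable becomes two blocks of real variables,
  for a matrix and for its inverse, so that inversion only swaps the two and every atomic formula is
  polynomial. Only total functions are \<open>recursive\<close>, which forces each search to stop
  also on numbers that are no codes; hence encodable types carry a test for being a code. The
  constants enter the real formulas as codes of elements of the field, and after elimination the
  signs are decided by the given order.\<close>

definition unary_recursive :: "(nat \<Rightarrow> nat) \<Rightarrow> bool" where
  "unary_recursive f \<longleftrightarrow> recursive 1 (\<lambda>xs. f (xs ! 0))"

definition binary_recursive :: "(nat \<Rightarrow> nat \<Rightarrow> nat) \<Rightarrow> bool" where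
  "binary_recursive f \<longleftrightarrow> recursive 2 (\<lambda>xs. f (xs ! 0) (xs ! 1))"

lemma recursive_unary:
  assumes "unary_recursive f" "recursive n g"
  shows "recursive n (\<lambda>xs. f (g xs))"
  using recursive.comp[of "[g]" "\<lambda>xs. f (xs ! 0)" n] assms by (simp add: unary_recursive_def)

lemma recursive_binary:
  assumes "binary_recursive h" "recursive n f" "recursive n g"
  shows "recursive n (\<lambda>xs. h (f xs) (g xs))"
  using recursive.comp[of "[f, g]" "\<lambda>xs. h (xs ! 0) (xs ! 1)" n] assms
  by (simp add: binary_recursive_def numeral_2_eq_2)

lemma unary_recursive_id: "unary_recursive (\<lambda>x. x)"
  unfolding unary_recursive_def by (rule recursive.proj) simp

lemma unary_recursive_comp: "unary_recursive f \<Longrightarrow> unary_recursive g \<Longrightarrow> unary_recursive (\<lambda>x. f (g x))"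
  using recursive_unary[of f 1 "\<lambda>xs. g (xs ! 0)"] by (simp add: unary_recursive_def)

lemma unary_recursive_binary:
  "binary_recursive h \<Longrightarrow> unary_recursive f \<Longrightarrow> unary_recursive g \<Longrightarrow> unary_recursive (\<lambda>x. h (f x) (g x))"
  using recursive_binary[of h 1 "\<lambda>xs. f (xs ! 0)" "\<lambda>xs. g (xs ! 0)"] by (simp add: unary_recursive_def)

lemma binary_recursive_unary:
  "unary_recursive f \<Longrightarrow> binary_recursive g \<Longrightarrow> binary_recursive (\<lambda>x y. f (g x y))"
  using recursive_unary[of f 2 "\<lambda>xs. g (xs ! 0) (xs ! 1)"] by (simp add: binary_recursive_def)

lemma binary_recursive_binary:
  "binary_recursive h \<Longrightarrow> binary_recursive f \<Longrightarrow> binary_recursive g \<Longrightarrow>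
    binary_recursive (\<lambda>x y. h (f x y) (g x y))"
  using recursive_binary[of h 2 "\<lambda>xs. f (xs ! 0) (xs ! 1)" "\<lambda>xs. g (xs ! 0) (xs ! 1)"]
  by (simp add: binary_recursive_def)

lemma binary_recursive_fst: "binary_recursive (\<lambda>x y. x)"
  and binary_recursive_snd: "binary_recursive (\<lambda>x y. y)"
  unfolding binary_recursive_def by (rule recursive.proj; simp)+

lemma unary_recursive_Suc: "unary_recursive Suc"
  unfolding unary_recursive_def by (rule recursive.suc)

lemma recursive_const: "recursive n (\<lambda>xs. c)"
proof (induction c)
  case (Suc c)
  then show ?case by (rule recursive_unary[OF unary_recursive_Suc])
qed (rule recursive.zero)

lemma unary_recursive_const: "unary_recursive (\<lambda>x. c)"
  unfolding unary_recursive_def by (rule recursive_const)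

lemma binary_recursive_const: "binary_recursive (\<lambda>x y. c)"
  unfolding binary_recursive_def by (rule recursive_const)

lemma binary_recursive_rec:
  assumes "unary_recursive g" "recursive 3 (\<lambda>xs. h (xs ! 0) (xs ! 1) (xs ! 2))"
  shows "binary_recursive (\<lambda>k x. rec_nat (g x) (\<lambda>k r. h k r x) k)"
  unfolding binary_recursive_def
proof (rule recursive.ext)
  show "recursive 2 (\<lambda>xs. rec_nat (g (tl xs ! 0))
      (\<lambda>k r. h ((k # r # tl xs) ! 0) ((k # r # tl xs) ! 1) ((k # r # tl xs) ! 2)) (hd xs))"
    using recursive.prim_rec[of 1 "\<lambda>xs. g (xs ! 0)" "\<lambda>xs. h (xs ! 0) (xs ! 1) (xs ! 2)"] assms
    by (simp add: unary_recursive_def numeral_2_eq_2 numeral_3_eq_3)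
qed (auto simp: length_Suc_conv numeral_2_eq_2)

lemma binary_recursive_swap: "binary_recursive f \<Longrightarrow> binary_recursive (\<lambda>x y. f y x)"
  by (rule binary_recursive_binary[OF _ binary_recursive_snd binary_recursive_fst])

lemma binary_recursive_add: "binary_recursive (+)"
proof -
  have "binary_recursive (\<lambda>k x. rec_nat x (\<lambda>k r. Suc r) k)"
    by (intro binary_recursive_rec unary_recursive_id recursive_unary[OF unary_recursive_Suc]
        recursive.proj) simp
  moreover have "rec_nat x (\<lambda>k r. Suc r) k = k + x" for k x
    by (induction k) auto
  ultimately show ?thesis by (simp add: binary_recursive_def)
qed

lemma binary_recursive_mult: "binary_recursive (*)"
proof -
  have "binary_recursive (\<lambda>k x. rec_nat 0 (\<lambda>k r. r + x) k)"
    by (intro binary_recursive_rec[where h = "\<lambda>k r x. r + x"] unary_recursive_const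
        recursive_binary[OF binary_recursive_add] recursive.proj) simp_all
  moreover have "rec_nat 0 (\<lambda>k r. r + x) k = k * x" for k x :: nat
    by (induction k) auto
  ultimately show ?thesis by (simp add: binary_recursive_def)
qed

lemma unary_recursive_pred: "unary_recursive (\<lambda>x. x - 1)"
proof -
  have "binary_recursive (\<lambda>k x. rec_nat 0 (\<lambda>k r. k) k)"
    by (intro binary_recursive_rec[where h = "\<lambda>k r x. k"] unary_recursive_const recursive.proj)
      simp_all
  moreover have "rec_nat 0 (\<lambda>k r. k) k = k - 1" for k :: nat
    by (induction k) auto
  ultimately have "binary_recursive (\<lambda>k x. k - 1)" by simp
  from unary_recursive_binary[OF this unary_recursive_id unary_recursive_id] show ?thesis by simp
qed

lemma binary_recursive_diff: "binary_recursive (-)"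
proof -
  have "binary_recursive (\<lambda>k x. rec_nat x (\<lambda>k r. r - 1) k)"
    by (intro binary_recursive_rec[where h = "\<lambda>k r x. r - 1"] unary_recursive_id
        recursive_unary[OF unary_recursive_pred] recursive.proj) simp_all
  moreover have "rec_nat x (\<lambda>k r. r - 1) k = x - k" for k x :: nat
    by (induction k) auto
  ultimately have "binary_recursive (\<lambda>k x. x - k)" by simp
  from binary_recursive_swap[OF this] show ?thesis by simp
qed

lemma unary_recursive_triangle: "unary_recursive triangle"
proof -
  have "binary_recursive (\<lambda>k x. rec_nat 0 (\<lambda>k r. r + Suc k) k)"
    by (intro binary_recursive_rec[where h = "\<lambda>k r x. r + Suc k"] unary_recursive_const
        recursive_binary[OF binary_recursive_add] recursive_unary[OF unary_recursive_Suc]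
        recursive.proj) simp_all
  moreover have "rec_nat 0 (\<lambda>k r. r + Suc k) k = triangle k" for k :: nat
    by (induction k) auto
  ultimately have "binary_recursive (\<lambda>k x. triangle k)" by simp
  from unary_recursive_binary[OF this unary_recursive_id unary_recursive_id] show ?thesis by simp
qed

lemma binary_recursive_pair: "binary_recursive (\<lambda>x y. prod_encode (x, y))"
  unfolding prod_encode_def split
  by (intro binary_recursive_binary[OF binary_recursive_add] binary_recursive_fst
      binary_recursive_snd binary_recursive_unary[OF unary_recursive_triangle])

text \<open>The index of the diagonal that carries \<open>n\<close> inverts the Cantor pairing. Its
  search is regular because \<open>n < triangle (Suc n)\<close>.\<close>

lemma unary_recursive_triangle_root: "unary_recursive (\<lambda>n. LEAST s. n < triangle (Suc s))"
proof -
  have ex: "\<exists>k. Suc n - triangle (Suc k) = 0" for n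
    by (rule exI[of _ n]) (simp add: triangle_def)
  have "recursive 1 (\<lambda>xs. LEAST k. Suc ((k # xs) ! 1) - triangle (Suc ((k # xs) ! 0)) = 0)"
  proof (rule recursive.mu[of 1 "\<lambda>xs. Suc (xs ! 1) - triangle (Suc (xs ! 0))"])
    have "recursive 2 (\<lambda>xs. Suc (xs ! 1) - triangle (Suc (xs ! 0)))"
      by (intro recursive_binary[OF binary_recursive_diff] recursive_unary[OF unary_recursive_Suc]
          recursive_unary[OF unary_recursive_triangle] recursive.proj) simp_all
    then show "recursive (Suc 1) (\<lambda>xs. Suc (xs ! 1) - triangle (Suc (xs ! 0)))"
      by (simp add: numeral_2_eq_2)
  qed (use ex in auto)
  moreover have "(Suc n - triangle (Suc k) = 0) \<longleftrightarrow> n < triangle (Suc k)" for n k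
    by linarith
  ultimately show ?thesis by (simp add: unary_recursive_def)
qed

lemma triangle_mono: "m \<le> n \<Longrightarrow> triangle m \<le> triangle n"
  unfolding triangle_def by (intro div_le_mono mult_le_mono) auto

lemma triangle_root_encode: "(LEAST s. prod_encode (m, n) < triangle (Suc s)) = m + n"
proof (rule Least_equality)
  show "prod_encode (m, n) < triangle (Suc (m + n))"
    by (simp add: prod_encode_def)
  fix s assume s: "prod_encode (m, n) < triangle (Suc s)"
  show "m + n \<le> s"
  proof (rule ccontr)
    assume "\<not> m + n \<le> s"
    then have "triangle (Suc s) \<le> triangle (m + n)" by (intro triangle_mono) simp
    with s show False by (simp add: prod_encode_def)
  qed
qed

lemma unary_recursive_fst: "unary_recursive (\<lambda>n. fst (prod_decode n))"
proof -
  have *: "fst (prod_decode n) = n - triangle (LEAST s. n < triangle (Suc s))" for n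
  proof (cases "prod_decode n")
    case (Pair a b)
    then have n: "n = prod_encode (a, b)" by (metis prod_decode_inverse)
    show ?thesis unfolding n triangle_root_encode prod_encode_inverse by (simp add: prod_encode_def)
  qed
  show ?thesis unfolding *
    by (intro unary_recursive_binary[OF binary_recursive_diff] unary_recursive_id
        unary_recursive_comp[OF unary_recursive_triangle] unary_recursive_triangle_root)
qed

lemma unary_recursive_snd: "unary_recursive (\<lambda>n. snd (prod_decode n))"
proof -
  have *: "snd (prod_decode n) = (LEAST s. n < triangle (Suc s)) - fst (prod_decode n)" for n
  proof (cases "prod_decode n")
    case (Pair a b)
    then have n: "n = prod_encode (a, b)" by (metis prod_decode_inverse)
    show ?thesis unfolding n triangle_root_encode by simp
  qed
  show ?thesis unfolding *
    by (intro unary_recursive_binary[OF binary_recursive_diff] unary_recursive_fst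
        unary_recursive_triangle_root)
qed

lemma unary_recursive_pair:
  "unary_recursive f \<Longrightarrow> unary_recursive g \<Longrightarrow> unary_recursive (\<lambda>x. prod_encode (f x, g x))"
  by (rule unary_recursive_binary[OF binary_recursive_pair])

lemma unary_recursive_rec:
  assumes "unary_recursive n" "unary_recursive g" "unary_recursive h"
  shows "unary_recursive (\<lambda>x. rec_nat (g x) (\<lambda>k r. h (prod_encode (x, prod_encode (k, r)))) (n x))"
proof -
  have "binary_recursive (\<lambda>k x. rec_nat (g x) (\<lambda>k r. h (prod_encode (x, prod_encode (k, r)))) k)"
    by (intro binary_recursive_rec[where h = "\<lambda>k r x. h (prod_encode (x, prod_encode (k, r)))"]
        assms recursive_unary[OF assms(3)] recursive_binary[OF binary_recursive_pair]
        recursive.proj) simp_all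
  from unary_recursive_binary[OF this assms(1) unary_recursive_id] show ?thesis .
qed

lemma unary_recursive_Least:
  assumes "unary_recursive g" "\<And>x. \<exists>k. g (prod_encode (x, k)) = 0"
  shows "unary_recursive (\<lambda>x. LEAST k. g (prod_encode (x, k)) = 0)"
proof -
  have "recursive 1 (\<lambda>xs. LEAST k. g (prod_encode ((k # xs) ! 1, (k # xs) ! 0)) = 0)"
  proof (rule recursive.mu[of 1 "\<lambda>xs. g (prod_encode (xs ! 1, xs ! 0))"])
    have "recursive 2 (\<lambda>xs. g (prod_encode (xs ! 1, xs ! 0)))"
      by (intro recursive_binary[OF binary_recursive_pair] recursive_unary[OF assms(1)]
          recursive.proj) simp_all
    then show "recursive (Suc 1) (\<lambda>xs. g (prod_encode (xs ! 1, xs ! 0)))"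
      by (simp add: numeral_2_eq_2)
  qed (use assms(2) in auto)
  then show ?thesis by (simp add: unary_recursive_def)
qed

lemma unary_recursive_if:
  assumes "unary_recursive c" "unary_recursive f" "unary_recursive g"
  shows "unary_recursive (\<lambda>x. if c x = 0 then f x else g x)"
proof -
  \<comment> \<open>With truncated subtraction \<open>1 - c x\<close> is 1 if \<open>c x = 0\<close>
    and 0 otherwise, so exactly one summand survives.\<close>
  have "unary_recursive (\<lambda>x. f x * (1 - c x) + g x * (1 - (1 - c x)))"
    by (intro unary_recursive_binary[OF binary_recursive_add] unary_recursive_binary[OF binary_recursive_mult]
        unary_recursive_binary[OF binary_recursive_diff] unary_recursive_const assms)
  moreover have "f x * (1 - c x) + g x * (1 - (1 - c x)) = (if c x = 0 then f x else g x)" for x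
    by simp
  ultimately show ?thesis by simp
qed

section \<open>Computable functions between encodable types\<close>

text \<open>Codes need not exhaust the numbers. The test \<open>c\<close>, which is 0 exactly on
  codes, makes searches total (\<open>computable_Least\<close>) and lets sets of codes be decided
  (\<open>computable_enc_image\<close>).\<close>

class encodable =
  fixes enc :: "'a \<Rightarrow> nat"
  assumes enc_inj: "enc x = enc y \<Longrightarrow> x = y"
    and enc_range: "\<exists>c. unary_recursive c \<and> (\<forall>n. c n = 0 \<longleftrightarrow> (\<exists>x. n = enc x))"

lemma enc_eq_iff [simp]: "enc x = enc y \<longleftrightarrow> x = y"
  by (auto dest: enc_inj)

instantiation nat :: encodable
begin
definition enc_nat :: "nat \<Rightarrow> nat" where [simp]: "enc_nat n = n"
instance
  by standard (auto intro!: exI[of _ "\<lambda>_. 0"] unary_recursive_const)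
end

instantiation bool :: encodable
begin
definition enc_bool :: "bool \<Rightarrow> nat" where "enc_bool b = (if b then 1 else 0)"
instance
proof
  have "n - 1 = 0 \<longleftrightarrow> (\<exists>x. n = enc (x :: bool))" for n
    unfolding ex_bool_eq enc_bool_def by auto
  then show "\<exists>c. unary_recursive c \<and> (\<forall>n. c n = 0 \<longleftrightarrow> (\<exists>x. n = enc (x :: bool)))"
    using unary_recursive_pred by blast
qed (auto simp: enc_bool_def split: if_splits)
end

instantiation prod :: (encodable, encodable) encodable
begin
definition enc_prod :: "'a \<times> 'b \<Rightarrow> nat" where "enc_prod p = prod_encode (enc (fst p), enc (snd p))"
instance
proof
  obtain c d where c: "unary_recursive c" "\<And>n. c n = 0 \<longleftrightarrow> (\<exists>x. n = enc (x :: 'a))"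
    and d: "unary_recursive d" "\<And>n. d n = 0 \<longleftrightarrow> (\<exists>x. n = enc (x :: 'b))"
    using enc_range[where 'a = 'a] enc_range[where 'a = 'b] by metis
  have "unary_recursive (\<lambda>n. c (fst (prod_decode n)) + d (snd (prod_decode n)))"
    by (intro unary_recursive_binary[OF binary_recursive_add] unary_recursive_comp[OF c(1)]
        unary_recursive_comp[OF d(1)] unary_recursive_fst unary_recursive_snd)
  moreover have "c (fst (prod_decode n)) + d (snd (prod_decode n)) = 0 \<longleftrightarrow>
      (\<exists>x. n = enc (x :: 'a \<times> 'b))" for n
  proof (cases "prod_decode n")
    case (Pair a b)
    then have n: "n = prod_encode (a, b)" by (metis prod_decode_inverse)
    show ?thesis unfolding n enc_prod_def split_paired_Ex by (simp add: c(2) d(2))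
  qed
  ultimately show "\<exists>c. unary_recursive c \<and> (\<forall>n. c n = 0 \<longleftrightarrow> (\<exists>x. n = enc (x :: 'a \<times> 'b)))"
    by blast
qed (auto simp: enc_prod_def prod_eq_iff)
end

text \<open>The state is a pair of the code of the remaining list and the sum of the checks so far,
  and a step removes one head. Running \<open>n\<close> steps on the code \<open>n\<close> is long
  enough, since a list is not longer than its code.\<close>

lemma list_code_check:
  assumes c: "unary_recursive c"
  shows "\<exists>d. unary_recursive d \<and> (\<forall>xs. d (list_encode xs) = 0 \<longleftrightarrow> (\<forall>x\<in>set xs. c x = 0))"
proof -
  define t where "t n = snd (prod_decode (n - 1))" for n
  define e where "e n = (if n = 0 then 0 else c (fst (prod_decode (n - 1))))" for n
  have t: "unary_recursive t" unfolding t_def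
    by (rule unary_recursive_comp[OF unary_recursive_snd unary_recursive_pred])
  have e: "unary_recursive e" unfolding e_def
    by (intro unary_recursive_if unary_recursive_id unary_recursive_const
        unary_recursive_comp[OF c] unary_recursive_comp[OF unary_recursive_fst]
        unary_recursive_pred)
  define d where "d n = snd (prod_decode (rec_nat (prod_encode (n, 0))
    (\<lambda>k r. prod_encode (t (fst (prod_decode r)), e (fst (prod_decode r)) + snd (prod_decode r))) n))"
    for n
  have "unary_recursive (\<lambda>n. rec_nat (prod_encode (n, 0))
    (\<lambda>k r. (\<lambda>p. prod_encode (t (fst (prod_decode (snd (prod_decode (snd (prod_decode p)))))),
      e (fst (prod_decode (snd (prod_decode (snd (prod_decode p)))))) +
      snd (prod_decode (snd (prod_decode (snd (prod_decode p)))))))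
      (prod_encode (n, prod_encode (k, r)))) n)"
    by (intro unary_recursive_rec[OF unary_recursive_id] unary_recursive_pair unary_recursive_id
        unary_recursive_const unary_recursive_binary[OF binary_recursive_add]
        unary_recursive_comp[OF t] unary_recursive_comp[OF e]
        unary_recursive_comp[OF unary_recursive_fst] unary_recursive_comp[OF unary_recursive_snd])
  then have "unary_recursive d" unfolding d_def
    by (intro unary_recursive_comp[OF unary_recursive_snd]) simp
  moreover have "d (list_encode xs) = 0 \<longleftrightarrow> (\<forall>x\<in>set xs. c x = 0)" for xs
  proof -
    define F where
      "F r = prod_encode (t (fst (prod_decode r)), e (fst (prod_decode r)) + snd (prod_decode r))" for r
    have rec_F: "rec_nat r (\<lambda>k. F) n = (F ^^ n) r" for r n
      by (induction n) auto
    \<comment> \<open>The code 0 of the empty list has to be a fixed point, since surplus steps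
      follow once the list is used up.\<close>
    have "prod_decode 0 = (0, 0)"
      unfolding prod_decode_def by (subst prod_decode_aux.simps) simp
    then have stop: "(F ^^ n) (prod_encode (0, a)) = prod_encode (0, a)" for n a
      by (induction n) (auto simp: F_def t_def e_def)
    have F: "F (prod_encode (list_encode (x # xs), a)) = prod_encode (list_encode xs, c x + a)"
      for x xs a by (simp add: F_def t_def e_def)
    have step: "snd (prod_decode ((F ^^ n) (prod_encode (list_encode xs, a)))) = 0
        \<longleftrightarrow> a = 0 \<and> (\<forall>x\<in>set xs. c x = 0)" if "length xs \<le> n" for xs a n
      using that
    proof (induction xs arbitrary: a n)
      case Nil
      then show ?case by (simp add: stop)
    next
      case (Cons x xs)
      then obtain m where "n = Suc m" "length xs \<le> m" by (cases n) auto
      then have "(F ^^ n) (prod_encode (list_encode (x # xs), a)) =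
          (F ^^ m) (prod_encode (list_encode xs, c x + a))"
        using F by (simp only: funpow_Suc_right o_apply)
      then show ?case using Cons.IH[OF \<open>length xs \<le> m\<close>] by auto
    qed
    have "length xs \<le> list_encode xs"
      by (induction xs) (auto intro: order.trans[OF _ le_prod_encode_2])
    from step[OF this, of 0] show ?thesis by (simp add: d_def rec_F flip: F_def)
  qed
  ultimately show ?thesis by blast
qed

instantiation list :: (encodable) encodable
begin
definition enc_list :: "'a list \<Rightarrow> nat" where "enc_list xs = list_encode (map enc xs)"
instance
proof
  fix x y :: "'a list"
  assume "enc x = enc y"
  then have "map enc x = map (enc :: 'a \<Rightarrow> nat) y"
    unfolding enc_list_def by (metis list_encode_inverse)
  moreover have "inj (enc :: 'a \<Rightarrow> nat)" by (rule injI) simp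
  ultimately show "x = y" by (simp add: inj_map_eq_map)
next
  obtain c where c: "unary_recursive c" "\<And>n. c n = 0 \<longleftrightarrow> (\<exists>x. n = enc (x :: 'a))"
    using enc_range[where 'a = 'a] by metis
  from list_code_check[OF c(1)] obtain d where d: "unary_recursive d"
    "\<And>xs. d (list_encode xs) = 0 \<longleftrightarrow> (\<forall>x\<in>set xs. c x = 0)" by blast
  have "d n = 0 \<longleftrightarrow> (\<exists>x. n = enc (x :: 'a list))" for n
  proof -
    have "d n = 0 \<longleftrightarrow> (\<exists>xs. list_decode n = map (enc :: 'a \<Rightarrow> nat) xs)"
      using d(2)[of "list_decode n"] by (simp add: c(2) ex_map_conv)
    also have "\<dots> \<longleftrightarrow> (\<exists>x. n = enc (x :: 'a list))"
      unfolding enc_list_def by (metis list_decode_inverse list_encode_inverse)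
    finally show ?thesis .
  qed
  with d(1) show "\<exists>c. unary_recursive c \<and> (\<forall>n. c n = 0 \<longleftrightarrow> (\<exists>x. n = enc (x :: 'a list)))"
    by blast
qed
end

definition computable :: "('a::encodable \<Rightarrow> 'b::encodable) \<Rightarrow> bool" where
  "computable f \<longleftrightarrow> (\<exists>g. unary_recursive g \<and> (\<forall>x. g (enc x) = enc (f x)))"

named_theorems computable_intros

lemma computableI: "unary_recursive g \<Longrightarrow> (\<And>x. g (enc x) = enc (f x)) \<Longrightarrow> computable f"
  unfolding computable_def by blast

lemma computable_const [computable_intros]: "computable (\<lambda>x. c)"
  by (rule computableI[OF unary_recursive_const]) simp

lemma computable_id [computable_intros]: "computable (\<lambda>x. x)"
  by (rule computableI[OF unary_recursive_id]) simp

lemma computable_comp: "computable f \<Longrightarrow> computable g \<Longrightarrow> computable (\<lambda>x. f (g x))"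
  unfolding computable_def using unary_recursive_comp by metis

lemma computable_Pair [computable_intros]:
  assumes "computable f" "computable g" shows "computable (\<lambda>x. (f x, g x))"
proof -
  from assms obtain f' g' where "unary_recursive f'" "\<And>x. f' (enc x) = enc (f x)"
    "unary_recursive g'" "\<And>x. g' (enc x) = enc (g x)" unfolding computable_def by metis
  then show ?thesis
    by (intro computableI[OF unary_recursive_pair[of f' g']]) (auto simp: enc_prod_def)
qed

lemma computable_comp2:
  "computable (\<lambda>p. f (fst p) (snd p)) \<Longrightarrow> computable g \<Longrightarrow> computable h \<Longrightarrow> computable (\<lambda>x. f (g x) (h x))"
  using computable_comp[OF _ computable_Pair, of "\<lambda>p. f (fst p) (snd p)" g h] by simp

lemma computable_fst [computable_intros]: "computable f \<Longrightarrow> computable (\<lambda>x. fst (f x))"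
  by (rule computable_comp[rotated], assumption)
    (rule computableI[OF unary_recursive_fst], simp add: enc_prod_def)

lemma computable_snd [computable_intros]: "computable f \<Longrightarrow> computable (\<lambda>x. snd (f x))"
  by (rule computable_comp[rotated], assumption)
    (rule computableI[OF unary_recursive_snd], simp add: enc_prod_def)

lemma computable_binary:
  assumes "binary_recursive h" "\<And>x y. enc (f x y) = h (enc x) (enc y)"
    and "computable a" "computable b"
  shows "computable (\<lambda>x. f (a x) (b x))"
proof -
  from assms obtain a' b' where "unary_recursive a'" "\<And>x. a' (enc x) = enc (a x)"
    "unary_recursive b'" "\<And>x. b' (enc x) = enc (b x)" unfolding computable_def by metis
  then show ?thesis
    by (intro computableI[OF unary_recursive_binary[OF assms(1), of a' b']]) (auto simp: assms(2))
qed

lemma computable_add [computable_intros]: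
    "computable f \<Longrightarrow> computable g \<Longrightarrow> computable (\<lambda>x. f x + g x :: nat)"
  and computable_diff [computable_intros]:
    "computable f \<Longrightarrow> computable g \<Longrightarrow> computable (\<lambda>x. f x - g x :: nat)"
  by (rule computable_binary[OF binary_recursive_add] computable_binary[OF binary_recursive_diff];
      simp)+

lemma computable_Suc [computable_intros]: "computable f \<Longrightarrow> computable (\<lambda>x. Suc (f x))"
  by (rule computable_comp[rotated], assumption) (rule computableI[OF unary_recursive_Suc], simp)

lemma computable_eq [computable_intros]:
  fixes f g :: "'a::encodable \<Rightarrow> 'b::encodable"
  assumes "computable f" "computable g" shows "computable (\<lambda>x. f x = g x)"
proof (rule computable_binary[of "\<lambda>x y. 1 - ((x - y) + (y - x))", OF _ _ assms])
  show "binary_recursive (\<lambda>x y. 1 - ((x - y) + (y - x)))"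
    by (intro binary_recursive_binary[OF binary_recursive_diff]
        binary_recursive_binary[OF binary_recursive_add] binary_recursive_const
        binary_recursive_fst binary_recursive_snd)
  fix x y :: 'b
  have "x = y \<longleftrightarrow> enc x - enc y + (enc y - enc x) = 0"
    by (subst enc_eq_iff[symmetric]) linarith
  then show "enc (x = y) = 1 - ((enc x - enc y) + (enc y - enc x))"
    by (auto simp: enc_bool_def)
qed

lemma computable_if [computable_intros]:
  assumes "computable c" "computable f" "computable g"
  shows "computable (\<lambda>x. if c x then f x else g x)"
proof -
  from assms obtain c' f' g' where "unary_recursive f'" "\<And>x. f' (enc x) = enc (f x)"
    "unary_recursive g'" "\<And>x. g' (enc x) = enc (g x)"
    "unary_recursive c'" "\<And>x. c' (enc x) = enc (c x)" unfolding computable_def by metis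
  then show ?thesis
    by (intro computableI[OF unary_recursive_if[of c' g' f']]) (auto simp: enc_bool_def)
qed

lemma computable_not [computable_intros]:
  assumes "computable f" shows "computable (\<lambda>x. \<not> f x)"
proof -
  have "(\<lambda>x. \<not> f x) = (\<lambda>x. if f x then False else True)" by auto
  then show ?thesis by (simp only:) (intro computable_intros assms)
qed

lemma computable_conj [computable_intros]:
  assumes "computable f" "computable g" shows "computable (\<lambda>x. f x \<and> g x)"
proof -
  have "(\<lambda>x. f x \<and> g x) = (\<lambda>x. if f x then g x else False)" by auto
  then show ?thesis by (simp only:) (intro computable_intros assms)
qed

lemma computable_disj [computable_intros]:
  assumes "computable f" "computable g" shows "computable (\<lambda>x. f x \<or> g x)"
proof -
  have "(\<lambda>x. f x \<or> g x) = (\<lambda>x. if f x then True else g x)" by auto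
  then show ?thesis by (simp only:) (intro computable_intros assms)
qed

lemma computable_le [computable_intros]:
  fixes f g :: "'a::encodable \<Rightarrow> nat"
  assumes "computable f" "computable g" shows "computable (\<lambda>x. f x \<le> g x)"
proof -
  have "computable (\<lambda>x. f x - g x = 0)" by (intro computable_intros assms)
  then show ?thesis by simp
qed

lemma computable_less [computable_intros]:
  fixes f g :: "'a::encodable \<Rightarrow> nat"
  assumes "computable f" "computable g" shows "computable (\<lambda>x. f x < g x)"
proof -
  have "computable (\<lambda>x. \<not> g x - f x = 0)" by (intro computable_intros assms)
  then show ?thesis by (simp add: not_le)
qed

lemma computable_rec_nat [computable_intros]:
  fixes g :: "'a::encodable \<Rightarrow> 'b::encodable"
  assumes "computable n" "computable g" "computable (\<lambda>p. h (fst p) (fst (snd p)) (snd (snd p)))"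
  shows "computable (\<lambda>x. rec_nat (g x) (\<lambda>k r. h x k r) (n x))"
proof -
  from assms(1,2) obtain n' g' where ng: "unary_recursive n'" "\<And>x. n' (enc x) = enc (n x)"
    "unary_recursive g'" "\<And>x. g' (enc x) = enc (g x)" unfolding computable_def by metis
  from assms(3) obtain h' where h: "unary_recursive h'"
    "\<And>x k r. h' (prod_encode (enc x, prod_encode (k, enc r))) = enc (h x k r)"
    unfolding computable_def by (metis enc_nat_def enc_prod_def fst_conv snd_conv)
  have "rec_nat (g' (enc x)) (\<lambda>k r. h' (prod_encode (enc x, prod_encode (k, r)))) m =
      enc (rec_nat (g x) (\<lambda>k r. h x k r) m)" for x m
    by (induction m) (auto simp: ng h)
  then show ?thesis
    by (intro computableI[OF unary_recursive_rec[OF ng(1,3) h(1)]]) (simp add: ng)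
qed

lemma computable_funpow [computable_intros]:
  fixes f :: "'a::encodable \<Rightarrow> 'b::encodable \<Rightarrow> 'b" and g :: "'a \<Rightarrow> 'b"
  assumes "computable (\<lambda>p. f (fst p) (snd p))" "computable n" "computable g"
  shows "computable (\<lambda>x. ((\<lambda>y. f x y) ^^ n x) (g x))"
proof -
  have "computable (\<lambda>x. rec_nat (g x) (\<lambda>k r. f x r) (n x))"
    by (intro computable_intros computable_comp2[OF assms(1)] assms)
  moreover have "rec_nat (g x) (\<lambda>k r. f x r) m = (f x ^^ m) (g x)" for x m
    by (induction m) auto
  ultimately show ?thesis by simp
qed

lemma computable_Least [computable_intros]:
  fixes P :: "'a::encodable \<Rightarrow> nat \<Rightarrow> bool"
  assumes P: "computable (\<lambda>p. P (fst p) (snd p))" and ex: "\<And>x. \<exists>k. P x k"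
  shows "computable (\<lambda>x. LEAST k. P x k)"
proof -
  have "computable (\<lambda>p. \<not> P (fst p) (snd p))" by (intro computable_intros P)
  then obtain g where g: "unary_recursive g"
    "\<And>x k. g (prod_encode (enc x, k)) = enc (\<not> P x k)"
    unfolding computable_def by (metis enc_nat_def enc_prod_def fst_conv snd_conv)
  obtain c where c: "unary_recursive c" "\<And>n. c n = 0 \<longleftrightarrow> (\<exists>x. n = enc (x :: 'a))"
    using enc_range[where 'a = 'a] by metis
  text \<open>Outside the range of \<open>enc\<close> the search is stopped at once, since minimisation has to be
    total.\<close>
  define f where "f n = (if c (fst (prod_decode n)) = 0 then g n else 0)" for n
  have "unary_recursive f" unfolding f_def
    by (intro unary_recursive_if unary_recursive_comp[OF c(1)] unary_recursive_fst g(1)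
        unary_recursive_const)
  moreover have "\<exists>k. f (prod_encode (n, k)) = 0" for n
  proof (cases "\<exists>x. n = enc (x :: 'a)")
    case True
    then obtain x :: 'a where x: "n = enc x" by blast
    obtain k where "P x k" using ex by blast
    then show ?thesis using c(2)[of n] x by (auto simp: f_def g(2) enc_bool_def)
  qed (use c(2)[of n] in \<open>auto simp: f_def\<close>)
  ultimately have "unary_recursive (\<lambda>n. LEAST k. f (prod_encode (n, k)) = 0)"
    by (rule unary_recursive_Least)
  moreover have "f (prod_encode (enc x, k)) = 0 \<longleftrightarrow> P x k" for x k
    using c(2)[of "enc x"] by (auto simp: f_def g(2) enc_bool_def)
  ultimately show ?thesis by (intro computableI) auto
qed

lemma computable_Cons [computable_intros]:
  assumes "computable f" "computable g" shows "computable (\<lambda>x. f x # g x)"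
  by (rule computable_binary[of "\<lambda>x y. Suc (prod_encode (x, y))", OF _ _ assms])
    (auto simp: enc_list_def intro: binary_recursive_unary[OF unary_recursive_Suc] binary_recursive_pair)

lemma computable_case_list [computable_intros]:
  assumes L: "computable L" and A: "computable A"
    and B: "computable (\<lambda>p. B (fst p) (fst (snd p)) (snd (snd p)))"
  shows "computable (\<lambda>x. case L x of [] \<Rightarrow> A x | y # ys \<Rightarrow> B x y ys)"
proof -
  from L A obtain l a where la: "unary_recursive l" "\<And>x. l (enc x) = enc (L x)"
    "unary_recursive a" "\<And>x. a (enc x) = enc (A x)" unfolding computable_def by metis
  from B obtain b where b: "unary_recursive b"
    "\<And>x. b (enc x) = enc (B (fst x) (fst (snd x)) (snd (snd x)))"
    unfolding computable_def by metis
  have b': "b (prod_encode (enc x, prod_encode (enc y, list_encode (map enc ys)))) = enc (B x y ys)"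
    for x y ys using b(2)[of "(x, y, ys)"] by (simp add: enc_prod_def enc_list_def)
  \<comment> \<open>The code of a nonempty list is the successor of the code of the pair of head and
    tail, so \<open>l n - 1\<close> is already the code of \<open>(y, ys)\<close>.\<close>
  have "unary_recursive (\<lambda>n. if l n = 0 then a n else b (prod_encode (n, l n - 1)))"
    by (intro unary_recursive_if la unary_recursive_comp[OF b(1)] unary_recursive_pair
        unary_recursive_id unary_recursive_comp[OF unary_recursive_pred la(1)])
  then show ?thesis
  proof (rule computableI)
    fix x show "(if l (enc x) = 0 then a (enc x) else b (prod_encode (enc x, l (enc x) - 1))) =
      enc (case L x of [] \<Rightarrow> A x | y # ys \<Rightarrow> B x y ys)"
      by (cases "L x") (simp_all add: la enc_list_def b')
  qed
qed

subsection \<open>Well-founded recursion\<close>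

text \<open>A function given by a well-founded recursion is evaluated by a stack machine.  A frame
  consists of an argument, the arguments still to be evaluated, and the values found so far, the
  latest one first.\<close>

context
  fixes q :: "'a::encodable \<Rightarrow> 'a list" and out :: "'a \<Rightarrow> 'b::encodable list \<Rightarrow> 'b"
begin

definition machine_step ::
    "('a \<times> 'a list \<times> 'b list) list \<times> 'b list \<Rightarrow> ('a \<times> 'a list \<times> 'b list) list \<times> 'b list" where
  "machine_step s = (case fst s of [] \<Rightarrow> s
    | frame # rest \<Rightarrow> (case fst (snd frame) of
        [] \<Rightarrow> (case rest of [] \<Rightarrow> ([], [out (fst frame) (snd (snd frame))])
           | next_frame # rest' \<Rightarrow>
               ((fst next_frame, fst (snd next_frame),
                 out (fst frame) (snd (snd frame)) # snd (snd next_frame)) # rest', snd s))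
      | y # ys \<Rightarrow> ((y, q y, []) # (fst frame, ys, snd (snd frame)) # rest, snd s)))"

lemma computable_machine_step:
  assumes "computable q" "computable (\<lambda>p. out (fst p) (snd p))"
  shows "computable machine_step"
  unfolding machine_step_def
  by (intro computable_intros computable_comp2[OF assms(2)] computable_comp[OF assms(1)])

text \<open>By well-founded induction on \<open>y\<close>, a frame for \<open>y\<close> on top of
  any stack is eventually replaced by the value \<open>f y\<close>, delivered to the frame below.
  The halting time is found by minimisation, which is regular because every run halts.\<close>

lemma computable_recursion_rev:
  fixes f :: "'a \<Rightarrow> 'b"
  assumes comp: "computable q" "computable (\<lambda>p. out (fst p) (snd p))"
    and wf: "wf R" "\<And>x y. y \<in> set (q x) \<Longrightarrow> (y, x) \<in> R"
    and f: "\<And>x. f x = out x (rev (map f (q x)))"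
  shows "computable f"
proof -
  define init where "init x = ([(x, q x, [] :: 'b list)], [] :: 'b list)" for x
  define steps where "steps n = machine_step ^^ n" for n
  have steps_add: "steps (m + n) s = steps n (steps m s)" for m n s
    unfolding steps_def by (metis add.commute comp_apply funpow_add)
  have steps_1: "steps 1 s = machine_step s" for s by (simp add: steps_def)
  \<comment> \<open>The hypothesis on single calls is restricted to members of \<open>ys'\<close>,
    so that the statement can be used inside the induction that proves \<open>call\<close>, where
    only smaller arguments are known.\<close>
  have queries: "\<exists>n. steps n ((x, ys, rs) # S, v) = ((x, [], rev (map f ys) @ rs) # S, v)"
    if call_y: "\<And>y rs x ys S v. y \<in> set ys' \<Longrightarrow>
      \<exists>n. steps n ((y, q y, []) # (x, ys, rs) # S, v) = ((x, ys, f y # rs) # S, v)"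
      and subset: "set ys \<subseteq> set ys'" for x ys ys' rs S v
    using subset
  proof (induction ys arbitrary: rs)
    case Nil
    show ?case by (rule exI[of _ 0]) (simp add: steps_def)
  next
    case (Cons y ys)
    have "steps 1 ((x, y # ys, rs) # S, v) = ((y, q y, []) # (x, ys, rs) # S, v)"
      unfolding steps_1 by (simp add: machine_step_def)
    moreover obtain n where "steps n ((y, q y, []) # (x, ys, rs) # S, v) = ((x, ys, f y # rs) # S, v)"
      using call_y[of y] Cons.prems by (meson list.set_intros(1) subset_iff)
    moreover obtain m where "steps m ((x, ys, f y # rs) # S, v) =
        ((x, [], rev (map f ys) @ f y # rs) # S, v)"
      using Cons.IH[of "f y # rs"] Cons.prems by auto
    ultimately show ?case
      by (intro exI[of _ "1 + (n + m)"]) (simp only: steps_add, simp)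
  qed
  have call: "\<exists>n. steps n ((y, q y, []) # (x, ys, rs) # S, v) = ((x, ys, f y # rs) # S, v)"
    for y x ys rs S v
    using wf(1)
  proof (induction y arbitrary: x ys rs S v)
    case (less y)
    from less wf(2)[of _ y] queries[of "q y" "q y" y "[]" "(x, ys, rs) # S" v]
    obtain n where "steps n ((y, q y, []) # (x, ys, rs) # S, v) =
        ((y, [], rev (map f (q y))) # (x, ys, rs) # S, v)" by fastforce
    then have "steps (n + 1) ((y, q y, []) # (x, ys, rs) # S, v) = ((x, ys, f y # rs) # S, v)"
      unfolding steps_add steps_1 by (simp add: machine_step_def f[of y])
    then show ?case by blast
  qed
  have final: "\<exists>n. steps n (init x) = ([], [f x])" for x
  proof -
    from queries[of "q x" "q x" x "[]" "[]" "[]"] call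
    obtain n where "steps n (init x) = ([(x, [], rev (map f (q x)))], [])"
      unfolding init_def by fastforce
    then have "steps (n + 1) (init x) = ([], [f x])"
      unfolding steps_add steps_1 by (simp add: machine_step_def f[of x])
    then show ?thesis by blast
  qed
  \<comment> \<open>Halted states are fixed points; hence the least halting time shows the same
    value as any later time.\<close>
  have stop: "steps n ([], v) = ([], v)" for n v
    unfolding steps_def by (induction n) (auto simp: machine_step_def)
  have unique: "steps (LEAST n. fst (steps n (init x)) = []) (init x) = ([], [f x])" for x
  proof -
    let ?m = "LEAST n. fst (steps n (init x)) = []"
    obtain n where n: "steps n (init x) = ([], [f x])" using final by blast
    then have "fst (steps ?m (init x)) = []" "?m \<le> n"
      by (auto intro: LeastI[of "\<lambda>n. fst (steps n (init x)) = []" n] Least_le)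
    moreover from this obtain v where "steps ?m (init x) = ([], v)" by (metis prod.collapse)
    ultimately show ?thesis using n stop[of "n - ?m" v] steps_add[of ?m "n - ?m" "init x"] by simp
  qed
  have cs: "computable (\<lambda>p. steps (snd p) (init (fst p)))"
    unfolding steps_def init_def
    by (intro computable_intros computable_comp[OF computable_machine_step] comp
        computable_comp[OF comp(1)])
  have cL: "computable (\<lambda>x. LEAST n. fst (steps n (init x)) = [])"
    by (intro computable_intros cs) (use final in \<open>metis fst_conv\<close>)
  have "computable (\<lambda>x. case snd (steps (LEAST n. fst (steps n (init x)) = []) (init x)) of
      [] \<Rightarrow> undefined | y # ys \<Rightarrow> y)"
    by (intro computable_intros computable_comp2[where f = "\<lambda>x n. steps n (init x)", OF cs] cL)
  then show ?thesis by (simp add: unique)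
qed

end

subsection \<open>Lists\<close>

lemma computable_foldr [computable_intros]:
  fixes F :: "'a::encodable \<Rightarrow> 'c::encodable \<Rightarrow> 'b::encodable \<Rightarrow> 'b"
  assumes F: "computable (\<lambda>p. F (fst p) (fst (snd p)) (snd (snd p)))"
    and L: "computable L" and B: "computable B"
  shows "computable (\<lambda>x. foldr (\<lambda>a b. F x a b) (L x) (B x))"
proof -
  have F': "computable (\<lambda>x. F (u x) (v x) (w x))"
    if "computable u" "computable v" "computable w" for u v w and x :: "'d::encodable"
    using computable_comp[OF F computable_Pair[OF that(1) computable_Pair[OF that(2,3)]]] by simp
  have "computable (\<lambda>p. foldr (F (fst p)) (snd p) (B (fst p)))"
  proof (rule computable_recursion_rev[of
        "\<lambda>p. case snd p of [] \<Rightarrow> [] | a # as \<Rightarrow> [(fst p, as)]"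
        "\<lambda>p rs. case snd p of [] \<Rightarrow> B (fst p) | a # as \<Rightarrow>
           (case rs of [] \<Rightarrow> B (fst p) | r # rs' \<Rightarrow> F (fst p) a r)"
        "Wellfounded.measure (\<lambda>p. length (snd p))"], goal_cases)
    case 1
    show ?case by (intro computable_intros)
  next
    case 2
    show ?case by (intro computable_intros F' computable_comp[OF B])
  next
    case (4 x y)
    then show ?case by (cases "snd x") auto
  next
    case (5 p)
    show ?case by (cases "snd p") auto
  qed simp
  from computable_comp2[of "\<lambda>x L. foldr (F x) L (B x)", OF this computable_id L] show ?thesis .
qed

lemma computable_map [computable_intros]:
  assumes "computable (\<lambda>p. f (fst p) (snd p))" "computable L"
  shows "computable (\<lambda>x. map (\<lambda>y. f x y) (L x))"
proof -
  have "computable (\<lambda>x. foldr (\<lambda>y ys. f x y # ys) (L x) [])"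
    by (intro computable_intros computable_comp2[OF assms(1)] assms)
  moreover have "foldr (\<lambda>y ys. f x y # ys) l [] = map (f x) l" for x l by (induction l) auto
  ultimately show ?thesis by simp
qed

lemma computable_append [computable_intros]:
  assumes "computable f" "computable g" shows "computable (\<lambda>x. f x @ g x)"
proof -
  have "computable (\<lambda>x. foldr (\<lambda>y ys. y # ys) (f x) (g x))"
    by (intro computable_intros assms)
  moreover have "foldr (\<lambda>y ys. y # ys) l m = l @ m" for l m :: "'b list" by (induction l) auto
  ultimately show ?thesis by simp
qed

lemma computable_concat [computable_intros]:
  assumes "computable f" shows "computable (\<lambda>x. concat (f x))"
  unfolding concat_conv_foldr by (intro computable_intros assms)

lemma computable_rev [computable_intros]:
  assumes "computable f" shows "computable (\<lambda>x. rev (f x))"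
proof -
  have "computable (\<lambda>x. foldr (\<lambda>y ys. ys @ [y]) (f x) [])"
    by (intro computable_intros assms)
  moreover have "foldr (\<lambda>y ys. ys @ [y]) l [] = rev l" for l :: "'b list" by (induction l) auto
  ultimately show ?thesis by simp
qed

lemma computable_filter [computable_intros]:
  assumes "computable (\<lambda>p. P (fst p) (snd p))" "computable L"
  shows "computable (\<lambda>x. filter (\<lambda>y. P x y) (L x))"
proof -
  have "computable (\<lambda>x. foldr (\<lambda>y ys. if P x y then y # ys else ys) (L x) [])"
    by (intro computable_intros computable_comp2[OF assms(1)] assms)
  moreover have "foldr (\<lambda>y ys. if P x y then y # ys else ys) l [] = filter (P x) l" for x l
    by (induction l) auto
  ultimately show ?thesis by simp
qed

lemma computable_bex_list [computable_intros]:
  assumes "computable (\<lambda>p. P (fst p) (snd p))" "computable L"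
  shows "computable (\<lambda>x. \<exists>y\<in>set (L x). P x y)"
proof -
  have "computable (\<lambda>x. foldr (\<lambda>y b. P x y \<or> b) (L x) False)"
    by (intro computable_intros computable_comp2[OF assms(1)] assms)
  moreover have "foldr (\<lambda>y b. P x y \<or> b) l False = (\<exists>y\<in>set l. P x y)" for x l
    by (induction l) auto
  ultimately show ?thesis by simp
qed

lemma computable_ball_list [computable_intros]:
  assumes "computable (\<lambda>p. P (fst p) (snd p))" "computable L"
  shows "computable (\<lambda>x. \<forall>y\<in>set (L x). P x y)"
proof -
  have "computable (\<lambda>x. \<not> (\<exists>y\<in>set (L x). \<not> P x y))"
    by (intro computable_intros computable_comp2[OF assms(1)] assms)
  then show ?thesis by simp
qed

lemma computable_member [computable_intros]:
  assumes "computable f" "computable L" shows "computable (\<lambda>x. f x \<in> set (L x))"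
proof -
  have "computable (\<lambda>x. \<exists>y\<in>set (L x). y = f x)"
    by (intro computable_intros computable_comp[OF assms(1)] assms)
  then show ?thesis by simp
qed

lemma computable_length [computable_intros]:
  assumes "computable f" shows "computable (\<lambda>x. length (f x))"
proof -
  have "computable (\<lambda>x. foldr (\<lambda>y n. Suc n) (f x) 0)"
    by (intro computable_intros assms)
  moreover have "foldr (\<lambda>y n. Suc n) l 0 = length l" for l :: "'b list" by (induction l) auto
  ultimately show ?thesis by simp
qed

lemma computable_tl [computable_intros]:
  assumes "computable f" shows "computable (\<lambda>x. tl (f x))"
proof -
  have "computable (\<lambda>x. case f x of [] \<Rightarrow> [] | y # ys \<Rightarrow> ys)"
    by (intro computable_intros assms)
  then show ?thesis by (simp add: tl_def)
qed

text \<open>Total versions of \<open>hd\<close> and \<open>!\<close> with an explicit default, so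
  that their computability follows from that of \<open>case\<close> on lists.\<close>

definition head_or :: "'a \<Rightarrow> 'a list \<Rightarrow> 'a" where
  "head_or d xs = (case xs of [] \<Rightarrow> d | y # ys \<Rightarrow> y)"

lemma head_or_simps [simp]: "head_or d [] = d" "head_or d (x # xs) = x"
  by (simp_all add: head_or_def)

lemma computable_head_or [computable_intros]:
  "computable d \<Longrightarrow> computable f \<Longrightarrow> computable (\<lambda>x. head_or (d x) (f x))"
  unfolding head_or_def by (intro computable_intros; assumption?)

definition nth_or :: "'a \<Rightarrow> 'a list \<Rightarrow> nat \<Rightarrow> 'a" where
  "nth_or d xs n = head_or d ((tl ^^ n) xs)"

lemma nth_or_eq: "nth_or d xs n = (if n < length xs then xs ! n else d)"
proof -
  have *: "(tl ^^ n) xs = drop n xs" by (induction n) (auto simp: drop_Suc tl_drop)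
  show ?thesis unfolding nth_or_def * by (auto simp: Cons_nth_drop_Suc[symmetric])
qed

lemma computable_nth_or [computable_intros]:
  "computable d \<Longrightarrow> computable f \<Longrightarrow> computable n \<Longrightarrow> computable (\<lambda>x. nth_or (d x) (f x) (n x))"
  unfolding nth_or_def by (intro computable_intros; assumption?)

lemma computable_upt [computable_intros]:
  assumes "computable n" shows "computable (\<lambda>x. [0..<n x])"
proof -
  have "computable (\<lambda>x. rec_nat [] (\<lambda>k ks. ks @ [k]) (n x))"
    by (intro computable_intros assms)
  moreover have "rec_nat [] (\<lambda>k ks. ks @ [k]) m = [0..<m]" for m by (induction m) auto
  ultimately show ?thesis by simp
qed

lemma computable_zip [computable_intros]:
  assumes "computable f" "computable g" shows "computable (\<lambda>x. zip (f x) (g x))"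
proof -
  \<comment> \<open>The fold over \<open>rev (f x)\<close> runs through \<open>f x\<close> from the
    left; its state holds the rest of the second list and the pairs so far in reverse.\<close>
  have "computable (\<lambda>x. rev (snd (foldr (\<lambda>a p. case fst p of [] \<Rightarrow> p
      | b # bs \<Rightarrow> (bs, (a, b) # snd p)) (rev (f x)) (g x, []))))"
    by (intro computable_intros assms)
  moreover have "rev (snd (foldr (\<lambda>a p. case fst p of [] \<Rightarrow> p
      | b # bs \<Rightarrow> (bs, (a, b) # snd p)) (rev l) (m, r))) = rev r @ zip l m"
    for l :: "'b list" and m :: "'c list" and r
  proof (induction l arbitrary: m r)
    case (Cons a l)
    show ?case
    proof (cases m)
      case Nil
      then show ?thesis using Cons.IH[of m r] by simp
    next
      case (Cons b bs)
      then show ?thesis using Cons.IH[of bs "(a, b) # r"] by simp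
    qed
  qed auto
  ultimately show ?thesis by simp
qed

lemma computable_recursion:
  fixes f :: "'a::encodable \<Rightarrow> 'b::encodable"
  assumes "computable q" "computable (\<lambda>p. out (fst p) (snd p))"
    and "wf R" "\<And>x y. y \<in> set (q x) \<Longrightarrow> (y, x) \<in> R"
    and "\<And>x. f x = out x (map f (q x))"
  shows "computable f"
proof (rule computable_recursion_rev[of q "\<lambda>x rs. out x (rev rs)" R])
  show "computable (\<lambda>p. out (fst p) (rev (snd p)))"
    by (intro computable_comp2[OF assms(2)] computable_intros)
qed (use assms in auto)

subsection \<open>Codes of pairs and lists\<close>

lemma computable_prod_decode [computable_intros]:
  "computable f \<Longrightarrow> computable (\<lambda>x. prod_decode (f x))"
  by (rule computable_comp[rotated], assumption)
    (rule computableI[OF unary_recursive_id], simp add: enc_prod_def)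

lemma computable_enc [computable_intros]: "computable f \<Longrightarrow> computable (\<lambda>x. enc (f x))"
  by (rule computable_comp[rotated], assumption)
    (rule computableI[OF unary_recursive_id], simp)

lemma computable_nat_iff: "computable (f :: nat \<Rightarrow> nat) \<longleftrightarrow> unary_recursive f"
  unfolding computable_def enc_nat_def by (simp flip: fun_eq_iff)

lemma computable_pred_iff: "computable (P :: nat \<Rightarrow> bool) \<longleftrightarrow> unary_recursive (\<lambda>n. if P n then 1 else 0)"
  unfolding computable_def enc_nat_def enc_bool_def by (simp flip: fun_eq_iff)

lemma computable_predD:
  assumes "computable (P :: nat \<Rightarrow> bool)"
  shows "\<exists>c. unary_recursive c \<and> (\<forall>n. c n = 0 \<longleftrightarrow> P n)"
proof (intro exI conjI allI)
  show "unary_recursive (\<lambda>n. if \<not> P n then 1 else 0)"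
    using computable_not[OF assms] unfolding computable_pred_iff .
qed simp

section \<open>Codes of terms and formulas\<close>

text \<open>Common core of the case distinctions on the three syntactic types: a code is a pair of a
  constructor tag and the code of the arguments, and a branch receives the context \<open>x\<close>
  as well. Types with four constructors pass the same function for \<open>h3\<close> and
  \<open>h4\<close>.\<close>

lemma computable_tagged:
  fixes g :: "'a::encodable \<Rightarrow> 'b::encodable"
  assumes g: "computable g" and h: "unary_recursive h0" "unary_recursive h1" "unary_recursive h2"
    "unary_recursive h3" "unary_recursive h4"
    and eq: "\<And>x t m. enc (g x) = prod_encode (t, m) \<Longrightarrow> enc (f x) =
      (if t = 0 then h0 else if t = 1 then h1 else if t = 2 then h2 else if t = 3 then h3 else h4)
        (prod_encode (enc x, m))"
  shows "computable f"
proof -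
  from g obtain g' where g': "unary_recursive g'" "\<And>x. g' (enc x) = enc (g x)"
    unfolding computable_def by metis
  define t where "t n = fst (prod_decode (g' n))" for n
  define p where "p n = prod_encode (n, snd (prod_decode (g' n)))" for n
  have t: "unary_recursive (\<lambda>n. t n - k)" for k unfolding t_def
    by (intro unary_recursive_binary[OF binary_recursive_diff] unary_recursive_const
        unary_recursive_comp[OF unary_recursive_fst] g')
  then have t0: "unary_recursive t" using t[of 0] by simp
  have p: "unary_recursive p" unfolding p_def
    by (intro unary_recursive_pair unary_recursive_id unary_recursive_comp[OF unary_recursive_snd] g')
  have "unary_recursive (\<lambda>n. if t n = 0 then h0 (p n) else if t n - 1 = 0 then h1 (p n)
      else if t n - 2 = 0 then h2 (p n) else if t n - 3 = 0 then h3 (p n) else h4 (p n))"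
    by (intro unary_recursive_if t t0 unary_recursive_comp[OF _ p] h)
  then show ?thesis
  proof (rule computableI)
    fix x :: 'a
    obtain u m where um: "prod_decode (g' (enc x)) = (u, m)" by fastforce
    then have "enc (g x) = prod_encode (u, m)" by (metis g'(2) prod_decode_inverse)
    then show "(if t (enc x) = 0 then h0 (p (enc x)) else if t (enc x) - 1 = 0 then h1 (p (enc x))
      else if t (enc x) - 2 = 0 then h2 (p (enc x)) else if t (enc x) - 3 = 0 then h3 (p (enc x))
      else h4 (p (enc x))) = enc (f x)"
      by (auto simp: eq t_def p_def um)
  qed
qed

lemma computable_pairD:
  assumes "computable (\<lambda>p. f (fst p) (snd p))"
  shows "\<exists>g. unary_recursive g \<and> (\<forall>x y. g (prod_encode (enc x, enc y)) = enc (f x y))"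
proof -
  from assms obtain g where "unary_recursive g" and g: "\<And>p. g (enc p) = enc (f (fst p) (snd p))"
    unfolding computable_def by blast
  moreover have "g (prod_encode (enc x, enc y)) = enc (f x y)" for x y
    using g[of "(x, y)"] by (simp add: enc_prod_def)
  ultimately show ?thesis by blast
qed

lemma computable_tripleD:
  assumes "computable (\<lambda>p. f (fst p) (fst (snd p)) (snd (snd p)))"
  shows "\<exists>g. unary_recursive g \<and>
    (\<forall>x y z. g (prod_encode (enc x, prod_encode (enc y, enc z))) = enc (f x y z))"
proof -
  from computable_pairD[of "\<lambda>x q. f x (fst q) (snd q)"] assms obtain g where "unary_recursive g"
    and g: "\<And>x q. g (prod_encode (enc x, enc q)) = enc (f x (fst q) (snd q))" by blast
  moreover have "g (prod_encode (enc x, prod_encode (enc y, enc z))) = enc (f x y z)" for x y z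
    using g[of x "(y, z)"] by (simp add: enc_prod_def)
  ultimately show ?thesis by blast
qed

lemma computable_code1:
  assumes "\<And>y. enc (C y) = prod_encode (k, enc y)" "computable f"
  shows "computable (\<lambda>x. C (f x))"
  by (rule computable_comp[OF computableI assms(2)],
      rule unary_recursive_pair[OF unary_recursive_const unary_recursive_id]) (rule assms(1)[symmetric])

lemma computable_code2:
  assumes "\<And>y z. enc (C y z) = prod_encode (k, prod_encode (enc y, enc z))" "computable f" "computable g"
  shows "computable (\<lambda>x. C (f x) (g x))"
  using computable_code1[of "\<lambda>p. C (fst p) (snd p)" k "\<lambda>x. (f x, g x)"] computable_Pair[OF assms(2,3)]
  by (simp add: assms(1) enc_prod_def)

text \<open>This fails for the tag 0, since \<open>prod_encode (0, 0) = 0\<close>; recursion on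
  codes therefore descends under positive tags only.\<close>

lemma code_less: "0 < t \<Longrightarrow> m < prod_encode (t, m)"
  unfolding prod_encode_def split by (induction t) (auto simp: trans_less_add2)

lemma code_fst_le: "fst (prod_decode m) \<le> m" and code_snd_le: "snd (prod_decode m) \<le> m"
  by (metis le_prod_encode_1 prod.collapse prod_decode_inverse,
      metis le_prod_encode_2 prod.collapse prod_decode_inverse)

lemma computable_code_recursion:
  fixes f :: "nat \<Rightarrow> bool"
  assumes "computable q" "computable (\<lambda>p. out (fst p) (snd p))"
    and "\<And>n m. m \<in> set (q n) \<Longrightarrow> fst (prod_decode n) > 0 \<and> m \<le> snd (prod_decode n)"
    and "\<And>n. f n = out n (map f (q n))"
  shows "computable f"
proof (rule computable_recursion[OF assms(1,2) wf_less _ assms(4)])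
  fix n m assume "m \<in> set (q n)"
  from assms(3)[OF this] code_less[of "fst (prod_decode n)" "snd (prod_decode n)"]
  show "(m, n) \<in> {(x, y). x < y}" by simp
qed

lemma gterm_ex: "(\<exists>t. P t) \<longleftrightarrow>
    (\<exists>i. P (Var i)) \<or> (\<exists>k. P (Const k)) \<or> P One \<or> (\<exists>t. P (Inverse t)) \<or> (\<exists>s t. P (Times s t))"
  by (metis gterm.exhaust)

text \<open>The \<open>encodable\<close> instance of \<open>gterm\<close> rests on this, so the
  recursion has to run on numbers and not on terms. Being a code is decided from the tag and, for
  the tags 3 and 4, from the decoded components.\<close>

lemma computable_term_code_range: "computable (\<lambda>n. \<exists>t. n = term_code t)"
proof (rule computable_code_recursion[of
    "\<lambda>n. if fst (prod_decode n) = 3 then [snd (prod_decode n)] else if fst (prod_decode n) = 4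
      then [fst (prod_decode (snd (prod_decode n))), snd (prod_decode (snd (prod_decode n)))] else []"
    "\<lambda>n rs. (fst (prod_decode n) = 2 \<longrightarrow> snd (prod_decode n) = 0) \<and> fst (prod_decode n) \<le> 4 \<and>
      (\<forall>r\<in>set rs. r)"], goal_cases)
  case 1
  show ?case by (intro computable_intros)
next
  case 2
  show ?case unfolding imp_conv_disj by (intro computable_intros)
next
  case (3 n m)
  then show ?case by (auto split: if_splits intro: code_fst_le code_snd_le)
next
  case (4 n)
  obtain t m where n: "n = prod_encode (t, m)" by (metis prod_decode_inverse surj_pair)
  obtain a b where m: "m = prod_encode (a, b)" by (metis prod_decode_inverse surj_pair)
  have "t = 0 \<or> t = 1 \<or> t = 2 \<or> t = 3 \<or> t = 4 \<or> t > 4" by linarith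
  then show ?case unfolding n
    by (subst gterm_ex) (auto simp: prod_encode_eq m)
qed

lemma term_code_inj: "term_code s = term_code t \<Longrightarrow> s = t"
proof (induction s arbitrary: t)
  case (Var x) then show ?case by (cases t) (auto simp: prod_encode_eq)
next
  case (Const x) then show ?case by (cases t) (auto simp: prod_encode_eq)
next
  case One then show ?case by (cases t) (auto simp: prod_encode_eq)
next
  case (Inverse s) then show ?case by (cases t) (auto simp: prod_encode_eq)
next
  case (Times s1 s2) then show ?case by (cases t) (auto simp: prod_encode_eq)
qed

instantiation gterm :: encodable
begin
definition enc_gterm :: "gterm \<Rightarrow> nat" where [simp]: "enc_gterm = term_code"
instance
  by standard (use term_code_inj computable_predD[OF computable_term_code_range] in auto)
end

lemma computable_case_gterm [computable_intros]:
  assumes g: "computable g" and A: "computable (\<lambda>p. A (fst p) (snd p))"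
    "computable (\<lambda>p. B (fst p) (snd p))" "computable C" "computable (\<lambda>p. D (fst p) (snd p))"
    "computable (\<lambda>p. E (fst p) (fst (snd p)) (snd (snd p)))"
  shows "computable (\<lambda>x. case g x of Var i \<Rightarrow> A x i | Const k \<Rightarrow> B x k | One \<Rightarrow> C x
    | Inverse t \<Rightarrow> D x t | Times s t \<Rightarrow> E x s t)"
proof -
  have C: "computable (\<lambda>p :: 'a \<times> nat. C (fst p))"
    by (intro computable_comp[OF A(3)] computable_intros)
  from computable_pairD[OF A(1)] obtain a where
    a: "unary_recursive a" "\<And>x y. a (prod_encode (enc x, enc y)) = enc (A x y)" by blast
  from computable_pairD[OF A(2)] obtain b where
    b: "unary_recursive b" "\<And>x y. b (prod_encode (enc x, enc y)) = enc (B x y)" by blast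
  from computable_pairD[of "\<lambda>x (i :: nat). C x", OF C] obtain c where
    c: "unary_recursive c" "\<And>x y. c (prod_encode (enc x, enc (y :: nat))) = enc (C x)" by blast
  from computable_pairD[OF A(4)] obtain d where
    d: "unary_recursive d" "\<And>x y. d (prod_encode (enc x, enc y)) = enc (D x y)" by blast
  from computable_tripleD[OF A(5)] obtain e where
    e: "unary_recursive e"
      "\<And>x y z. e (prod_encode (enc x, prod_encode (enc y, enc z))) = enc (E x y z)" by blast
  note u = a(1) b(1) c(1) d(1) e(1) and v = a(2) b(2) c(2) d(2) e(2)
  show ?thesis
  proof (rule computable_tagged[OF g u])
    fix x t m assume "enc (g x) = prod_encode (t, m)"
    then show "enc (case g x of Var i \<Rightarrow> A x i | Const k \<Rightarrow> B x k | One \<Rightarrow> C x     | Inverse t \<Rightarrow> D x t | Times s t \<Rightarrow> E x s t) = (if t = 0 then a else if t = 1 then b else if t = 2 then c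
      else if t = 3 then d else e) (prod_encode (enc x, m))"
      by (cases "g x") (auto simp: prod_encode_eq v[simplified])
  qed
qed

lemma gformula_ex: "(\<exists>p. P p) \<longleftrightarrow>
    (\<exists>s t. P (Equal s t)) \<or> (\<exists>p. P (Neg p)) \<or> (\<exists>p q. P (Conj p q)) \<or> (\<exists>i p. P (Exists i p))"
  by (metis gformula.exhaust)

lemma computable_formula_code_range: "computable (\<lambda>n. \<exists>p. n = formula_code p)"
proof (rule computable_code_recursion[of
    "\<lambda>n. if fst (prod_decode n) = 1 then [snd (prod_decode n)] else if fst (prod_decode n) = 2
      then [fst (prod_decode (snd (prod_decode n))), snd (prod_decode (snd (prod_decode n)))]
      else if fst (prod_decode n) = 3 then [snd (prod_decode (snd (prod_decode n)))] else []"
    "\<lambda>n rs. (fst (prod_decode n) = 0 \<longrightarrow> (\<exists>t. fst (prod_decode (snd (prod_decode n))) = term_code t) \<and>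
       (\<exists>t. snd (prod_decode (snd (prod_decode n))) = term_code t)) \<and>
      fst (prod_decode n) \<le> 3 \<and> (\<forall>r\<in>set rs. r)"], goal_cases)
  case 1
  show ?case by (intro computable_intros)
next
  case 2
  show ?case unfolding imp_conv_disj
    by (intro computable_intros computable_comp[OF computable_term_code_range])
next
  case (3 n m)
  then show ?case by (auto split: if_splits intro: code_fst_le code_snd_le)
next
  case (4 n)
  obtain t m where n: "n = prod_encode (t, m)" by (metis prod_decode_inverse surj_pair)
  obtain a b where m: "m = prod_encode (a, b)" by (metis prod_decode_inverse surj_pair)
  have "t = 0 \<or> t = 1 \<or> t = 2 \<or> t = 3 \<or> t > 3" by linarith
  then show ?case unfolding n
    by (subst gformula_ex) (auto simp: prod_encode_eq m)
qed

lemma formula_code_inj: "formula_code p = formula_code q \<Longrightarrow> p = q"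
proof (induction p arbitrary: q)
  case (Equal s t) then show ?case by (cases q) (auto simp: prod_encode_eq dest: term_code_inj)
next
  case (Neg p) then show ?case by (cases q) (auto simp: prod_encode_eq)
next
  case (Conj p1 p2) then show ?case by (cases q) (auto simp: prod_encode_eq)
next
  case (Exists i p) then show ?case by (cases q) (auto simp: prod_encode_eq)
qed

instantiation gformula :: encodable
begin
definition enc_gformula :: "gformula \<Rightarrow> nat" where [simp]: "enc_gformula = formula_code"
instance
  by standard (use formula_code_inj computable_predD[OF computable_formula_code_range] in auto)
end

lemma computable_case_gformula [computable_intros]:
  assumes g: "computable g" and A: "computable (\<lambda>p. A (fst p) (fst (snd p)) (snd (snd p)))"
    "computable (\<lambda>p. B (fst p) (snd p))"
    "computable (\<lambda>p. C (fst p) (fst (snd p)) (snd (snd p)))"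
    "computable (\<lambda>p. D (fst p) (fst (snd p)) (snd (snd p)))"
  shows "computable (\<lambda>x. case g x of Equal s t \<Rightarrow> A x s t | Neg p \<Rightarrow> B x p | Conj p q \<Rightarrow> C x p q
    | Exists i p \<Rightarrow> D x i p)"
proof -
  from computable_tripleD[OF A(1)] obtain a where
    a: "unary_recursive a"
      "\<And>x y z. a (prod_encode (enc x, prod_encode (enc y, enc z))) = enc (A x y z)" by blast
  from computable_pairD[OF A(2)] obtain b where
    b: "unary_recursive b" "\<And>x y. b (prod_encode (enc x, enc y)) = enc (B x y)" by blast
  from computable_tripleD[OF A(3)] obtain c where
    c: "unary_recursive c"
      "\<And>x y z. c (prod_encode (enc x, prod_encode (enc y, enc z))) = enc (C x y z)" by blast
  from computable_tripleD[OF A(4)] obtain d where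
    d: "unary_recursive d"
      "\<And>x y z. d (prod_encode (enc x, prod_encode (enc y, enc z))) = enc (D x y z)" by blast
  note u = a(1) b(1) c(1) d(1) and v = a(2) b(2) c(2) d(2)
  show ?thesis
  proof (rule computable_tagged[OF g u u(4)])
    fix x t m assume "enc (g x) = prod_encode (t, m)"
    then show "enc (case g x of Equal s t \<Rightarrow> A x s t | Neg p \<Rightarrow> B x p | Conj p q \<Rightarrow> C x p q     | Exists i p \<Rightarrow> D x i p) = (if t = 0 then a else if t = 1 then b else if t = 2 then c
      else if t = 3 then d else d) (prod_encode (enc x, m))"
      by (cases "g x") (auto simp: prod_encode_eq v[simplified])
  qed
qed

lemma computable_gformula_intros [computable_intros]:
  "computable h \<Longrightarrow> computable h' \<Longrightarrow> computable (\<lambda>x. Equal (h x) (h' x))"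
  "computable f \<Longrightarrow> computable (\<lambda>x. Neg (f x))"
  "computable f \<Longrightarrow> computable f' \<Longrightarrow> computable (\<lambda>x. Conj (f x) (f' x))"
  "computable i \<Longrightarrow> computable f \<Longrightarrow> computable (\<lambda>x. Exists (i x) (f x))"
  by (rule computable_code1 computable_code2, simp; assumption)+


text \<open>\<open>RConst k\<close> stands for the \<open>k\<close>-th element of an enumeration of the constants.\<close>

datatype rterm = RVar nat | RConst nat | RAdd rterm rterm | RMul rterm rterm

primrec rterm_code :: "rterm \<Rightarrow> nat" where
  "rterm_code (RVar i) = prod_encode (0, i)"
| "rterm_code (RConst k) = prod_encode (1, k)"
| "rterm_code (RAdd s t) = prod_encode (2, prod_encode (rterm_code s, rterm_code t))"
| "rterm_code (RMul s t) = prod_encode (3, prod_encode (rterm_code s, rterm_code t))"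

lemma rterm_ex: "(\<exists>t. P t) \<longleftrightarrow>
    (\<exists>i. P (RVar i)) \<or> (\<exists>k. P (RConst k)) \<or> (\<exists>s t. P (RAdd s t)) \<or> (\<exists>s t. P (RMul s t))"
  by (metis rterm.exhaust)

lemma computable_rterm_code_range: "computable (\<lambda>n. \<exists>t. n = rterm_code t)"
proof (rule computable_code_recursion[of
    "\<lambda>n. if fst (prod_decode n) < 2 then [] else
      [fst (prod_decode (snd (prod_decode n))), snd (prod_decode (snd (prod_decode n)))]"
    "\<lambda>n rs. fst (prod_decode n) \<le> 3 \<and> (\<forall>r\<in>set rs. r)"], goal_cases)
  case 1
  show ?case by (intro computable_intros)
next
  case 2
  show ?case by (intro computable_intros)
next
  case (3 n m)
  then show ?case by (auto split: if_splits intro: code_fst_le code_snd_le)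
next
  case (4 n)
  obtain t m where n: "n = prod_encode (t, m)" by (metis prod_decode_inverse surj_pair)
  obtain a b where m: "m = prod_encode (a, b)" by (metis prod_decode_inverse surj_pair)
  have "t = 0 \<or> t = 1 \<or> t = 2 \<or> t = 3 \<or> t > 3" by linarith
  then show ?case unfolding n
    by (subst rterm_ex) (auto simp: prod_encode_eq m)
qed

lemma rterm_code_inj: "rterm_code s = rterm_code t \<Longrightarrow> s = t"
proof (induction s arbitrary: t)
  case (RVar x) then show ?case by (cases t) (auto simp: prod_encode_eq)
next
  case (RConst x) then show ?case by (cases t) (auto simp: prod_encode_eq)
next
  case (RAdd s1 s2) then show ?case by (cases t) (auto simp: prod_encode_eq)
next
  case (RMul s1 s2) then show ?case by (cases t) (auto simp: prod_encode_eq)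
qed

instantiation rterm :: encodable
begin
definition enc_rterm :: "rterm \<Rightarrow> nat" where [simp]: "enc_rterm = rterm_code"
instance
  by standard (use rterm_code_inj computable_predD[OF computable_rterm_code_range] in auto)
end

lemma computable_case_rterm [computable_intros]:
  assumes g: "computable g" and A: "computable (\<lambda>p. A (fst p) (snd p))"
    "computable (\<lambda>p. B (fst p) (snd p))"
    "computable (\<lambda>p. C (fst p) (fst (snd p)) (snd (snd p)))"
    "computable (\<lambda>p. D (fst p) (fst (snd p)) (snd (snd p)))"
  shows "computable (\<lambda>x. case g x of RVar i \<Rightarrow> A x i | RConst k \<Rightarrow> B x k | RAdd s t \<Rightarrow> C x s t
    | RMul s t \<Rightarrow> D x s t)"
proof -
  from computable_pairD[OF A(1)] obtain a where
    a: "unary_recursive a" "\<And>x y. a (prod_encode (enc x, enc y)) = enc (A x y)" by blast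
  from computable_pairD[OF A(2)] obtain b where
    b: "unary_recursive b" "\<And>x y. b (prod_encode (enc x, enc y)) = enc (B x y)" by blast
  from computable_tripleD[OF A(3)] obtain c where
    c: "unary_recursive c"
      "\<And>x y z. c (prod_encode (enc x, prod_encode (enc y, enc z))) = enc (C x y z)" by blast
  from computable_tripleD[OF A(4)] obtain d where
    d: "unary_recursive d"
      "\<And>x y z. d (prod_encode (enc x, prod_encode (enc y, enc z))) = enc (D x y z)" by blast
  note u = a(1) b(1) c(1) d(1) and v = a(2) b(2) c(2) d(2)
  show ?thesis
  proof (rule computable_tagged[OF g u u(4)])
    fix x t m assume "enc (g x) = prod_encode (t, m)"
    then show "enc (case g x of RVar i \<Rightarrow> A x i | RConst k \<Rightarrow> B x k | RAdd s t \<Rightarrow> C x s t     | RMul s t \<Rightarrow> D x s t) = (if t = 0 then a else if t = 1 then b else if t = 2 then c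
      else if t = 3 then d else d) (prod_encode (enc x, m))"
      by (cases "g x") (auto simp: prod_encode_eq v[simplified])
  qed
qed

lemma computable_rterm_intros [computable_intros]:
  "computable f \<Longrightarrow> computable (\<lambda>x. RVar (f x))"
  "computable f \<Longrightarrow> computable (\<lambda>x. RConst (f x))"
  "computable h \<Longrightarrow> computable h' \<Longrightarrow> computable (\<lambda>x. RAdd (h x) (h' x))"
  "computable h \<Longrightarrow> computable h' \<Longrightarrow> computable (\<lambda>x. RMul (h x) (h' x))"
  by (rule computable_code1 computable_code2, simp; assumption)+


section \<open>Structural recursion on terms and formulas\<close>

lemma computable_rec_rterm:
  fixes f :: "'a::encodable \<Rightarrow> rterm \<Rightarrow> 'b::encodable"
  assumes AB: "computable (\<lambda>p. A (fst p) (snd p))" "computable (\<lambda>p. B (fst p) (snd p))"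
    and CD: "computable (\<lambda>p. C (fst p) (fst (snd p)) (snd (snd p)))"
    "computable (\<lambda>p. D (fst p) (fst (snd p)) (snd (snd p)))"
    and f: "\<And>x i. f x (RVar i) = A x i" "\<And>x k. f x (RConst k) = B x k"
    "\<And>x s t. f x (RAdd s t) = C x (f x s) (f x t)" "\<And>x s t. f x (RMul s t) = D x (f x s) (f x t)"
  shows "computable (\<lambda>p. f (fst p) (snd p))"
proof (rule computable_recursion[of
    "\<lambda>p. case snd p of RVar i \<Rightarrow> [] | RConst k \<Rightarrow> [] | RAdd s t \<Rightarrow> [(fst p, s), (fst p, t)]
      | RMul s t \<Rightarrow> [(fst p, s), (fst p, t)]"
    "\<lambda>p rs. case snd p of RVar i \<Rightarrow> A (fst p) i | RConst k \<Rightarrow> B (fst p) k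
      | RAdd s t \<Rightarrow> C (fst p) (nth_or undefined rs 0) (nth_or undefined rs 1)
      | RMul s t \<Rightarrow> D (fst p) (nth_or undefined rs 0) (nth_or undefined rs 1)"
    "Wellfounded.measure (\<lambda>p. size (snd p))"], goal_cases)
  case 1
  show ?case by (intro computable_intros)
next
  case 2
  have CD': "computable (\<lambda>x. C (u x) (v x) (w x))" "computable (\<lambda>x. D (u x) (v x) (w x))"
    if "computable u" "computable v" "computable w" for u v w and x :: "'d::encodable"
    using computable_comp[OF CD(1) computable_Pair[OF that(1) computable_Pair[OF that(2,3)]]]
      computable_comp[OF CD(2) computable_Pair[OF that(1) computable_Pair[OF that(2,3)]]] by simp_all
  show ?case by (intro computable_intros CD' computable_comp2[OF AB(1)] computable_comp2[OF AB(2)])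
next
  case (4 x y)
  then show ?case by (cases "snd x") auto
next
  case (5 p)
  show ?case by (cases "snd p") (auto simp: f nth_or_eq)
qed simp

text \<open>There is no premise for \<open>One\<close>, because the value there is a constant and
  constants are computable.\<close>

lemma computable_rec_gterm:
  fixes f :: "gterm \<Rightarrow> 'b::encodable"
  assumes AB: "computable A" "computable B" "computable D" "computable (\<lambda>p. E (fst p) (snd p))"
    and f: "\<And>i. f (Var i) = A i" "\<And>k. f (Const k) = B k" "\<And>t. f (Inverse t) = D (f t)"
      "\<And>s t. f (Times s t) = E (f s) (f t)"
  shows "computable f"
proof (rule computable_recursion[of
    "\<lambda>t. case t of Var i \<Rightarrow> [] | Const k \<Rightarrow> [] | One \<Rightarrow> [] | Inverse t \<Rightarrow> [t] | Times s t \<Rightarrow> [s, t]"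
    "\<lambda>t rs. case t of Var i \<Rightarrow> A i | Const k \<Rightarrow> B k | One \<Rightarrow> f One
      | Inverse t \<Rightarrow> D (nth_or undefined rs 0)
      | Times s t \<Rightarrow> E (nth_or undefined rs 0) (nth_or undefined rs 1)"
    "Wellfounded.measure size"], goal_cases)
  case 1
  show ?case by (intro computable_intros)
next
  case 2
  show ?case by (intro computable_intros computable_comp[OF AB(1)] computable_comp[OF AB(2)]
      computable_comp[OF AB(3)] computable_comp2[OF AB(4)])
next
  case (4 x y)
  then show ?case by (cases x) auto
next
  case (5 p)
  show ?case by (cases p) (auto simp: f nth_or_eq)
qed simp

lemma computable_rec_gformula:
  fixes f :: "gformula \<Rightarrow> 'b::encodable"
  assumes AB: "computable (\<lambda>p. A (fst p) (snd p))" "computable B"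
    "computable (\<lambda>p. C (fst p) (snd p))" "computable (\<lambda>p. D (fst p) (snd p))"
    and f: "\<And>s t. f (Equal s t) = A s t" "\<And>p. f (Neg p) = B (f p)"
      "\<And>p q. f (Conj p q) = C (f p) (f q)" "\<And>i p. f (Exists i p) = D i (f p)"
  shows "computable f"
proof (rule computable_recursion[of
    "\<lambda>t. case t of Equal s t \<Rightarrow> [] | Neg p \<Rightarrow> [p] | Conj p q \<Rightarrow> [p, q] | Exists i p \<Rightarrow> [p]"
    "\<lambda>t rs. case t of Equal s t \<Rightarrow> A s t | Neg p \<Rightarrow> B (nth_or undefined rs 0)
      | Conj p q \<Rightarrow> C (nth_or undefined rs 0) (nth_or undefined rs 1)
      | Exists i p \<Rightarrow> D i (nth_or undefined rs 0)"
    "Wellfounded.measure size"], goal_cases)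
  case 1
  show ?case by (intro computable_intros)
next
  case 2
  show ?case by (intro computable_intros computable_comp[OF AB(2)]
      computable_comp2[OF AB(1)] computable_comp2[OF AB(3)] computable_comp2[OF AB(4)])
next
  case (4 x y)
  then show ?case by (cases x) auto
next
  case (5 p)
  show ?case by (cases p) (auto simp: f nth_or_eq)
qed simp

text \<open>Decidability speaks of sets of numbers, so numbers that are no codes are rejected first;
  on codes the function realising \<open>f\<close> answers.\<close>

lemma computable_enc_image:
  fixes f :: "'a::encodable \<Rightarrow> bool"
  assumes "computable f"
  shows "computable (\<lambda>n. n \<in> enc ` {x. f x})"
proof -
  obtain c where c: "unary_recursive c" "\<And>n. c n = 0 \<longleftrightarrow> (\<exists>x. n = enc (x :: 'a))"
    using enc_range[where 'a = 'a] by metis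
  from assms obtain g where g: "unary_recursive g" "\<And>x. g (enc x) = enc (f x)"
    unfolding computable_def by metis
  have "unary_recursive (\<lambda>n. if c n = 0 then g n else 0)"
    by (intro unary_recursive_if c g unary_recursive_const)
  moreover have "(if c n = 0 then g n else 0) = (if n \<in> enc ` {x. f x} then 1 else 0)" for n
  proof (cases "c n = 0")
    case True
    then obtain x :: 'a where "n = enc x" using c(2) by metis
    then show ?thesis using True by (auto simp: g(2) enc_bool_def image_iff)
  qed (use c(2)[of n] in auto)
  ultimately show ?thesis unfolding computable_pred_iff by simp
qed

lemma decidable_setI: "computable (\<lambda>n. n \<in> S) \<Longrightarrow> decidable_set S"
  unfolding computable_pred_iff unary_recursive_def decidable_set_def decidable_pred_def .

section \<open>Real polynomials\<close>

text \<open>Polynomials are lists of coefficients, the leading one first; it may vanish.\<close>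

primrec poly_fun :: "real list \<Rightarrow> real \<Rightarrow> real" where
  "poly_fun [] x = 0"
| "poly_fun (a # p) x = a * x ^ length p + poly_fun p x"

primrec poly_deriv :: "real list \<Rightarrow> real list" where
  "poly_deriv [] = []"
| "poly_deriv (a # p) = (if p = [] then [] else (of_nat (length p) * a) # poly_deriv p)"

lemma length_poly_deriv: "length (poly_deriv p) = length p - 1"
  by (induction p) (auto simp: Suc_diff_Suc simp flip: length_greater_0_conv)

lemma poly_fun_deriv: "(poly_fun p has_real_derivative poly_fun (poly_deriv p) x) (at x)"
proof (induction p)
  case (Cons a p)
  have "((\<lambda>x. a * x ^ length p + poly_fun p x) has_real_derivative
      a * (of_nat (length p) * x ^ (length p - 1)) + poly_fun (poly_deriv p) x) (at x)"
    by (rule derivative_eq_intros Cons refl | simp)+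
  then show ?case
    by (cases "p = []") (auto simp: length_poly_deriv algebra_simps poly_fun.simps[abs_def])
qed (simp add: poly_fun.simps[abs_def])

text \<open>Splitting off the leading term leaves a quotient of the same shape times
  \<open>inverse x\<close>. The limit yields the signs of a polynomial near both ends of the
  line.\<close>

lemma poly_fun_limit: "((\<lambda>x. poly_fun (a # p) x / x ^ length p) \<longlongrightarrow> a) at_infinity"
proof (induction p arbitrary: a)
  case (Cons b p)
  have "((\<lambda>x. a + (poly_fun (b # p) x / x ^ length p) * inverse x) \<longlongrightarrow> a + b * 0) at_infinity"
    by (intro tendsto_intros Cons tendsto_inverse_0)
  moreover have "\<forall>\<^sub>F x in at_infinity. a + (poly_fun (b # p) x / x ^ length p) * inverse x =
      poly_fun (a # b # p) x / x ^ length (b # p)"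
    using eventually_not_equal_at_infinity[of 0]
    by eventually_elim (simp add: field_simps)
  ultimately show ?case using Lim_transform_eventually by fastforce
qed simp

text \<open>Signs are natural numbers, so that sign vectors and columns of tables are encodable
  data.\<close>

definition sign_code :: "real \<Rightarrow> nat" where
  "sign_code r = (if r = 0 then 0 else if r > 0 then 1 else 2)"

lemma sign_code_simps: "sign_code r = 0 \<longleftrightarrow> r = 0" "sign_code r = 1 \<longleftrightarrow> r > 0"
    "sign_code r = Suc 0 \<longleftrightarrow> r > 0" "sign_code r = 2 \<longleftrightarrow> r < 0" "sign_code r \<le> 2"
  by (auto simp: sign_code_def)

lemma sign_code_mult_pos: "a > 0 \<Longrightarrow> sign_code (a * r) = sign_code r"
  by (auto simp: sign_code_def zero_less_mult_iff)

definition negate_sign :: "nat \<Rightarrow> nat" where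
  "negate_sign s = (if s = 1 then 2 else if s = 2 then 1 else 0)"

lemma sign_code_minus: "sign_code (- r) = negate_sign (sign_code r)"
  by (auto simp: sign_code_def negate_sign_def)

lemma sign_near_limit:
  assumes "(f \<longlongrightarrow> a) F" "(a :: real) \<noteq> 0"
  shows "\<forall>\<^sub>F x in F. sign_code (f x) = sign_code a"
proof (cases "a > 0")
  case True
  with order_tendstoD(1)[OF assms(1), of 0] show ?thesis
    by (auto elim!: eventually_mono simp: sign_code_def)
next
  case False
  with order_tendstoD(2)[OF assms(1), of 0] assms(2) show ?thesis
    by (auto elim!: eventually_mono simp: sign_code_def)
qed

lemma sign_code_divide_pos: "b > 0 \<Longrightarrow> sign_code (r / b) = sign_code r"
  using sign_code_mult_pos[of "inverse b" r] by (simp add: divide_inverse mult.commute)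

lemma sign_at_top:
  assumes "a \<noteq> 0" shows "\<exists>y. \<forall>x\<ge>y. sign_code (poly_fun (a # p) x) = sign_code a"
proof -
  have "\<forall>\<^sub>F x in at_top. sign_code (poly_fun (a # p) x / x ^ length p) = sign_code a"
    by (intro sign_near_limit tendsto_mono[OF at_top_le_at_infinity poly_fun_limit] assms)
  moreover have "\<forall>\<^sub>F x :: real in at_top. x > 0" by (rule eventually_gt_at_top)
  ultimately have "\<forall>\<^sub>F x in at_top. sign_code (poly_fun (a # p) x) = sign_code a"
    by eventually_elim (simp add: sign_code_divide_pos del: poly_fun.simps)
  then show ?thesis by (simp add: eventually_at_top_linorder)
qed

lemma sign_at_bot:
  assumes "a \<noteq> 0"
  shows "\<exists>y. \<forall>x\<le>y. sign_code (poly_fun (a # p) x) =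
    (if even (length p) then sign_code a else negate_sign (sign_code a))"
proof -
  have "\<forall>\<^sub>F x in at_bot. sign_code (poly_fun (a # p) x / x ^ length p) = sign_code a"
    by (intro sign_near_limit tendsto_mono[OF at_bot_le_at_infinity poly_fun_limit] assms)
  moreover have "\<forall>\<^sub>F x :: real in at_bot. x < 0"
    unfolding eventually_at_bot_dense by blast
  ultimately have "\<forall>\<^sub>F x in at_bot. sign_code (poly_fun (a # p) x) =
    (if even (length p) then sign_code a else negate_sign (sign_code a))"
  proof eventually_elim
    case (elim x)
    show ?case
    proof (cases "even (length p)")
      case True
      then have "x ^ length p > 0" using elim by (simp add: zero_less_power_eq)
      then show ?thesis using elim True by (simp add: sign_code_divide_pos del: poly_fun.simps)
    next
      case False
      then have "- (x ^ length p) > 0" using elim by (simp add: power_less_zero_eq)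
      then have "sign_code (poly_fun (a # p) x) = sign_code (- (poly_fun (a # p) x / x ^ length p))"
        using sign_code_divide_pos[of "- (x ^ length p)" "poly_fun (a # p) x"]
        by (simp del: poly_fun.simps)
      then show ?thesis using elim False by (simp add: sign_code_minus del: poly_fun.simps)
    qed
  qed
  then show ?thesis by (simp add: eventually_at_bot_linorder)
qed

text \<open>The derivative also vanishes on \<open>U\<close>, and its leading coefficient is
  \<open>of_nat (length p) * a\<close>. The lemma excludes that the derivative of a nonconstant
  polynomial with nonzero leading coefficient is identically 0 on a cell.\<close>

lemma poly_fun_vanish_open:
  assumes "open U" "U \<noteq> {}" "\<And>x. x \<in> U \<Longrightarrow> poly_fun (a # p) x = 0"
  shows "a = 0"
  using assms(3)
proof (induction "length p" arbitrary: a p)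
  case 0
  then show ?case using assms(2) by auto
next
  case (Suc n)
  then have p: "p \<noteq> []" "length (poly_deriv p) = n" by (auto simp: length_poly_deriv)
  have "poly_fun (poly_deriv (a # p)) x = 0" if "x \<in> U" for x
  proof -
    have "((\<lambda>x. 0) has_real_derivative poly_fun (poly_deriv (a # p)) x) (at x)"
      by (rule has_field_derivative_transform_within_open[OF poly_fun_deriv assms(1) that Suc.prems])
    then show ?thesis using DERIV_unique DERIV_const by blast
  qed
  then have "of_nat (length p) * a = 0"
    using Suc.hyps(1)[of "poly_deriv p" "of_nat (length p) * a"] p by simp
  then show ?case using p by simp
qed

section \<open>Signs on an interval of monotonicity\<close>

text \<open>A cell is written as \<open>X \<inter> Y\<close> with \<open>X\<close> bounded at most
  on the left and \<open>Y\<close> at most on the right, so that bounded and unbounded cells are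
  treated alike. The sign \<open>s\<close> at the left end may be 0 at a finite point, but not at
  infinity, where it comes from a nonzero leading coefficient.\<close>

definition left_sign :: "(real \<Rightarrow> real) \<Rightarrow> real set \<Rightarrow> nat \<Rightarrow> bool" where
  "left_sign f X s \<longleftrightarrow> (X = UNIV \<and> s \<noteq> 0 \<and> (\<exists>y. \<forall>x\<le>y. sign_code (f x) = s)) \<or>
    (\<exists>a. X = {a<..} \<and> s = sign_code (f a))"

definition right_sign :: "(real \<Rightarrow> real) \<Rightarrow> real set \<Rightarrow> nat \<Rightarrow> bool" where
  "right_sign f Y r \<longleftrightarrow> (Y = UNIV \<and> r \<noteq> 0 \<and> (\<exists>y. \<forall>x\<ge>y. sign_code (f x) = r)) \<or>
    (\<exists>b. Y = {..<b} \<and> r = sign_code (f b))"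

lemma sign_near:
  assumes "continuous_on UNIV f" "f a \<noteq> (0 :: real)"
  shows "\<exists>d>0. \<forall>x :: real. \<bar>x - a\<bar> < d \<longrightarrow> sign_code (f x) = sign_code (f a)"
proof -
  have "(f \<longlongrightarrow> f a) (at a)" using assms(1) by (simp add: continuous_on_def)
  from sign_near_limit[OF this assms(2)] obtain d where "d > 0"
    "\<forall>x. x \<noteq> a \<and> dist x a < d \<longrightarrow> sign_code (f x) = sign_code (f a)"
    by (auto simp: eventually_at)
  then have "sign_code (f x) = sign_code (f a)" if "\<bar>x - a\<bar> < d" for x
    using that by (cases "x = a") (auto simp: dist_real_def)
  with \<open>d > 0\<close> show ?thesis by blast
qed

text \<open>The monotonicity hypothesis asks only the open interval between \<open>x\<close> and
  \<open>y\<close> to lie in the cell, so it also compares the end point \<open>a\<close>, which is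
  outside, with points inside. A zero at \<open>a\<close> thus forces positive values, while a
  nonzero value keeps its sign nearby by continuity.\<close>

lemma left_sign_cases:
  assumes cont: "continuous_on UNIV f" and X: "left_sign f X s"
    and Y: "Y = UNIV \<or> (\<exists>b. Y = {..<b})" and ne: "X \<inter> Y \<noteq> {}"
    and mono: "\<And>x y. x < y \<Longrightarrow> {x<..<y} \<subseteq> X \<inter> Y \<Longrightarrow> f x < f y"
  shows "s = 0 \<and> (\<forall>x\<in>X \<inter> Y. f x > 0) \<or>
    s \<noteq> 0 \<and> (\<exists>y\<in>X \<inter> Y. \<forall>x\<in>X \<inter> Y. x \<le> y \<longrightarrow> sign_code (f x) = s)"
  using X unfolding left_sign_def
proof (elim disjE conjE exE)
  fix y assume y: "X = UNIV" "s \<noteq> 0" "\<forall>x\<le>y. sign_code (f x) = s"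
  obtain c where c: "c \<in> X \<inter> Y" using ne by blast
  have "min c y \<in> X \<inter> Y" using Y c y(1) by auto
  then show ?thesis using y by (intro disjI2 conjI bexI[of _ "min c y"]) auto
next
  fix a assume a: "X = {a<..}" "s = sign_code (f a)"
  show ?thesis
  proof (cases "f a = 0")
    case True
    have "f x > 0" if "x \<in> X \<inter> Y" for x
    proof -
      have "a < x" "{a<..<x} \<subseteq> X \<inter> Y" using that Y a(1) by auto
      from mono[OF this] show ?thesis using True by simp
    qed
    then show ?thesis using True a(2) by (auto simp: sign_code_def)
  next
    case False
    obtain d where d: "d > 0" "\<And>x. \<bar>x - a\<bar> < d \<Longrightarrow> sign_code (f x) = sign_code (f a)"
      using sign_near[OF cont False] by blast
    obtain c where c: "c \<in> X \<inter> Y" using ne by blast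
    have "min c (a + d / 2) \<in> X \<inter> Y" using Y c a(1) d(1) by auto
    moreover have "sign_code (f x) = s" if "x \<in> X" "x \<le> min c (a + d / 2)" for x
      using that d(1) d(2)[of x] a by auto
    ultimately show ?thesis using False a(2)
      by (intro disjI2 conjI bexI[of _ "min c (a + d / 2)"]) (auto simp: sign_code_simps)
  qed
qed

lemma right_sign_cases:
  assumes cont: "continuous_on UNIV f" and Y: "right_sign f Y r"
    and X: "X = UNIV \<or> (\<exists>a. X = {a<..})" and ne: "X \<inter> Y \<noteq> {}"
    and mono: "\<And>x y. x < y \<Longrightarrow> {x<..<y} \<subseteq> X \<inter> Y \<Longrightarrow> f x < f y"
  shows "r = 0 \<and> (\<forall>x\<in>X \<inter> Y. f x < 0) \<or>
    r \<noteq> 0 \<and> (\<exists>y\<in>X \<inter> Y. \<forall>x\<in>X \<inter> Y. y \<le> x \<longrightarrow> sign_code (f x) = r)"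
  using Y unfolding right_sign_def
proof (elim disjE conjE exE)
  fix y assume y: "Y = UNIV" "r \<noteq> 0" "\<forall>x\<ge>y. sign_code (f x) = r"
  obtain c where c: "c \<in> X \<inter> Y" using ne by blast
  have "max c y \<in> X \<inter> Y" using X c y(1) by auto
  then show ?thesis using y by (intro disjI2 conjI bexI[of _ "max c y"]) auto
next
  fix b assume b: "Y = {..<b}" "r = sign_code (f b)"
  show ?thesis
  proof (cases "f b = 0")
    case True
    have "f x < 0" if "x \<in> X \<inter> Y" for x
    proof -
      have "x < b" "{x<..<b} \<subseteq> X \<inter> Y" using that X b(1) by auto
      from mono[OF this] show ?thesis using True by simp
    qed
    then show ?thesis using True b(2) by (auto simp: sign_code_def)
  next
    case False
    obtain d where d: "d > 0" "\<And>x. \<bar>x - b\<bar> < d \<Longrightarrow> sign_code (f x) = sign_code (f b)"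
      using sign_near[OF cont False] by blast
    obtain c where c: "c \<in> X \<inter> Y" using ne by blast
    have "max c (b - d / 2) \<in> X \<inter> Y" using X c b(1) d(1) by auto
    moreover have "sign_code (f x) = r" if "x \<in> Y" "max c (b - d / 2) \<le> x" for x
      using that d(1) d(2)[of x] b by auto
    ultimately show ?thesis using False b(2)
      by (intro disjI2 conjI bexI[of _ "max c (b - d / 2)"]) (auto simp: sign_code_simps)
  qed
qed

lemma sign_le_2: "left_sign f X s \<Longrightarrow> s \<le> 2" "right_sign f X s \<Longrightarrow> s \<le> 2"
  unfolding left_sign_def right_sign_def using sign_code_simps(5) by blast+

text \<open>An increasing function has at most one zero in a cell, and whether it has one is read
  off from the signs at the ends. At most one end sign vanishes, and then the other one holds
  throughout.\<close>

lemma increasing_signs: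
  assumes cont: "continuous_on UNIV f" and X: "left_sign f X s" and Y: "right_sign f Y r"
    and ne: "X \<inter> Y \<noteq> {}" and mono: "\<And>x y. x < y \<Longrightarrow> {x<..<y} \<subseteq> X \<inter> Y \<Longrightarrow> f x < f y"
  shows "if s \<noteq> 0 \<and> r \<noteq> 0 \<and> s \<noteq> r
    then \<exists>z\<in>X \<inter> Y. f z = 0 \<and> (\<forall>x\<in>X \<inter> Y. x < z \<longrightarrow> sign_code (f x) = s) \<and>
      (\<forall>x\<in>X \<inter> Y. z < x \<longrightarrow> sign_code (f x) = r)
    else \<forall>x\<in>X \<inter> Y. sign_code (f x) = (if s = 0 then r else s)"
proof -
  have X': "X = UNIV \<or> (\<exists>a. X = {a<..})" and Y': "Y = UNIV \<or> (\<exists>b. Y = {..<b})"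
    using X Y unfolding left_sign_def right_sign_def by auto
  have conv: "z \<in> X \<inter> Y" if "x \<in> X \<inter> Y" "y \<in> X \<inter> Y" "x \<le> z" "z \<le> y" for x y z
    using that X' Y' by auto
  have less: "f x < f y" if "x \<in> X \<inter> Y" "y \<in> X \<inter> Y" "x < y" for x y
  proof (rule mono[OF that(3)], rule subsetI)
    fix z assume "z \<in> {x<..<y}"
    then show "z \<in> X \<inter> Y" using conv[OF that(1,2), of z] by simp
  qed
  have L: "s = 0 \<and> (\<forall>x\<in>X \<inter> Y. f x > 0) \<or>
    s \<noteq> 0 \<and> (\<exists>y\<in>X \<inter> Y. \<forall>x\<in>X \<inter> Y. x \<le> y \<longrightarrow> sign_code (f x) = s)"
    by (rule left_sign_cases[OF cont X Y' ne mono])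
  have R: "r = 0 \<and> (\<forall>x\<in>X \<inter> Y. f x < 0) \<or>
    r \<noteq> 0 \<and> (\<exists>y\<in>X \<inter> Y. \<forall>x\<in>X \<inter> Y. y \<le> x \<longrightarrow> sign_code (f x) = r)"
    by (rule right_sign_cases[OF cont Y X' ne mono])
  obtain c where c: "c \<in> X \<inter> Y" using ne by blast
  consider "s = 0" | "s \<noteq> 0" "r = 0" | "s \<noteq> 0" "r \<noteq> 0" by blast
  then show ?thesis
  proof cases
    case 1
    then have pos: "\<forall>x\<in>X \<inter> Y. f x > 0" using L by blast
    \<comment> \<open>Otherwise \<open>f\<close> would be negative on the cell as well.\<close>
    then have "r \<noteq> 0" using R c by force
    then obtain y where "y \<in> X \<inter> Y" "sign_code (f y) = r" using R by blast
    then have "r = 1" using pos by (auto simp: sign_code_def)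
    moreover have "sign_code (f x) = 1" if "x \<in> X \<inter> Y" for x
      using pos that by (simp only: sign_code_simps)
    ultimately show ?thesis using 1 by simp
  next
    case 2
    then have neg: "\<forall>x\<in>X \<inter> Y. f x < 0" using R by blast
    obtain y where "y \<in> X \<inter> Y" "sign_code (f y) = s" using L 2 by blast
    then have "s = 2" using neg by (force simp: sign_code_def)
    moreover have "sign_code (f x) = 2" if "x \<in> X \<inter> Y" for x
      using neg that by (simp only: sign_code_simps)
    ultimately show ?thesis using 2 by simp
  next
    case 3
    obtain y where y: "y \<in> X \<inter> Y" "\<And>x. x \<in> X \<inter> Y \<Longrightarrow> x \<le> y \<Longrightarrow> sign_code (f x) = s" using L 3 by blast
    obtain y' where y': "y' \<in> X \<inter> Y" "\<And>x. x \<in> X \<inter> Y \<Longrightarrow> y' \<le> x \<Longrightarrow> sign_code (f x) = r"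
      using R 3 by blast
    have sy: "sign_code (f y) = s" and ry: "sign_code (f y') = r" using y y' by auto
    show ?thesis
    proof (cases "s = r")
      case True
      have "sign_code (f x) = s" if x: "x \<in> X \<inter> Y" for x
      proof (cases "f y > 0")
        case pos: True
        show ?thesis
        proof (cases "x \<le> y")
          case False
          then have "f x > 0" using less[of y x] x y(1) pos by simp
          then show ?thesis using sy pos by (simp add: sign_code_def)
        qed (use y x in auto)
      next
        case neg: False
        then have neg': "f y < 0" "f y' < 0" using sy ry 3 True
          by (auto simp: sign_code_def split: if_splits)
        show ?thesis
        proof (cases "y' \<le> x")
          case False
          then have "f x < 0" using less[of x y'] x y'(1) neg' by simp
          then show ?thesis using sy neg' by (simp add: sign_code_def)
        qed (use y' x True in auto)
      qed
      then show ?thesis using True 3 by simp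
    next
      case False
      \<comment> \<open>Unequal end signs can only mean negative on the left and positive on the
        right: a fall would contradict monotonicity or, if \<open>y' < y\<close>, the constant sign
        \<open>s\<close> to the left of \<open>y\<close>.\<close>
      have "\<not> (f y > 0 \<and> f y' < 0)"
      proof
        assume *: "f y > 0 \<and> f y' < 0"
        then have "y \<noteq> y'" "\<not> y < y'" using less[OF y(1) y'(1)] by auto
        then have "y' < y" by simp
        then show False using y(2)[of y'] y'(1) * sy by (auto simp: sign_code_def)
      qed
      then have neg: "f y < 0" "f y' > 0" and sr: "s = 2" "r = 1" using sy ry 3 False
        by (auto simp: sign_code_def split: if_splits)
      have yy: "y \<le> y'" using less[OF y'(1) y(1)] neg by (cases "y' < y") auto
      obtain z where z: "y \<le> z" "z \<le> y'" "f z = 0"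
        using IVT'[of f y 0 y'] neg yy continuous_on_subset[OF cont] by (metis less_imp_le subset_UNIV)
      have zC: "z \<in> X \<inter> Y" using conv y(1) y'(1) z by blast
      have "sign_code (f x) = s" if "x \<in> X \<inter> Y" "x < z" for x
        using less[OF that(1) zC that(2)] z(3) sr by (simp add: sign_code_def)
      moreover have "sign_code (f x) = r" if "x \<in> X \<inter> Y" "z < x" for x
        using less[OF zC that(1,2)] z(3) sr by (simp add: sign_code_def)
      ultimately show ?thesis using 3 False zC z(3) by auto
    qed
  qed
qed

lemma negate_sign_simps: "s \<le> 2 \<Longrightarrow> negate_sign s = 0 \<longleftrightarrow> s = 0"
  "s \<le> 2 \<Longrightarrow> r \<le> 2 \<Longrightarrow> negate_sign s = negate_sign r \<longleftrightarrow> s = r"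
  by (auto simp: negate_sign_def)

text \<open>The mean value theorem turns the constant sign of the derivative inside the cell into
  strict monotonicity up to the ends; a decreasing \<open>f\<close> is replaced by its
  negative.\<close>

lemma monotone_signs:
  assumes der: "\<And>x. (f has_real_derivative f' x) (at x)" and X: "left_sign f X s"
    and Y: "right_sign f Y r" and ne: "X \<inter> Y \<noteq> {}"
    and sign: "\<And>x. x \<in> X \<inter> Y \<Longrightarrow> sign_code (f' x) = d" "d \<noteq> 0"
  shows "if s \<noteq> 0 \<and> r \<noteq> 0 \<and> s \<noteq> r
    then \<exists>z\<in>X \<inter> Y. f z = 0 \<and> (\<forall>x\<in>X \<inter> Y. x < z \<longrightarrow> sign_code (f x) = s) \<and>
      (\<forall>x\<in>X \<inter> Y. z < x \<longrightarrow> sign_code (f x) = r)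
    else \<forall>x\<in>X \<inter> Y. sign_code (f x) = (if s = 0 then r else s)"
proof -
  have cont: "continuous_on UNIV f"
    using der by (meson DERIV_continuous_on has_field_derivative_at_within)
  have mvt: "\<exists>c\<in>{x<..<y}. f y - f x = (y - x) * f' c" if "x < y" for x y
    using MVT2[of x y f f'] der that by auto
  obtain c where "c \<in> X \<inter> Y" using ne by blast
  then have "d = sign_code (f' c)" "d \<noteq> 0" using sign by auto
  then have "d = 1 \<or> d = 2" by (auto simp: sign_code_def split: if_splits)
  then show ?thesis
  proof
    assume d: "d = 1"
    have "f x < f y" if xy: "x < y" and sub: "{x<..<y} \<subseteq> X \<inter> Y" for x y
    proof -
      obtain c where "c \<in> {x<..<y}" "f y - f x = (y - x) * f' c" using mvt[OF xy] by blast
      moreover have "sign_code (f' c) = 1" using sign(1)[of c] sub d \<open>c \<in> _\<close> by blast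
      then have "f' c > 0" by (simp only: sign_code_simps)
      ultimately show ?thesis using xy by (metis diff_gt_0_iff_gt mult_pos_pos)
    qed
    then show ?thesis by (intro increasing_signs cont X Y ne)
  next
    assume d: "d = 2"
    have mono: "- f x < - f y" if xy: "x < y" and sub: "{x<..<y} \<subseteq> X \<inter> Y" for x y
    proof -
      obtain c where "c \<in> {x<..<y}" "f y - f x = (y - x) * f' c" using mvt[OF xy] by blast
      moreover have "sign_code (f' c) = 2" using sign(1)[of c] sub d \<open>c \<in> _\<close> by blast
      then have "f' c < 0" by (simp only: sign_code_simps)
      ultimately show ?thesis using xy by (smt (verit) mult_pos_neg)
    qed
    have sr: "s \<le> 2" "r \<le> 2" using X Y sign_le_2 by auto
    have "left_sign (\<lambda>x. - f x) X (negate_sign s)" "right_sign (\<lambda>x. - f x) Y (negate_sign r)"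
      using X Y sr unfolding left_sign_def right_sign_def
      by (fastforce simp: sign_code_minus negate_sign_simps)+
    from increasing_signs[OF continuous_on_minus[OF cont] this ne mono]
    show ?thesis using sr by (auto simp: sign_code_minus negate_sign_simps sign_code_simps split: if_splits)
  qed
qed

lemma computable_replicate [computable_intros]:
  assumes "computable n" "computable a" shows "computable (\<lambda>x. replicate (n x) (a x))"
proof -
  have "computable (\<lambda>x. map (\<lambda>k. a x) [0..<n x])"
    by (intro computable_intros assms computable_comp[OF assms(2)])
  then show ?thesis by (simp add: map_replicate_const)
qed

definition alookup :: "('a \<times> nat) list \<Rightarrow> 'a \<Rightarrow> nat" where
  "alookup xs a = foldr (\<lambda>p b. if fst p = a then snd p else b) xs 0"

lemma alookup_simps [simp]:
  "alookup [] a = 0" "alookup (p # xs) a = (if fst p = a then snd p else alookup xs a)"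
  by (simp_all add: alookup_def)

text \<open>Repeated members of \<open>xs\<close> do no harm, as the value attached to a key depends
  on the key alone.\<close>

lemma alookup_zip: "a \<in> set xs \<Longrightarrow> alookup (zip xs (map f xs)) a = f a"
  by (induction xs) auto

lemma computable_alookup [computable_intros]:
  assumes "computable f" "computable g" shows "computable (\<lambda>x. alookup (f x) (g x))"
  unfolding alookup_def by (intro computable_intros assms computable_comp[OF assms(2)])

type_synonym column = "(rterm list \<times> nat) list"

text \<open>Elimination is purely symbolic and takes place over any \<open>\<nu>\<close> that has
  codes for 0, 1 and -1; the computable field operations join in \<open>coded_group\<close>.\<close>

locale coded_reals =
  fixes \<nu> :: "nat \<Rightarrow> real" and zero_ix one_ix minus_ix :: nat
  assumes code_values [simp]: "\<nu> zero_ix = 0" "\<nu> one_ix = 1" "\<nu> minus_ix = - 1"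
begin

primrec rvalue :: "(nat \<Rightarrow> real) \<Rightarrow> rterm \<Rightarrow> real" where
  "rvalue w (RVar i) = w i"
| "rvalue w (RConst k) = \<nu> k"
| "rvalue w (RAdd s t) = rvalue w s + rvalue w t"
| "rvalue w (RMul s t) = rvalue w s * rvalue w t"

definition pvalue :: "(nat \<Rightarrow> real) \<Rightarrow> rterm list \<Rightarrow> real \<Rightarrow> real" where
  "pvalue w p = poly_fun (map (rvalue w) p)"

lemma pvalue_simps [simp]: "pvalue w [] x = 0"
    "pvalue w (a # p) x = rvalue w a * x ^ length p + pvalue w p x"
  by (simp_all add: pvalue_def)

subsection \<open>Operations on polynomials with terms as coefficients\<close>

abbreviation "tzero \<equiv> RConst zero_ix"
abbreviation "tminus t \<equiv> RMul (RConst minus_ix) t"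

text \<open>A repeated sum, because a constant for \<open>n\<close> would need a code computed from
  \<open>n\<close>.\<close>

definition nat_times :: "nat \<Rightarrow> rterm \<Rightarrow> rterm" where
  "nat_times n t = ((RAdd t) ^^ n) tzero"

lemma rvalue_nat_times [simp]: "rvalue w (nat_times n t) = of_nat n * rvalue w t"
  unfolding nat_times_def by (induction n) (auto simp: algebra_simps)

lemma computable_nat_times [computable_intros]:
  assumes "computable n" "computable t" shows "computable (\<lambda>x. nat_times (n x) (t x))"
  unfolding nat_times_def by (intro computable_intros computable_comp[OF assms(2)] assms)

fun tderiv :: "rterm list \<Rightarrow> rterm list" where
  "tderiv [] = []"
| "tderiv (a # p) = (if p = [] then [] else nat_times (length p) a # tderiv p)"

lemma length_tderiv: "length (tderiv p) = length p - 1"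
  by (induction p) (auto simp: Suc_diff_Suc simp flip: length_greater_0_conv)

lemma pvalue_tderiv: "(pvalue w p has_real_derivative pvalue w (tderiv p) x) (at x)"
proof -
  have "map (rvalue w) (tderiv p) = poly_deriv (map (rvalue w) p)"
    by (induction p) auto
  then show ?thesis unfolding pvalue_def using poly_fun_deriv by simp
qed

lemma computable_tderiv [computable_intros]:
  assumes "computable f" shows "computable (\<lambda>x. tderiv (f x))"
proof -
  have eq: "foldr (\<lambda>a r. (Suc (fst r), if fst r = 0 then [] else nat_times (fst r) a # snd r)) p (0, []) =
      (length p, tderiv p)" for p
    by (induction p) auto
  have "computable (\<lambda>x. snd (foldr (\<lambda>a r. (Suc (fst r),
      if fst r = 0 then [] else nat_times (fst r) a # snd r)) (f x) (0, [])))"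
    by (intro computable_intros assms)
  then show ?thesis unfolding eq by simp
qed

definition padd :: "rterm list \<Rightarrow> rterm list \<Rightarrow> rterm list" where
  "padd p q = map (\<lambda>r. RAdd (fst r) (snd r))
    (zip (replicate (length q - length p) tzero @ p) (replicate (length p - length q) tzero @ q))"

lemma pvalue_replicate [simp]: "pvalue w (replicate n tzero @ p) x = pvalue w p x"
  by (induction n) auto

lemma pvalue_padd [simp]: "pvalue w (padd p q) x = pvalue w p x + pvalue w q x"
proof -
  have *: "length p = length q \<Longrightarrow>
    pvalue w (map (\<lambda>r. RAdd (fst r) (snd r)) (zip p q)) x = pvalue w p x + pvalue w q x" for p q
    by (induction p q rule: list_induct2) (auto simp: algebra_simps)
  show ?thesis unfolding padd_def by (subst *) auto
qed

lemma computable_padd [computable_intros]: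
  assumes "computable f" "computable g" shows "computable (\<lambda>x. padd (f x) (g x))"
  unfolding padd_def by (intro computable_intros assms)

text \<open>Horner's scheme in the coefficients of \<open>p\<close>: appending \<open>tzero\<close>
  multiplies by the variable.\<close>

definition pmul :: "rterm list \<Rightarrow> rterm list \<Rightarrow> rterm list" where
  "pmul p q = foldr (\<lambda>a r. padd (r @ [tzero]) (map (RMul a) q)) (rev p) []"

lemma pvalue_snoc: "pvalue w (p @ [a]) x = x * pvalue w p x + rvalue w a"
  by (induction p) (auto simp: algebra_simps)

lemma pvalue_scale [simp]: "pvalue w (map (RMul a) q) x = rvalue w a * pvalue w q x"
  by (induction q) (auto simp: algebra_simps)

lemma pvalue_pmul [simp]: "pvalue w (pmul p q) x = pvalue w p x * pvalue w q x"
  by (induction p rule: rev_induct) (auto simp: pmul_def pvalue_snoc algebra_simps)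

lemma computable_pmul [computable_intros]:
  assumes "computable f" "computable g" shows "computable (\<lambda>x. pmul (f x) (g x))"
  unfolding pmul_def by (intro computable_intros assms computable_comp[OF assms(2)])

primrec to_poly :: "nat \<Rightarrow> rterm \<Rightarrow> rterm list" where
  "to_poly i (RVar j) = (if i = j then [RConst one_ix, tzero] else [RVar j])"
| "to_poly i (RConst k) = [RConst k]"
| "to_poly i (RAdd s t) = padd (to_poly i s) (to_poly i t)"
| "to_poly i (RMul s t) = pmul (to_poly i s) (to_poly i t)"

lemma pvalue_to_poly: "pvalue w (to_poly i t) x = rvalue (w(i := x)) t"
  by (induction t) auto

lemma computable_to_poly [computable_intros]:
  assumes "computable f" "computable g" shows "computable (\<lambda>x. to_poly (f x) (g x))"
proof -
  have "computable (\<lambda>p. to_poly (fst p) (snd p))"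
    by (rule computable_rec_rterm[OF _ _ _ _ to_poly.simps]) (intro computable_intros)+
  from computable_comp2[OF this assms] show ?thesis .
qed

text \<open>Here \<open>c\<close> and \<open>a\<close> are the leading coefficients of divisor and
  dividend, \<open>q\<close> and \<open>p\<close> their remaining coefficients. The leading terms
  cancel, and their difference is omitted rather than kept as a coefficient of value 0, so that the
  list gets shorter.\<close>

definition psub :: "rterm \<Rightarrow> rterm \<Rightarrow> rterm list \<Rightarrow> rterm list \<Rightarrow> rterm list" where
  "psub c a p q = map (\<lambda>r. RAdd (RMul (RMul c c) (fst r)) (tminus (RMul (RMul c a) (snd r))))
    (zip p (q @ replicate (length p) tzero))"

lemma pvalue_psub:
  assumes "length q \<le> length p"
  shows "pvalue w (psub c a p q) x = (rvalue w c)\<^sup>2 * pvalue w p x -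
    rvalue w c * rvalue w a * x ^ (length p - length q) * pvalue w q x"
proof -
  \<comment> \<open>Any sufficient number \<open>n\<close> of trailing zeros is allowed, since the
    padding does not shrink with \<open>p\<close> in the induction; \<open>zip\<close> cuts off the
    excess.\<close>
  have "length q \<le> length p \<Longrightarrow> length p \<le> length q + n \<Longrightarrow>
    pvalue w (map (\<lambda>r. RAdd (RMul (RMul c c) (fst r)) (tminus (RMul (RMul c a) (snd r))))
      (zip p (q @ replicate n tzero))) x = (rvalue w c)\<^sup>2 * pvalue w p x -
      rvalue w c * rvalue w a * x ^ (length p - length q) * pvalue w q x" for n
  proof (induction p arbitrary: q n)
    case (Cons b p)
    show ?case
    proof (cases q)
      case Nil
      with Cons.prems obtain m where "n = Suc m" "length p \<le> m" by (cases n) auto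
      with Nil Cons.IH[of "[]" m] show ?thesis
        by (auto simp: algebra_simps power2_eq_square)
    next
      case (Cons d q')
      have "x ^ (length p - length q') * x ^ length q' = x ^ length p"
        using Cons Cons.prems by (simp flip: power_add)
      then have "x ^ length p = x ^ (length p - length q') * x ^ length q'" by simp
      with Cons Cons.IH[of q' n] Cons.prems show ?thesis
        by (auto simp: algebra_simps power2_eq_square)
    qed
  qed simp
  from this[of "length p"] show ?thesis using assms by (simp add: psub_def)
qed

lemma length_psub: "length (psub c a p q) = length p"
  by (simp add: psub_def)

lemma computable_psub [computable_intros]:
  assumes "computable c" "computable a" "computable f" "computable g"
  shows "computable (\<lambda>x. psub (c x) (a x) (f x) (g x))"
  unfolding psub_def
  by (intro computable_intros assms computable_comp[OF assms(1)] computable_comp[OF assms(2)])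

text \<open>One step of the pseudo-division of \<open>p\<close> by \<open>q\<close>.  The factor is the square of the leading
  coefficient of \<open>q\<close>, so that signs at the roots of \<open>q\<close> are preserved.\<close>

definition pstep :: "rterm list \<Rightarrow> rterm list \<Rightarrow> rterm list" where
  "pstep q p = (if length p < length q then p
    else psub (head_or tzero q) (head_or tzero p) (tl p) (tl q))"

text \<open>A step shortens a nonempty list that is not shorter than \<open>q\<close> and leaves
  other lists alone, so \<open>length p\<close> steps reach the remainder.\<close>

definition prem :: "rterm list \<Rightarrow> rterm list \<Rightarrow> rterm list" where
  "prem p q = (pstep q ^^ length p) p"

lemma sign_pstep:
  assumes "q \<noteq> []" "rvalue w (hd q) \<noteq> 0" "pvalue w q x = 0"
  shows "sign_code (pvalue w (pstep q p) x) = sign_code (pvalue w p x)"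
proof (cases "length p < length q")
  case False
  with assms(1) obtain c q' a p' where q: "q = c # q'" and p: "p = a # p'" "length q' \<le> length p'"
    by (cases q; cases p) auto
  have "pvalue w q' x = - rvalue w c * x ^ length q'" using assms(3) q by simp
  then have "pvalue w (pstep q p) x = (rvalue w c)\<^sup>2 * pvalue w p' x +
      (rvalue w c)\<^sup>2 * rvalue w a * (x ^ (length p' - length q') * x ^ length q')"
    using False q p by (simp add: pstep_def pvalue_psub power2_eq_square)
  also have "\<dots> = (rvalue w c)\<^sup>2 * pvalue w p x"
    using p by (simp add: algebra_simps flip: power_add)
  finally show ?thesis using assms(2) q by (simp add: sign_code_mult_pos)
qed (simp add: pstep_def)

text \<open>The source of the signs at the points of a table: at a zero of \<open>q\<close> the
  question for the sign of \<open>p\<close> is passed on to a list shorter than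
  \<open>q\<close>.\<close>

lemma sign_prem:
  assumes "q \<noteq> []" "rvalue w (hd q) \<noteq> 0" "pvalue w q x = 0"
  shows "sign_code (pvalue w (prem p q) x) = sign_code (pvalue w p x)"
proof -
  have "sign_code (pvalue w ((pstep q ^^ n) p) x) = sign_code (pvalue w p x)" for n
    by (induction n) (auto simp: sign_pstep[OF assms])
  then show ?thesis by (simp add: prem_def)
qed

lemma length_pstep_funpow:
  "length ((pstep q ^^ n) p) < length q \<or> length ((pstep q ^^ n) p) = length p - n"
  by (induction n) (auto simp: pstep_def length_psub)

lemma length_prem: "q \<noteq> [] \<Longrightarrow> length (prem p q) < length q"
  using length_pstep_funpow[where q = q and n = "length p" and p = p] by (auto simp: prem_def)

lemma prem_Nil: "prem p [] = []"
  using length_pstep_funpow[where q = "[]" and n = "length p" and p = p] by (auto simp: prem_def)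

lemma prem_short: "length p < length q \<Longrightarrow> prem p q = p"
proof -
  assume *: "length p < length q"
  have "(pstep q ^^ n) p = p" for n by (induction n) (auto simp: pstep_def *)
  then show ?thesis by (simp add: prem_def)
qed

lemma computable_prem [computable_intros]:
  assumes "computable f" "computable g" shows "computable (\<lambda>x. prem (f x) (g x))"
  unfolding prem_def pstep_def
  by (intro computable_intros assms computable_comp[OF assms(2)])

subsection \<open>Closed families of polynomials\<close>

definition clos :: "rterm list list \<Rightarrow> rterm list list" where
  "clos F = F @ map tl F @ map tderiv F @ concat (map (\<lambda>p. map (\<lambda>q. prem p q) F) F)"

lemma set_clos: "set (clos F) = set F \<union> tl ` set F \<union> tderiv ` set F \<union>
    {prem p q | p q. p \<in> set F \<and> q \<in> set F}"
  unfolding clos_def by auto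

lemma computable_clos [computable_intros]:
  assumes "computable f" shows "computable (\<lambda>x. clos (f x))"
  unfolding clos_def by (intro computable_intros assms computable_comp[OF assms])

lemma length_clos:
  assumes "\<forall>p\<in>set F. length p \<le> d" shows "\<forall>p\<in>set ((clos ^^ n) F). length p \<le> d"
proof (induction n)
  case (Suc n)
  have "length (prem p q) \<le> d" if "length p \<le> d" "length q \<le> d" for p q
    using that length_prem[of q p] prem_Nil[of p] by (cases "q = []") auto
  with Suc show ?case by (auto simp: set_clos length_tderiv)
qed (use assms in simp)

text \<open>The operations produce shorter polynomials only, so members of large length are present
  early.\<close>

lemma clos_stable:
  assumes "\<forall>p\<in>set F. length p \<le> d" "r \<in> set ((clos ^^ Suc k) F)" "d < length r + k"
  shows "r \<in> set ((clos ^^ k) F)"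
  using assms(2,3)
proof (induction k arbitrary: r)
  case 0
  then show ?case using length_clos[OF assms(1), of "Suc 0"] by auto
next
  case (Suc k)
  let ?S = "\<lambda>k. set ((clos ^^ k) F)"
  have S: "?S (Suc k) = ?S k \<union> tl ` ?S k \<union> tderiv ` ?S k \<union> {prem p q | p q. p \<in> ?S k \<and> q \<in> ?S k}"
    for k by (simp add: set_clos)
  \<comment> \<open>A parent \<open>p\<close> longer than \<open>r\<close> satisfies the inequality
    with \<open>k\<close> in place of \<open>Suc k\<close>, so it is present one stage earlier, and
    therefore so is \<open>r\<close>.\<close>
  have IH: "p \<in> ?S k" if "p \<in> ?S (Suc k)" "length r < length p" for p
    using that Suc.IH[of p] Suc.prems(2) by simp
  from Suc.prems(1) S[of "Suc k"] consider "r \<in> ?S (Suc k)"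
    | p where "p \<in> ?S (Suc k)" "r = tl p \<or> r = tderiv p"
    | p q where "p \<in> ?S (Suc k)" "q \<in> ?S (Suc k)" "r = prem p q"
    by blast
  then show ?case
  proof cases
    case (2 p)
    show ?thesis
    proof (cases "p = []")
      case False
      then have "length r < length p" using 2 by (auto simp: length_tderiv)
      then show ?thesis using IH[of p] 2 S[of k] by blast
    qed (use 2 in auto)
  next
    case (3 p q)
    consider "q = []" | "length p < length q" | "q \<noteq> []" "length q \<le> length p" by linarith
    then show ?thesis
    proof cases
      case 3
      then have "length r < length q" "length r < length p"
        using length_prem[of q p] \<open>r = prem p q\<close> by auto
      then have "p \<in> ?S k" "q \<in> ?S k" using IH \<open>p \<in> _\<close> \<open>q \<in> _\<close> by auto
      then show ?thesis using \<open>r = prem p q\<close> S[of k] by blast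
    qed (use 3 prem_Nil[of p] prem_short[of p q] in auto)
  qed
qed

text \<open>The number \<open>d\<close> bounds the lengths of the given lists. With
  \<open>Suc d\<close> rounds the inequality of \<open>clos_stable\<close> holds even for the empty
  list, so the family is closed; the buckets by length give the order of treatment.\<close>

definition closure_list :: "rterm list list \<Rightarrow> rterm list list" where
  "closure_list ps = (let d = length (concat ps); F = (clos ^^ Suc d) ps
    in concat (map (\<lambda>k. filter (\<lambda>p. length p = k) F) [0..<Suc d]))"

lemma computable_closure_list [computable_intros]:
  assumes "computable f" shows "computable (\<lambda>x. closure_list (f x))"
  unfolding closure_list_def Let_def
  by (intro computable_intros assms computable_comp[OF assms])

text \<open>Whatever the signs of \<open>p\<close> are computed from has to be treated before
  \<open>p\<close>. Only remainders by predecessors are asked for, since the points of the table at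
  that stage are zeros of predecessors.\<close>

definition good_order :: "rterm list list \<Rightarrow> bool" where
  "good_order L \<longleftrightarrow> (\<forall>A p B. L = A @ p # B \<longrightarrow> (p \<noteq> [] \<longrightarrow> tl p \<in> set A \<and> tderiv p \<in> set A) \<and>
    (\<forall>q\<in>set A. q \<noteq> [] \<longrightarrow> prem p q \<in> set A))"

lemma sorted_by_length:
  "sorted_wrt (\<lambda>p q. length p \<le> length q)
    (concat (map (\<lambda>k. filter (\<lambda>p. length p = k) F) [0..<n]))"
proof -
  have "sorted_wrt (\<lambda>p q. length p \<le> length q) (filter (\<lambda>p. length p = k) F)" for k
    by (induction F) auto
  then show ?thesis by (induction n) (auto simp: sorted_wrt_append)
qed

lemma closure_list:
  shows closure_list_superset: "set ps \<subseteq> set (closure_list ps)"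
    and good_order_closure_list: "good_order (closure_list ps)"
proof -
  define d where "d = length (concat ps)"
  define F where "F = (clos ^^ Suc d) ps"
  have ps: "\<forall>p\<in>set ps. length p \<le> d"
    unfolding d_def by (auto simp: length_concat intro: member_le_sum_list)
  have lenF: "\<forall>p\<in>set F. length p \<le> d" unfolding F_def by (rule length_clos[OF ps])
  have L: "closure_list ps = concat (map (\<lambda>k. filter (\<lambda>p. length p = k) F) [0..<Suc d])"
    by (simp add: closure_list_def d_def F_def Let_def)
  have setL: "set (closure_list ps) = set F" unfolding L using lenF by (auto simp: less_Suc_eq_le)
  have "set ps \<subseteq> set ((clos ^^ n) ps)" for n by (induction n) (auto simp: set_clos)
  then show "set ps \<subseteq> set (closure_list ps)" unfolding setL F_def .
  have closed: "r \<in> set F" if "r \<in> set (clos F)" for r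
    using clos_stable[OF ps, of r "Suc d"] that by (simp add: F_def)
  show "good_order (closure_list ps)"
    unfolding good_order_def
  proof (intro allI impI)
    fix A p B assume AB: "closure_list ps = A @ p # B"
    have sorted: "sorted_wrt (\<lambda>p q. length p \<le> length q) (A @ p # B)"
      using sorted_by_length unfolding AB[symmetric] L .
    have before: "r \<in> set A" if "r \<in> set (clos F)" "length r < length p" for r
    proof -
      have "r \<in> set A \<or> r = p \<or> r \<in> set B" using closed[OF that(1)] setL AB by auto
      moreover have "length p \<le> length s" if "s \<in> set B" for s
        using sorted that by (simp add: sorted_wrt_append)
      ultimately show ?thesis using that(2) by force
    qed
    have pF: "p \<in> set F" and AF: "set A \<subseteq> set F" using setL AB by auto
    show "(p \<noteq> [] \<longrightarrow> tl p \<in> set A \<and> tderiv p \<in> set A) \<and> (\<forall>q\<in>set A. q \<noteq> [] \<longrightarrow> prem p q \<in> set A)"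
    proof (intro conjI impI ballI)
      fix q assume q: "q \<in> set A" "q \<noteq> []"
      then have "length q \<le> length p" using sorted by (simp add: sorted_wrt_append)
      then have "length (prem p q) < length p" using length_prem[OF q(2), of p] by simp
      then show "prem p q \<in> set A" using pF AF q by (intro before) (auto simp: set_clos)
    qed (use pF in \<open>auto intro!: before simp: set_clos length_tderiv\<close>)
  qed
qed

subsection \<open>Sign tables\<close>

text \<open>A table lists the signs of the polynomials treated so far on the cells of a decomposition
  of the real line: its first column belongs to the leftmost interval, and each further pair
  consists of the columns of a point and of the interval to its right.\<close>

definition lc_sign :: "(rterm \<times> nat) list \<Rightarrow> rterm list \<Rightarrow> nat" where
  "lc_sign S p = alookup S (head_or tzero p)"

text \<open>\<open>P\<close> is the column of a point at which some earlier \<open>q\<close>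
  vanishes; the sign of \<open>p\<close> there is that of the remainder by \<open>q\<close>, which
  \<open>P\<close> records. At the points of a correct table the default 0 is never reached.\<close>

definition point_sign :: "(rterm \<times> nat) list \<Rightarrow> rterm list list \<Rightarrow> rterm list \<Rightarrow> column \<Rightarrow> nat" where
  "point_sign S D p P = head_or 0 (map (\<lambda>q. alookup P (prem p q))
    (filter (\<lambda>q. q \<noteq> [] \<and> lc_sign S q \<noteq> 0 \<and> alookup P q = 0) D))"

text \<open>The algorithmic form of \<open>monotone_signs\<close> on a cell with column
  \<open>I\<close> and end signs \<open>s\<close> and \<open>r\<close>: opposite signs split the
  cell at a new point where \<open>p\<close> vanishes. The first component of the result is the cell
  next to the left end.\<close>

definition merge_cell ::
    "rterm list \<Rightarrow> nat \<Rightarrow> nat \<Rightarrow> column \<Rightarrow> (column \<times> column) list \<Rightarrow> column \<times> (column \<times> column) list" where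
  "merge_cell p s r I out = (if s \<noteq> 0 \<and> r \<noteq> 0 \<and> s \<noteq> r
    then ((p, s) # I, ((p, 0) # I, (p, r) # I) # out)
    else ((p, if s = 0 then r else s) # I, out))"

text \<open>The fold runs from right to left. Its accumulator consists of the sign of
  \<open>p\<close> at the right end of the current interval and the finished pairs from there
  on.\<close>

definition extend_step :: "(rterm \<times> nat) list \<Rightarrow> rterm list list \<Rightarrow> rterm list \<Rightarrow> column \<times> column \<Rightarrow>
    nat \<times> (column \<times> column) list \<Rightarrow> nat \<times> (column \<times> column) list" where
  "extend_step S D p c a = (point_sign S D p (fst c),
    ((p, point_sign S D p (fst c)) # fst c,
      fst (merge_cell p (point_sign S D p (fst c)) (fst a) (snd c) (snd a))) #
      snd (merge_cell p (point_sign S D p (fst c)) (fst a) (snd c) (snd a)))"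

definition bot_sign :: "(rterm \<times> nat) list \<Rightarrow> rterm list \<Rightarrow> nat" where
  "bot_sign S p = (if even (length (tl p)) then lc_sign S p else negate_sign (lc_sign S p))"

definition extend_table :: "(rterm \<times> nat) list \<Rightarrow> rterm list list \<Rightarrow> rterm list \<Rightarrow>
    column \<times> (column \<times> column) list \<Rightarrow> column \<times> (column \<times> column) list" where
  "extend_table S D p T = (let a = foldr (extend_step S D p) (snd T) (lc_sign S p, [])
    in merge_cell p (bot_sign S p) (fst a) (fst T) (snd a))"

text \<open>A polynomial whose leading coefficient vanishes under \<open>S\<close>, or which has at
  most one coefficient, creates no new point: its sign is that of its tail or of the
  constant.\<close>

definition simple_sign :: "(rterm \<times> nat) list \<Rightarrow> rterm list \<Rightarrow> column \<Rightarrow> nat" where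
  "simple_sign S p I = (if p = [] then 0 else if lc_sign S p = 0 then alookup I (tl p) else lc_sign S p)"

definition add_poly :: "(rterm \<times> nat) list \<Rightarrow> rterm list \<Rightarrow>
    rterm list list \<times> column \<times> (column \<times> column) list \<Rightarrow>
    rterm list list \<times> column \<times> (column \<times> column) list" where
  "add_poly S p st = (p # fst st,
    if lc_sign S p = 0 \<or> length p \<le> 1
    then ((p, simple_sign S p (fst (snd st))) # fst (snd st),
      map (\<lambda>c. ((p, simple_sign S p (fst c)) # fst c, (p, simple_sign S p (snd c)) # snd c)) (snd (snd st)))
    else extend_table S (fst st) p (snd st))"

definition sign_table :: "(rterm \<times> nat) list \<Rightarrow> rterm list list \<Rightarrow>
    rterm list list \<times> column \<times> (column \<times> column) list" where
  "sign_table S L = foldr (add_poly S) (rev L) ([], [], [])"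

definition table_columns :: "column \<times> (column \<times> column) list \<Rightarrow> column list" where
  "table_columns T = fst T # concat (map (\<lambda>c. [fst c, snd c]) (snd T))"

lemma computable_even:
  fixes f :: "'a::encodable \<Rightarrow> nat"
  assumes f: "computable f" shows "computable (\<lambda>x. even (f x))"
proof -
  have "computable (\<lambda>x. rec_nat True (\<lambda>k b. \<not> b) (f x))"
    by (intro computable_intros f)
  moreover have "rec_nat True (\<lambda>k b. \<not> b) n = even n" for n by (induction n) auto
  ultimately show ?thesis by simp
qed

lemma computable_lc_sign [computable_intros]:
  assumes "computable S" "computable p" shows "computable (\<lambda>x. lc_sign (S x) (p x))"
  unfolding lc_sign_def by (intro computable_intros assms)

lemma computable_point_sign [computable_intros]:
  assumes "computable S" "computable D" "computable p" "computable P"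
  shows "computable (\<lambda>x. point_sign (S x) (D x) (p x) (P x))"
  unfolding point_sign_def
  by (intro computable_intros assms computable_comp[OF assms(1)] computable_comp[OF assms(3)]
      computable_comp[OF assms(4)])

lemma computable_merge_cell [computable_intros]:
  assumes "computable p" "computable s" "computable r" "computable I" "computable out"
  shows "computable (\<lambda>x. merge_cell (p x) (s x) (r x) (I x) (out x))"
  unfolding merge_cell_def by (intro computable_intros assms)

lemma computable_extend_step [computable_intros]:
  assumes "computable S" "computable D" "computable p" "computable c" "computable a"
  shows "computable (\<lambda>x. extend_step (S x) (D x) (p x) (c x) (a x))"
  unfolding extend_step_def by (intro computable_intros assms)

lemma computable_bot_sign [computable_intros]:
  assumes "computable S" "computable p" shows "computable (\<lambda>x. bot_sign (S x) (p x))"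
  unfolding bot_sign_def negate_sign_def by (intro computable_intros computable_even assms)

lemma computable_extend_table [computable_intros]:
  assumes "computable S" "computable D" "computable p" "computable T"
  shows "computable (\<lambda>x. extend_table (S x) (D x) (p x) (T x))"
  unfolding extend_table_def Let_def
  by (intro computable_intros assms computable_comp[OF assms(1)] computable_comp[OF assms(2)]
      computable_comp[OF assms(3)])

lemma computable_simple_sign [computable_intros]:
  assumes "computable S" "computable p" "computable I"
  shows "computable (\<lambda>x. simple_sign (S x) (p x) (I x))"
  unfolding simple_sign_def by (intro computable_intros assms)

lemma computable_add_poly [computable_intros]:
  assumes "computable S" "computable p" "computable st"
  shows "computable (\<lambda>x. add_poly (S x) (p x) (st x))"
  unfolding add_poly_def
  by (intro computable_intros assms computable_comp[OF assms(1)] computable_comp[OF assms(2)])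

lemma computable_sign_table [computable_intros]:
  assumes "computable S" "computable L" shows "computable (\<lambda>x. sign_table (S x) (L x))"
  unfolding sign_table_def by (intro computable_intros assms computable_comp[OF assms(1)])

lemma computable_table_columns [computable_intros]:
  assumes "computable T" shows "computable (\<lambda>x. table_columns (T x))"
  unfolding table_columns_def by (intro computable_intros assms)

end

section \<open>Correctness of the sign tables\<close>

context coded_reals
begin

lemma sign_code_pos [simp]: "0 < sign_code r \<longleftrightarrow> r \<noteq> 0"
  by (simp add: sign_code_def)

definition column_ok :: "(nat \<Rightarrow> real) \<Rightarrow> rterm list list \<Rightarrow> column \<Rightarrow> real \<Rightarrow> bool" where
  "column_ok w D I x \<longleftrightarrow> (\<forall>q\<in>set D. alookup I q = sign_code (pvalue w q x))"

text \<open>Points of a table have to be zeros of treated polynomials with nonzero leading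
  coefficient, because pseudo-division preserves signs only under this condition.\<close>

definition is_root :: "(nat \<Rightarrow> real) \<Rightarrow> rterm list list \<Rightarrow> real \<Rightarrow> bool" where
  "is_root w D z \<longleftrightarrow> (\<exists>q\<in>set D. q \<noteq> [] \<and> rvalue w (hd q) \<noteq> 0 \<and> pvalue w q z = 0)"

text \<open>\<open>boundary w D rest Y\<close>: the pairs in \<open>rest\<close> describe the line to the right of \<open>Y\<close>,
  which is the ray up to the first point of \<open>rest\<close>.\<close>

primrec boundary ::
    "(nat \<Rightarrow> real) \<Rightarrow> rterm list list \<Rightarrow> (column \<times> column) list \<Rightarrow> real set \<Rightarrow> bool" where
  "boundary w D [] Y \<longleftrightarrow> Y = UNIV"
| "boundary w D (c # rest) Y \<longleftrightarrow> (\<exists>z Y'. Y = {..<z} \<and> column_ok w D (fst c) z \<and> is_root w D z \<and>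
    {z<..} \<inter> Y' \<noteq> {} \<and> (\<forall>x\<in>{z<..} \<inter> Y'. column_ok w D (snd c) x) \<and> boundary w D rest Y')"

definition table_ok ::
    "(nat \<Rightarrow> real) \<Rightarrow> rterm list list \<Rightarrow> column \<times> (column \<times> column) list \<Rightarrow> bool" where
  "table_ok w D T \<longleftrightarrow> (\<exists>Y. boundary w D (snd T) Y \<and> Y \<noteq> {} \<and> (\<forall>x\<in>Y. column_ok w D (fst T) x))"

lemma column_ok_Cons:
  "column_ok w D I x \<Longrightarrow> s = sign_code (pvalue w p x) \<Longrightarrow> column_ok w (p # D) ((p, s) # I) x"
  by (auto simp: column_ok_def)

context
  fixes w :: "nat \<Rightarrow> real" and S :: "(rterm \<times> nat) list" and D :: "rterm list list" and p :: "rterm list"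
  assumes coeff: "\<And>q c. q \<in> set (p # D) \<Longrightarrow> c \<in> set q \<Longrightarrow> alookup S c = sign_code (rvalue w c)"
    and tl_mem: "p \<noteq> [] \<Longrightarrow> tl p \<in> set D" and tderiv_mem: "p \<noteq> [] \<Longrightarrow> tderiv p \<in> set D"
    and prem_mem: "\<And>q. q \<in> set D \<Longrightarrow> q \<noteq> [] \<Longrightarrow> prem p q \<in> set D"
begin

lemma lc_sign_eq: "q \<in> set (p # D) \<Longrightarrow> q \<noteq> [] \<Longrightarrow> lc_sign S q = sign_code (rvalue w (hd q))"
  using coeff[of q "hd q"] by (cases q) (auto simp: lc_sign_def)

lemma point_sign_eq:
  assumes "column_ok w D P z" "is_root w D z"
  shows "point_sign S D p P = sign_code (pvalue w p z)"
proof -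
  let ?L = "filter (\<lambda>q. q \<noteq> [] \<and> lc_sign S q \<noteq> 0 \<and> alookup P q = 0) D"
  obtain q where "q \<in> set D" "q \<noteq> []" "rvalue w (hd q) \<noteq> 0" "pvalue w q z = 0"
    using assms(2) by (auto simp: is_root_def)
  then have "q \<in> set ?L"
    using assms(1) lc_sign_eq[of q] by (auto simp: column_ok_def sign_code_simps)
  \<comment> \<open>The polynomial \<open>q'\<close> picked by \<open>point_sign\<close> may differ
    from \<open>q\<close>; \<open>is_root\<close> serves to show that there is something to
    pick.\<close>
  have "?L \<noteq> []"
  proof
    assume *: "?L = []"
    from \<open>q \<in> set ?L\<close> show False unfolding * by simp
  qed
  then obtain q' L' where L: "?L = q' # L'" by (cases ?L) auto
  have "q' \<in> set ?L" unfolding L by simp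
  then have q': "q' \<in> set D" "q' \<noteq> []" "lc_sign S q' \<noteq> 0" "alookup P q' = 0" by auto
  then have "rvalue w (hd q') \<noteq> 0" "pvalue w q' z = 0"
    using lc_sign_eq[of q'] assms(1) by (auto simp: column_ok_def sign_code_simps)
  then have "sign_code (pvalue w (prem p q') z) = sign_code (pvalue w p z)"
    using q' by (intro sign_prem)
  moreover have "alookup P (prem p q') = sign_code (pvalue w (prem p q') z)"
    using prem_mem[OF q'(1,2)] assms(1) by (simp add: column_ok_def)
  ultimately show ?thesis unfolding point_sign_def L by simp
qed

text \<open>The derivative has been treated, so its sign is constant on the cell; it is not 0, since
  its leading coefficient is a positive multiple of that of \<open>p\<close>. This is the situation
  of \<open>monotone_signs\<close>.\<close>

lemma merge_cell_ok:
  assumes lc: "p \<noteq> []" "rvalue w (hd p) \<noteq> 0" "length p \<ge> 2"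
    and X: "left_sign (pvalue w p) X s" and Y: "right_sign (pvalue w p) Y r"
    and ne: "X \<inter> Y \<noteq> {}" and I: "\<And>x. x \<in> X \<inter> Y \<Longrightarrow> column_ok w D I x"
    and out: "boundary w (p # D) out Y"
  shows "\<exists>Y'. boundary w (p # D) (snd (merge_cell p s r I out)) Y' \<and> X \<inter> Y' \<noteq> {} \<and>
    (\<forall>x\<in>X \<inter> Y'. column_ok w (p # D) (fst (merge_cell p s r I out)) x)"
proof -
  have X': "X = UNIV \<or> (\<exists>a. X = {a<..})" and Y': "Y = UNIV \<or> (\<exists>b. Y = {..<b})"
    using X Y unfolding left_sign_def right_sign_def by auto
  define d where "d = alookup I (tderiv p)"
  have d: "sign_code (pvalue w (tderiv p) x) = d" if "x \<in> X \<inter> Y" for x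
    using I[OF that] tderiv_mem lc(1) by (simp add: column_ok_def d_def)
  have "d \<noteq> 0"
  proof
    assume "d = 0"
    then have "pvalue w (tderiv p) x = 0" if "x \<in> X \<inter> Y" for x
      using d[OF that] by (simp add: sign_code_simps)
    moreover obtain a b q where p: "p = a # b # q" using lc(3) by (cases p; cases "tl p") auto
    moreover have "open (X \<inter> Y)" using X' Y' by (intro open_Int) auto
    ultimately have "rvalue w (nat_times (length (b # q)) a) = 0"
      using poly_fun_vanish_open[of "X \<inter> Y" "rvalue w (nat_times (length (b # q)) a)"
          "map (rvalue w) (tderiv (b # q))"] ne
      by (auto simp: pvalue_def simp del: rvalue_nat_times)
    then show False using lc(2) p by simp
  qed
  note cell = monotone_signs[OF pvalue_tderiv X Y ne d this]
  show ?thesis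
  proof (cases "s \<noteq> 0 \<and> r \<noteq> 0 \<and> s \<noteq> r")
    case True
    with cell obtain z where z: "z \<in> X \<inter> Y" "pvalue w p z = 0"
      "\<And>x. x \<in> X \<inter> Y \<Longrightarrow> x < z \<Longrightarrow> sign_code (pvalue w p x) = s"
      "\<And>x. x \<in> X \<inter> Y \<Longrightarrow> z < x \<Longrightarrow> sign_code (pvalue w p x) = r" by auto
    have sub: "X \<inter> {..<z} \<subseteq> X \<inter> Y" "{z<..} \<inter> Y \<subseteq> X \<inter> Y" using z(1) X' Y' by auto
    have "is_root w (p # D) z" using lc(1,2) z(2) by (auto simp: is_root_def)
    moreover have "column_ok w (p # D) ((p, 0) # I) z"
      using z by (intro column_ok_Cons I) (auto simp: sign_code_simps)
    moreover have "{z<..} \<inter> Y \<noteq> {}"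
    proof -
      obtain u where "u > z" "u \<in> Y" using z(1) Y' by (metis IntD2 UNIV_I gt_ex dense lessThan_iff)
      then show ?thesis by auto
    qed
    moreover have "\<forall>x\<in>{z<..} \<inter> Y. column_ok w (p # D) ((p, r) # I) x"
      using sub z by (auto intro!: column_ok_Cons I)
    moreover have "X \<inter> {..<z} \<noteq> {}"
    proof -
      obtain u where "u < z" "u \<in> X" using z(1) X' by (metis IntD1 UNIV_I lt_ex dense greaterThan_iff)
      then show ?thesis by auto
    qed
    moreover have "\<forall>x\<in>X \<inter> {..<z}. column_ok w (p # D) ((p, s) # I) x"
      using sub z by (auto intro!: column_ok_Cons I)
    ultimately show ?thesis using True out
      by (intro exI[of _ "{..<z}"]) (auto simp: merge_cell_def)
  next
    case False
    then have "\<forall>x\<in>X \<inter> Y. sign_code (pvalue w p x) = (if s = 0 then r else s)" using cell by metis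
    then have "\<forall>x\<in>X \<inter> Y. column_ok w (p # D) ((p, if s = 0 then r else s) # I) x"
      by (auto intro!: column_ok_Cons I)
    then show ?thesis using False ne out by (intro exI[of _ Y]) (auto simp: merge_cell_def)
  qed
qed

text \<open>Invariant of the fold: besides the table to the right of \<open>Y\<close>, the
  accumulator carries the sign of \<open>p\<close> at the right end of \<open>Y\<close>, starting
  with the sign at plus infinity.\<close>

lemma extend_boundary:
  assumes lc: "p \<noteq> []" "rvalue w (hd p) \<noteq> 0" "length p \<ge> 2" and "boundary w D rest Y"
  shows "boundary w (p # D) (snd (foldr (extend_step S D p) rest (lc_sign S p, []))) Y \<and>
    right_sign (pvalue w p) Y (fst (foldr (extend_step S D p) rest (lc_sign S p, [])))"
  using assms(4)
proof (induction rest arbitrary: Y)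
  case Nil
  have p: "map (rvalue w) p = rvalue w (hd p) # map (rvalue w) (tl p)"
    using lc(1) by (cases p) auto
  from sign_at_top[OF lc(2), of "map (rvalue w) (tl p)"]
  have "right_sign (pvalue w p) Y (lc_sign S p)"
    unfolding right_sign_def pvalue_def p using Nil lc lc_sign_eq[of p]
    by (auto simp: sign_code_simps)
  then show ?case using Nil by simp
next
  case (Cons c rest)
  then obtain z Y' where z: "Y = {..<z}" "column_ok w D (fst c) z" "is_root w D z"
    "{z<..} \<inter> Y' \<noteq> {}" "\<And>x. x \<in> {z<..} \<inter> Y' \<Longrightarrow> column_ok w D (snd c) x" "boundary w D rest Y'" by auto
  define a where "a = foldr (extend_step S D p) rest (lc_sign S p, [])"
  have IH: "boundary w (p # D) (snd a) Y'" "right_sign (pvalue w p) Y' (fst a)"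
    using Cons.IH[OF z(6)] by (auto simp: a_def)
  have ps: "point_sign S D p (fst c) = sign_code (pvalue w p z)"
    by (rule point_sign_eq[OF z(2,3)])
  have "left_sign (pvalue w p) {z<..} (point_sign S D p (fst c))"
    unfolding left_sign_def ps by blast
  note merge_cell_ok[OF lc this IH(2) z(4) z(5) IH(1)]
  moreover have "is_root w (p # D) z" using z(3) by (auto simp: is_root_def)
  ultimately have "boundary w (p # D) (snd (extend_step S D p c a)) Y"
    unfolding extend_step_def snd_conv boundary.simps fst_conv
    using z(1) column_ok_Cons[OF z(2) ps] by blast
  moreover have "right_sign (pvalue w p) Y (fst (extend_step S D p c a))"
    unfolding right_sign_def using z(1) ps by (auto simp: extend_step_def)
  ultimately show ?case by (simp add: a_def)
qed

lemma extend_table_ok: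
  assumes lc: "p \<noteq> []" "rvalue w (hd p) \<noteq> 0" "length p \<ge> 2" and "table_ok w D T"
  shows "table_ok w (p # D) (extend_table S D p T)"
proof -
  from assms(4) obtain Y where Y: "boundary w D (snd T) Y" "Y \<noteq> {}"
    "\<And>x. x \<in> Y \<Longrightarrow> column_ok w D (fst T) x" by (auto simp: table_ok_def)
  have p: "map (rvalue w) p = rvalue w (hd p) # map (rvalue w) (tl p)"
    using lc(1) by (cases p) auto
  have "bot_sign S p = (if even (length (map (rvalue w) (tl p))) then sign_code (rvalue w (hd p))
      else negate_sign (sign_code (rvalue w (hd p))))" "bot_sign S p \<noteq> 0"
    using lc lc_sign_eq[of p] by (auto simp: bot_sign_def sign_code_def negate_sign_def)
  with sign_at_bot[OF lc(2), of "map (rvalue w) (tl p)"]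
  have left: "left_sign (pvalue w p) UNIV (bot_sign S p)"
    unfolding left_sign_def pvalue_def p by (intro disjI1 conjI refl) (simp_all only: not_False_eq_True)
  note right = extend_boundary[OF lc Y(1)]
  note merge_cell_ok[OF lc left conjunct2[OF right] _ _ conjunct1[OF right], of "fst T"]
  then show ?thesis using Y(2,3) by (simp add: table_ok_def extend_table_def Let_def)
qed

lemma simple_sign_eq:
  assumes "lc_sign S p = 0 \<or> length p \<le> 1" "column_ok w D I x"
  shows "column_ok w (p # D) ((p, simple_sign S p I) # I) x"
proof (rule column_ok_Cons[OF assms(2)])
  show "simple_sign S p I = sign_code (pvalue w p x)"
  proof (cases p)
    case Nil
    then show ?thesis by (simp add: simple_sign_def sign_code_def)
  next
    case (Cons a q)
    have lcp: "lc_sign S p = sign_code (rvalue w a)" using lc_sign_eq[of p] Cons by simp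
    show ?thesis
    proof (cases "lc_sign S p = 0")
      case True
      then have "rvalue w a = 0" using lcp by (simp add: sign_code_simps)
      moreover have "alookup I q = sign_code (pvalue w q x)"
        using tl_mem Cons assms(2) by (simp add: column_ok_def)
      ultimately show ?thesis using True Cons by (simp add: simple_sign_def)
    next
      case False
      then have "q = []" using assms(1) Cons by simp
      then show ?thesis using False Cons lcp by (simp add: simple_sign_def sign_code_simps)
    qed
  qed
qed

lemma simple_boundary:
  assumes "lc_sign S p = 0 \<or> length p \<le> 1" "boundary w D rest Y"
  shows "boundary w (p # D)
    (map (\<lambda>c. ((p, simple_sign S p (fst c)) # fst c, (p, simple_sign S p (snd c)) # snd c)) rest) Y"
  using assms(2)
proof (induction rest arbitrary: Y)
  case (Cons c rest)
  then obtain z Y' where z: "Y = {..<z}" "column_ok w D (fst c) z" "is_root w D z"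
    "{z<..} \<inter> Y' \<noteq> {}" "\<And>x. x \<in> {z<..} \<inter> Y' \<Longrightarrow> column_ok w D (snd c) x" "boundary w D rest Y'" by auto
  then have "is_root w (p # D) z" by (auto simp: is_root_def)
  moreover have "\<forall>x\<in>{z<..} \<inter> Y'. column_ok w (p # D) ((p, simple_sign S p (snd c)) # snd c) x"
    using z(5) simple_sign_eq[OF assms(1)] by blast
  ultimately show ?case
    unfolding list.map boundary.simps fst_conv snd_conv
    using z(1,4) Cons.IH[OF z(6)] simple_sign_eq[OF assms(1) z(2)] by blast
qed simp

lemma add_poly_ok:
  assumes "table_ok w D T"
  shows "table_ok w (p # D) (snd (add_poly S p (D, T)))"
proof (cases "lc_sign S p = 0 \<or> length p \<le> 1")
  case True
  from assms obtain Y where Y: "boundary w D (snd T) Y" "Y \<noteq> {}"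
    "\<And>x. x \<in> Y \<Longrightarrow> column_ok w D (fst T) x" by (auto simp: table_ok_def)
  have "\<forall>x\<in>Y. column_ok w (p # D) ((p, simple_sign S p (fst T)) # fst T) x"
    using Y(3) simple_sign_eq[OF True] by blast
  then show ?thesis using True Y(2) simple_boundary[OF True Y(1)]
    unfolding table_ok_def add_poly_def by auto
next
  case False
  then have "p \<noteq> []" "length p \<ge> 2" by auto
  moreover from this False have "rvalue w (hd p) \<noteq> 0"
    using lc_sign_eq[of p] by (auto simp: sign_code_simps)
  ultimately show ?thesis using extend_table_ok assms False by (simp add: add_poly_def)
qed

end

lemma sign_table_ok:
  assumes "\<forall>q\<in>set L. \<forall>c\<in>set q. alookup S c = sign_code (rvalue w c)" "good_order L"
  shows "set (fst (sign_table S L)) = set L \<and> table_ok w (fst (sign_table S L)) (snd (sign_table S L))"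
  using assms
proof (induction L rule: rev_induct)
  case Nil
  show ?case by (simp add: sign_table_def table_ok_def column_ok_def)
next
  case (snoc p L)
  have good: "good_order L"
    unfolding good_order_def
  proof (intro allI impI)
    fix A q B assume "L = A @ q # B"
    then have "L @ [p] = A @ q # (B @ [p])" by simp
    then show "(q \<noteq> [] \<longrightarrow> tl q \<in> set A \<and> tderiv q \<in> set A) \<and> (\<forall>r\<in>set A. r \<noteq> [] \<longrightarrow> prem q r \<in> set A)"
      using snoc.prems(2) unfolding good_order_def by blast
  qed
  have p: "(p \<noteq> [] \<longrightarrow> tl p \<in> set L \<and> tderiv p \<in> set L) \<and> (\<forall>r\<in>set L. r \<noteq> [] \<longrightarrow> prem p r \<in> set L)"
    using snoc.prems(2) unfolding good_order_def by blast
  define st where "st = sign_table S L"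
  have IH: "set (fst st) = set L" "table_ok w (fst st) (snd st)"
    using snoc.IH[OF _ good] snoc.prems(1) by (auto simp: st_def)
  have "sign_table S (L @ [p]) = add_poly S p st" by (simp add: sign_table_def st_def)
  moreover have "table_ok w (p # fst st) (snd (add_poly S p (fst st, snd st)))"
    by (rule add_poly_ok) (use IH p snoc.prems(1) in auto)
  ultimately show ?case using IH by (simp add: add_poly_def)
qed

lemma boundary_columns:
  assumes "boundary w D rest Y"
  shows "x \<notin> Y \<Longrightarrow> \<exists>col\<in>set (concat (map (\<lambda>c. [fst c, snd c]) rest)). column_ok w D col x"
    and "col \<in> set (concat (map (\<lambda>c. [fst c, snd c]) rest)) \<Longrightarrow> \<exists>x. column_ok w D col x"
  using assms
proof (induction rest arbitrary: Y)
  case (Cons c rest)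
  {
    case 1
    then obtain z Y' where z: "Y = {..<z}" "column_ok w D (fst c) z"
      "\<And>x. x \<in> {z<..} \<inter> Y' \<Longrightarrow> column_ok w D (snd c) x" "boundary w D rest Y'" by auto
    consider "x = z" | "x \<in> {z<..} \<inter> Y'" | "x \<notin> Y'" using 1(1) z(1) by force
    then show ?case using z Cons.IH(1)[OF _ z(4)] by cases auto
  next
    case 2
    then obtain z Y' where z: "column_ok w D (fst c) z" "{z<..} \<inter> Y' \<noteq> {}"
      "\<And>x. x \<in> {z<..} \<inter> Y' \<Longrightarrow> column_ok w D (snd c) x" "boundary w D rest Y'" by auto
    then show ?case using 2(1) Cons.IH(2)[OF _ z(4)] by auto
  }
qed auto

text \<open>Completeness and soundness of the columns: the first lets a real witness be found in the
  table, the second turns a column into a witness, because no cell is empty.\<close>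

lemma table_columns_ok:
  assumes "table_ok w D T"
  shows "\<exists>col\<in>set (table_columns T). column_ok w D col x"
    and "col \<in> set (table_columns T) \<Longrightarrow> \<exists>x. column_ok w D col x"
proof -
  from assms obtain Y where Y: "boundary w D (snd T) Y" "Y \<noteq> {}"
    "\<And>x. x \<in> Y \<Longrightarrow> column_ok w D (fst T) x" by (auto simp: table_ok_def)
  show "\<exists>col\<in>set (table_columns T). column_ok w D col x"
    using Y boundary_columns(1)[OF Y(1), of x] by (cases "x \<in> Y") (auto simp: table_columns_def)
  show "\<exists>x. column_ok w D col x" if "col \<in> set (table_columns T)"
    using that Y boundary_columns(2)[OF Y(1), of col] by (auto simp: table_columns_def)
qed

subsection \<open>Quantifier elimination\<close>

text \<open>A quantifier-free formula is a list of terms with the list of the admitted sign vectors.\<close>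

definition holds :: "(nat \<Rightarrow> real) \<Rightarrow> rterm list \<times> nat list list \<Rightarrow> bool" where
  "holds w \<phi> \<longleftrightarrow> map (\<lambda>t. sign_code (rvalue w t)) (fst \<phi>) \<in> set (snd \<phi>)"

definition sign_vectors :: "nat \<Rightarrow> nat list list" where
  "sign_vectors n = rec_nat [[]] (\<lambda>k vs. concat (map (\<lambda>v. [0 # v, 1 # v, 2 # v]) vs)) n"

lemma sign_vectors_complete: "map (\<lambda>t. sign_code (f t)) ts \<in> set (sign_vectors (length ts))"
proof (induction ts)
  case (Cons t ts)
  have "sign_code (f t) = 0 \<or> sign_code (f t) = 1 \<or> sign_code (f t) = 2"
    by (simp add: sign_code_def)
  with Cons show ?case by (auto simp: sign_vectors_def)
qed (simp add: sign_vectors_def)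

lemma computable_sign_vectors [computable_intros]:
  assumes "computable n" shows "computable (\<lambda>x. sign_vectors (n x))"
  unfolding sign_vectors_def by (intro computable_intros assms)

definition q_zero :: "rterm \<Rightarrow> rterm list \<times> nat list list" where
  "q_zero t = ([t], [[0]])"

definition q_not :: "rterm list \<times> nat list list \<Rightarrow> rterm list \<times> nat list list" where
  "q_not \<phi> = (fst \<phi>, filter (\<lambda>v. v \<notin> set (snd \<phi>)) (sign_vectors (length (fst \<phi>))))"

definition q_and :: "rterm list \<times> nat list list \<Rightarrow> rterm list \<times> nat list list \<Rightarrow>
    rterm list \<times> nat list list" where
  "q_and \<phi> \<psi> = (fst \<phi> @ fst \<psi>, filter (\<lambda>v. \<exists>u\<in>set (snd \<phi>). length u = length (fst \<phi>) \<and>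
     (\<exists>u'\<in>set (snd \<psi>). v = u @ u')) (sign_vectors (length (fst \<phi> @ fst \<psi>))))"

text \<open>The vector \<open>v\<close> is a guess for the signs of all coefficients. For a guess
  that no assignment realises the table is meaningless but harmless, because \<open>holds\<close>
  looks only at the actual signs.\<close>

definition column_admitted ::
    "nat list list \<Rightarrow> rterm list list \<Rightarrow> rterm list list \<Rightarrow> nat list \<Rightarrow> bool" where
  "column_admitted V ps L v \<longleftrightarrow> (\<exists>col\<in>set (table_columns (snd (sign_table (zip (concat L) v) L))).
     map (\<lambda>p. alookup col p) ps \<in> set V)"

definition eliminate ::
    "nat list list \<Rightarrow> rterm list list \<Rightarrow> rterm list list \<Rightarrow> rterm list \<times> nat list list" where
  "eliminate V ps L =
    (concat L, filter (\<lambda>v. column_admitted V ps L v) (sign_vectors (length (concat L))))"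

definition q_ex :: "nat \<Rightarrow> rterm list \<times> nat list list \<Rightarrow> rterm list \<times> nat list list" where
  "q_ex i \<phi> = eliminate (snd \<phi>) (map (to_poly i) (fst \<phi>))
    (closure_list (map (to_poly i) (fst \<phi>)))"

lemma holds_q_zero [simp]: "holds w (q_zero t) \<longleftrightarrow> rvalue w t = 0"
  by (auto simp: holds_def q_zero_def sign_code_simps)

lemma holds_q_not [simp]: "holds w (q_not \<phi>) \<longleftrightarrow> \<not> holds w \<phi>"
  by (simp add: holds_def q_not_def sign_vectors_complete)

lemma holds_q_and [simp]: "holds w (q_and \<phi> \<psi>) \<longleftrightarrow> holds w \<phi> \<and> holds w \<psi>"
proof -
  have "holds w (q_and \<phi> \<psi>) \<longleftrightarrow> (\<exists>u\<in>set (snd \<phi>). length u = length (fst \<phi>) \<and>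
     (\<exists>u'\<in>set (snd \<psi>). map (\<lambda>t. sign_code (rvalue w t)) (fst \<phi> @ fst \<psi>) = u @ u'))"
    using sign_vectors_complete[of "rvalue w" "fst \<phi> @ fst \<psi>"] by (simp add: holds_def q_and_def)
  then show ?thesis by (auto simp: holds_def)
qed

lemma holds_q_ex: "holds w (q_ex i \<phi>) \<longleftrightarrow> (\<exists>a. holds (w(i := a)) \<phi>)"
proof -
  define ts where "ts = fst \<phi>"
  define L where "L = closure_list (map (to_poly i) ts)"
  define v where "v = map (\<lambda>t. sign_code (rvalue w t)) (concat L)"
  define st where "st = sign_table (zip (concat L) v) L"
  have "set (fst st) = set L \<and> table_ok w (fst st) (snd st)"
    unfolding st_def
  proof (rule sign_table_ok, intro ballI)
    fix q c assume "q \<in> set L" "c \<in> set q"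
    then have "c \<in> set (concat L)" by auto
    then show "alookup (zip (concat L) v) c = sign_code (rvalue w c)"
      unfolding v_def by (rule alookup_zip)
  qed (simp add: L_def good_order_closure_list)
  then have L: "set (fst st) = set L" and ok: "table_ok w (fst st) (snd st)" by auto
  have mem: "to_poly i t \<in> set (fst st)" if "t \<in> set ts" for t
    using that closure_list_superset[of "map (to_poly i) ts"] L by (auto simp: L_def)
  have signs: "map (\<lambda>t. alookup col (to_poly i t)) ts =
      map (\<lambda>t. sign_code (rvalue (w(i := x)) t)) ts" if "column_ok w (fst st) col x" for col x
    using that mem by (auto simp: column_ok_def pvalue_to_poly)
  have "holds w (q_ex i \<phi>) \<longleftrightarrow> (\<exists>col\<in>set (table_columns (snd st)).
      map (\<lambda>t. alookup col (to_poly i t)) ts \<in> set (snd \<phi>))"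
    using sign_vectors_complete[of "rvalue w" "concat L"]
    by (simp add: holds_def q_ex_def eliminate_def column_admitted_def st_def v_def L_def ts_def o_def)
  also have "\<dots> \<longleftrightarrow> (\<exists>x. map (\<lambda>t. sign_code (rvalue (w(i := x)) t)) ts \<in> set (snd \<phi>))"
    using table_columns_ok[OF ok] signs by metis
  finally show ?thesis by (simp add: holds_def ts_def)
qed

lemma computable_q_zero [computable_intros]:
  assumes "computable t" shows "computable (\<lambda>x. q_zero (t x))"
  unfolding q_zero_def by (intro computable_intros assms)

lemma computable_q_not [computable_intros]:
  assumes "computable f" shows "computable (\<lambda>x. q_not (f x))"
  unfolding q_not_def by (intro computable_intros assms computable_comp[OF assms])

lemma computable_q_and [computable_intros]:
  assumes "computable f" "computable g" shows "computable (\<lambda>x. q_and (f x) (g x))"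
proof -
  have "computable (\<lambda>p. q_and (fst p) (snd p))"
    unfolding q_and_def by (intro computable_intros)
  from computable_comp2[OF this assms] show ?thesis .
qed

lemma computable_column_admitted [computable_intros]:
  assumes "computable V" "computable ps" "computable L" "computable v"
  shows "computable (\<lambda>x. column_admitted (V x) (ps x) (L x) (v x))"
  unfolding column_admitted_def
  by (intro computable_intros assms computable_comp[OF assms(1)] computable_comp[OF assms(2)])

lemma computable_eliminate [computable_intros]:
  assumes "computable V" "computable ps" "computable L"
  shows "computable (\<lambda>x. eliminate (V x) (ps x) (L x))"
  unfolding eliminate_def
  by (intro computable_intros assms computable_comp[OF assms(1)] computable_comp[OF assms(2)]
    computable_comp[OF assms(3)])

lemma computable_q_ex [computable_intros]:
  assumes "computable i" "computable f" shows "computable (\<lambda>x. q_ex (i x) (f x))"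
proof -
  have "computable (\<lambda>p. q_ex (fst p) (snd p))"
    unfolding q_ex_def by (intro computable_intros)
  from computable_comp2[OF this assms] show ?thesis .
qed

end

section \<open>The Hilbert basis theorem\<close>

text \<open>Subrings of one ambient ring, later that of the real functions on matrices, so that
  adjoining one matrix entry after another stays within a single type.\<close>

definition subring_set :: "'a::comm_ring_1 set \<Rightarrow> bool" where
  "subring_set S \<longleftrightarrow> 1 \<in> S \<and> (\<forall>x\<in>S. - x \<in> S) \<and> (\<forall>x\<in>S. \<forall>y\<in>S. x + y \<in> S \<and> x * y \<in> S)"

lemma subring_setD:
  assumes "subring_set S"
  shows "0 \<in> S" "1 \<in> S" "x \<in> S \<Longrightarrow> - x \<in> S" "x \<in> S \<Longrightarrow> y \<in> S \<Longrightarrow> x + y \<in> S"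
    "x \<in> S \<Longrightarrow> y \<in> S \<Longrightarrow> x * y \<in> S"
proof -
  have "1 + (- 1) \<in> S" using assms unfolding subring_set_def by blast
  then show "0 \<in> S" by simp
qed (use assms in \<open>auto simp: subring_set_def\<close>)

lemma subring_set_sum: "subring_set S \<Longrightarrow> (\<And>i. i \<in> A \<Longrightarrow> f i \<in> S) \<Longrightarrow> sum f A \<in> S"
  by (induction A rule: infinite_finite_induct) (auto intro: subring_setD)

lemma subring_set_prod: "subring_set S \<Longrightarrow> (\<And>i. i \<in> A \<Longrightarrow> f i \<in> S) \<Longrightarrow> prod f A \<in> S"
  by (induction A rule: infinite_finite_induct) (auto intro: subring_setD)

lemma subring_set_power: "subring_set S \<Longrightarrow> x \<in> S \<Longrightarrow> x ^ n \<in> S"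
  by (induction n) (auto intro: subring_setD)

inductive_set ideal_gen :: "'a::comm_ring_1 set \<Rightarrow> 'a set \<Rightarrow> 'a set" for T B where
  zero: "0 \<in> ideal_gen T B"
| step: "y \<in> ideal_gen T B \<Longrightarrow> a \<in> T \<Longrightarrow> b \<in> B \<Longrightarrow> y + a * b \<in> ideal_gen T B"

lemma ideal_gen_add:
  assumes "x \<in> ideal_gen T B" "y \<in> ideal_gen T B" shows "x + y \<in> ideal_gen T B"
  using assms(2) by induction (use assms(1) in \<open>auto simp: add.assoc[symmetric] intro: ideal_gen.intros\<close>)

lemma ideal_gen_mult:
  assumes T: "subring_set T" and "c \<in> T" "x \<in> ideal_gen T B" shows "c * x \<in> ideal_gen T B"
  using assms(3)
proof induction
  case (step y a b)
  then show ?case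
    using ideal_gen.step[of "c * y" T B "c * a" b] subring_setD(5)[OF T assms(2)]
    by (simp add: algebra_simps)
qed (simp add: ideal_gen.zero)

lemma ideal_gen_base: "subring_set T \<Longrightarrow> b \<in> B \<Longrightarrow> b \<in> ideal_gen T B"
  using ideal_gen.step[OF ideal_gen.zero subring_setD(2)] by fastforce

lemma ideal_gen_subset:
  assumes T: "subring_set T" and "B \<subseteq> ideal_gen T C" shows "ideal_gen T B \<subseteq> ideal_gen T C"
proof
  fix x assume "x \<in> ideal_gen T B"
  then show "x \<in> ideal_gen T C"
    by induction (use assms in \<open>auto intro: ideal_gen.zero ideal_gen_add ideal_gen_mult[OF T]\<close>)
qed

lemma ideal_gen_finite: "x \<in> ideal_gen T B \<Longrightarrow> \<exists>F\<subseteq>B. finite F \<and> x \<in> ideal_gen T F"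
proof (induction rule: ideal_gen.induct)
  case (step y a b)
  then obtain F where F: "F \<subseteq> B" "finite F" "y \<in> ideal_gen T F" by blast
  have "ideal_gen T F \<subseteq> ideal_gen T (insert b F)"
  proof
    fix x assume "x \<in> ideal_gen T F"
    then show "x \<in> ideal_gen T (insert b F)" by induction (auto intro: ideal_gen.intros)
  qed
  then have "y + a * b \<in> ideal_gen T (insert b F)" using F(3) step by (auto intro: ideal_gen.intros)
  then show ?case using F step by (intro exI[of _ "insert b F"]) auto
qed (auto intro: ideal_gen.zero)

text \<open>Stated for arbitrary subsets \<open>I\<close>, with the generators taken from
  \<open>I\<close> itself: the finitely many equations obtained in the end are then among the given
  integral ones.\<close>

definition noetherian :: "'a::comm_ring_1 set \<Rightarrow> bool" where
  "noetherian S \<longleftrightarrow> (\<forall>I\<subseteq>S. \<exists>F\<subseteq>I. finite F \<and> I \<subseteq> ideal_gen S F)"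

definition adjoin :: "'a::comm_ring_1 set \<Rightarrow> 'a \<Rightarrow> 'a set" where
  "adjoin S x = {poly p x | p. \<forall>i. coeff p i \<in> S}"

lemma subring_set_adjoin:
  fixes S :: "'a::comm_ring_1 set"
  assumes S: "subring_set S"
  shows "subring_set (adjoin S x)" "S \<subseteq> adjoin S x" "x \<in> adjoin S x"
proof -
  have mem: "poly p x \<in> adjoin S x" if "\<And>i. coeff p i \<in> S" for p
    using that by (auto simp: adjoin_def)
  have "poly 1 x \<in> adjoin S x" by (rule mem) (simp add: coeff_1 subring_setD(1,2)[OF S])
  moreover have "- y \<in> adjoin S x" if y: "y \<in> adjoin S x" for y
  proof -
    obtain p where p: "y = poly p x" "\<And>i. coeff p i \<in> S" using y by (auto simp: adjoin_def)
    have "poly (- p) x \<in> adjoin S x" by (rule mem) (simp add: p subring_setD(3)[OF S])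
    then show ?thesis by (simp add: p)
  qed
  moreover have "y + z \<in> adjoin S x \<and> y * z \<in> adjoin S x"
    if y: "y \<in> adjoin S x" and z: "z \<in> adjoin S x" for y z
  proof -
    obtain p where p: "y = poly p x" "\<And>i. coeff p i \<in> S" using y by (auto simp: adjoin_def)
    obtain q where q: "z = poly q x" "\<And>i. coeff q i \<in> S" using z by (auto simp: adjoin_def)
    have "poly (p + q) x \<in> adjoin S x" by (rule mem) (simp add: p q subring_setD(4)[OF S])
    moreover have "poly (p * q) x \<in> adjoin S x"
      by (rule mem) (simp add: coeff_mult p q subring_set_sum[OF S] subring_setD(5)[OF S])
    ultimately show ?thesis by (simp add: p q)
  qed
  ultimately show "subring_set (adjoin S x)" by (simp add: subring_set_def)
  show "S \<subseteq> adjoin S x"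
  proof
    fix a assume "a \<in> S"
    then have "poly [:a:] x \<in> adjoin S x"
      by (intro mem) (simp add: coeff_pCons subring_setD(1)[OF S] split: nat.split)
    then show "a \<in> adjoin S x" by simp
  qed
  have "poly [:0, 1:] x \<in> adjoin S x"
    by (intro mem) (simp add: coeff_pCons subring_setD(1,2)[OF S] split: nat.split)
  then show "x \<in> adjoin S x" by simp
qed

text \<open>If the ideal were not finitely generated, one could choose successive members of minimal
  degree outside the ideal of the previous ones; a relation between their leading coefficients
  then yields a member of smaller degree.\<close>

theorem noetherian_adjoin:
  assumes S: "subring_set S" and noeth: "noetherian S"
  shows "noetherian (adjoin S x)"
  unfolding noetherian_def
proof (intro allI impI)
  fix I assume I: "I \<subseteq> adjoin S x"
  define T where "T = adjoin S x"
  have T: "subring_set T" and ST: "S \<subseteq> T" and xT: "x \<in> T"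
    using subring_set_adjoin[OF S] by (auto simp: T_def)
  \<comment> \<open>Degrees belong to polynomials and not to their values, as \<open>x\<close> may
    satisfy relations over \<open>S\<close>; hence the choice is made among polynomials.\<close>
  define P where "P = {p. (\<forall>i. coeff p i \<in> S) \<and> poly p x \<in> ideal_gen T I}"
  have P: "\<exists>p\<in>P. y = poly p x" if y: "y \<in> I" for y
  proof -
    obtain p where "y = poly p x" "\<forall>i. coeff p i \<in> S" using I y unfolding adjoin_def by blast
    moreover from this have "p \<in> P" using ideal_gen_base[OF T y] by (simp add: P_def)
    ultimately show ?thesis by blast
  qed
  show "\<exists>F\<subseteq>I. finite F \<and> I \<subseteq> ideal_gen (adjoin S x) F"
  proof (rule ccontr)
    assume not_fg: "\<not> ?thesis"
    have ex: "\<exists>p\<in>P. poly p x \<notin> ideal_gen T ((\<lambda>p. poly p x) ` set l)" if l: "set l \<subseteq> P" for l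
    proof (rule ccontr)
      assume "\<not> ?thesis"
      then have gen: "I \<subseteq> ideal_gen T ((\<lambda>p. poly p x) ` set l)" using P by blast
      \<comment> \<open>The values of the chosen polynomials lie in the ideal of \<open>I\<close>,
        but perhaps not in \<open>I\<close>, so they are traded for the finitely many members of
        \<open>I\<close> that produce them.\<close>
      have "\<forall>p\<in>set l. \<exists>F\<subseteq>I. finite F \<and> poly p x \<in> ideal_gen T F"
        using l by (auto simp: P_def intro: ideal_gen_finite)
      then obtain F where F: "\<And>p. p \<in> set l \<Longrightarrow> F p \<subseteq> I \<and> finite (F p) \<and> poly p x \<in> ideal_gen T (F p)"
        by metis
      have "poly p x \<in> ideal_gen T (\<Union>p\<in>set l. F p)" if "p \<in> set l" for p
      proof -
        have "ideal_gen T (F p) \<subseteq> ideal_gen T (\<Union>p\<in>set l. F p)"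
          using that by (intro ideal_gen_subset[OF T] subsetI ideal_gen_base[OF T]) blast
        then show ?thesis using F[OF that] by blast
      qed
      then have "I \<subseteq> ideal_gen T (\<Union>p\<in>set l. F p)"
        using gen ideal_gen_subset[OF T, of "(\<lambda>p. poly p x) ` set l" "\<Union>p\<in>set l. F p"] by blast
      moreover have "(\<Union>p\<in>set l. F p) \<subseteq> I" "finite (\<Union>p\<in>set l. F p)" using F by auto
      ultimately show False using not_fg unfolding T_def by blast
    qed
    define out where "out l p \<longleftrightarrow> p \<in> P \<and> poly p x \<notin> ideal_gen T ((\<lambda>p. poly p x) ` set l)" for l p
    define pick where "pick l = (SOME p. out l p \<and> (\<forall>q. out l q \<longrightarrow> degree p \<le> degree q))" for l
    have pick: "out l (pick l)" "\<And>q. out l q \<Longrightarrow> degree (pick l) \<le> degree q" if l: "set l \<subseteq> P" for l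
    proof -
      have "\<exists>p. out l p \<and> (\<forall>q. out l q \<longrightarrow> degree p \<le> degree q)"
      proof -
        obtain p where "out l p" using ex[OF l] unfolding out_def by blast
        then show ?thesis by (rule ex_has_least_nat)
      qed
      from someI_ex[OF this] show "out l (pick l)" "\<And>q. out l q \<Longrightarrow> degree (pick l) \<le> degree q"
        unfolding pick_def by auto
    qed
    define G where "G n = rec_nat [] (\<lambda>_ l. l @ [pick l]) n" for n
    define f where "f n = pick (G n)" for n
    have G_Suc: "G (Suc n) = G n @ [f n]" and G_0: "G 0 = []" for n by (simp_all add: G_def f_def)
    have G: "set (G n) = f ` {..<n}" for n
      by (induction n) (auto simp: G_Suc G_0 lessThan_Suc)
    have GP: "set (G n) \<subseteq> P" for n
    proof (induction n)
      case (Suc n)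
      then show ?case using pick(1)[OF Suc] by (simp add: G_Suc out_def f_def)
    qed (simp add: G_0)
    define J where "J n = ideal_gen T ((\<lambda>p. poly p x) ` f ` {..<n})" for n
    have f: "f n \<in> P" "poly (f n) x \<notin> J n" for n
      using pick(1)[OF GP, of n] unfolding out_def f_def[symmetric] J_def G by auto
    have minimal: "degree (f n) \<le> degree q" if "q \<in> P" "poly q x \<notin> J n" for n q
      using pick(2)[OF GP, of n q] that unfolding out_def f_def[symmetric] J_def G by auto
    have J_mono: "J m \<subseteq> J n" if "m \<le> n" for m n
      unfolding J_def
    proof (intro ideal_gen_subset[OF T] subsetI ideal_gen_base[OF T])
      show "y \<in> (\<lambda>p. poly p x) ` f ` {..<n}" if "y \<in> (\<lambda>p. poly p x) ` f ` {..<m}" for y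
        using that \<open>m \<le> n\<close> by auto
    qed
    have deg_mono: "degree (f m) \<le> degree (f n)" if "m \<le> n" for m n
      using minimal[OF f(1)] f(2)[of n] J_mono[OF that] by blast
    define a where "a n = lead_coeff (f n)" for n
    have "range a \<subseteq> S" using f(1) by (auto simp: a_def P_def)
    from mp[OF spec[OF noeth[unfolded noetherian_def]] this]
    obtain F where F: "F \<subseteq> range a" "finite F" "range a \<subseteq> ideal_gen S F" by auto
    obtain K where K: "finite K" "F = a ` K" using finite_subset_image[OF F(2,1)] by blast
    obtain N where N: "K \<subseteq> {..<N}" using finite_nat_bounded[OF K(1)] by blast
    have "F \<subseteq> ideal_gen S (a ` {..<N})"
      using K N by (intro subsetI ideal_gen_base[OF S]) auto
    then have aN: "a N \<in> ideal_gen S (a ` {..<N})"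
      using F(3) ideal_gen_subset[OF S] by blast
    \<comment> \<open>A relation between leading coefficients is lifted to polynomials: a monomial
      shifts each \<open>f i\<close> to the degree of \<open>f N\<close>, which is possible since
      the degrees do not decrease.\<close>
    have "\<exists>q\<in>P. degree q \<le> degree (f N) \<and> coeff q (degree (f N)) = y \<and> poly q x \<in> J N"
      if "y \<in> ideal_gen S (a ` {..<N})" for y
      using that
    proof induction
      case zero
      show ?case by (rule bexI[of _ 0])
        (auto simp: P_def J_def intro: ideal_gen.zero subring_setD[OF S])
    next
      case (step y c b)
      then obtain q i where q: "q \<in> P" "degree q \<le> degree (f N)" "coeff q (degree (f N)) = y"
        "poly q x \<in> J N" and i: "i < N" "b = a i" by blast
      define k where "k = degree (f N) - degree (f i)"
      have k: "degree (f i) + k = degree (f N)" using deg_mono[of i N] i by (simp add: k_def)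
      define r where "r = q + monom c k * f i"
      have fi: "\<forall>j. coeff (f i) j \<in> S" "poly (f i) x \<in> ideal_gen T I"
        using f(1)[of i] by (auto simp: P_def)
      have cx: "c * x ^ k \<in> T"
        using step(2) ST xT by (intro subring_setD(5)[OF T] subring_set_power[OF T]) auto
      have poly_r: "poly r x = poly q x + c * x ^ k * poly (f i) x"
        by (simp add: r_def poly_monom)
      have "coeff r j \<in> S" for j
        using q(1) fi(1) step(2)
        by (auto simp: r_def P_def coeff_monom_mult intro!: subring_setD(4,5)[OF S] subring_setD(1)[OF S])
      moreover have "poly r x \<in> ideal_gen T I" unfolding poly_r
        using q(1) fi(2) cx by (auto simp: P_def intro!: ideal_gen_add ideal_gen_mult[OF T])
      ultimately have "r \<in> P" by (simp add: P_def)
      moreover have "degree r \<le> degree (f N)"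
      proof -
        have "degree (monom c k * f i) \<le> k + degree (f i)"
          by (rule order.trans[OF degree_mult_le]) (simp add: degree_monom_le)
        then show ?thesis using q(2) k unfolding r_def by (intro degree_add_le) auto
      qed
      moreover have "coeff r (degree (f N)) = y + c * b"
        using q(3) k i by (auto simp: r_def coeff_monom_mult a_def k_def)
      moreover have "poly r x \<in> J N"
      proof -
        have "poly (f i) x \<in> J N" unfolding J_def by (rule ideal_gen_base[OF T]) (use i in auto)
        then show ?thesis unfolding poly_r using q(4) cx
          by (auto simp: J_def intro!: ideal_gen_add ideal_gen_mult[OF T])
      qed
      ultimately show ?case by blast
    qed
    from this[OF aN] obtain q where q: "q \<in> P" "degree q \<le> degree (f N)"
      "coeff q (degree (f N)) = a N" "poly q x \<in> J N" by blast
    \<comment> \<open>The leading terms cancel, so \<open>g\<close> is 0 or has a smaller degree,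
      but like \<open>f N\<close> its value is outside \<open>J N\<close>; this contradicts the
      minimality of \<open>f N\<close>.\<close>
    define g where "g = f N - q"
    have uminus: "- y \<in> ideal_gen T B" if "y \<in> ideal_gen T B" for y B
      using ideal_gen_mult[OF T, of "- 1" y B] that subring_setD(2,3)[OF T] by simp
    have "g \<in> P"
    proof -
      have "coeff (f N) j + - coeff q j \<in> S" for j
        using f(1)[of N] q(1) by (intro subring_setD(4)[OF S] subring_setD(3)[OF S]) (auto simp: P_def)
      moreover have "poly (f N) x + - poly q x \<in> ideal_gen T I"
        using f(1)[of N] q(1) by (intro ideal_gen_add uminus) (auto simp: P_def)
      ultimately show ?thesis by (simp add: P_def g_def)
    qed
    moreover have "poly g x \<notin> J N"
    proof
      assume "poly g x \<in> J N"
      then have "poly g x + poly q x \<in> J N" using q(4) unfolding J_def by (rule ideal_gen_add)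
      then show False using f(2)[of N] by (simp add: g_def)
    qed
    ultimately have min: "degree (f N) \<le> degree g" by (rule minimal)
    have "coeff g (degree (f N)) = 0" using q(3) by (simp add: g_def a_def)
    moreover have "degree g \<le> degree (f N)" unfolding g_def using q(2) by (intro degree_diff_le) auto
    ultimately have "lead_coeff g = 0" using min by (simp add: order.antisym)
    then have "g = 0" by simp
    then show False using \<open>poly g x \<notin> J N\<close> by (simp add: J_def ideal_gen.zero)
  qed
qed

section \<open>Polynomial functions of matrices\<close>

definition matrix_monomial :: "('n \<times> 'n \<Rightarrow>\<^sub>0 nat) \<Rightarrow> 'k::comm_ring_1^'n::finite^'n \<Rightarrow> 'k" where
  "matrix_monomial m g = (\<Prod>(i, j)\<in>Poly_Mapping.keys m. (g $ i $ j) ^ Poly_Mapping.lookup m (i, j))"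

lemma poly_value_monomial:
  "poly_value p g = (\<Sum>m\<in>Poly_Mapping.keys p. of_int (Poly_Mapping.lookup p m) * matrix_monomial m g)"
  by (simp add: poly_value_def matrix_monomial_def)

text \<open>The constant functions form a field and so are noetherian; this survives adjoining the
  finitely many matrix entries, after which all functions \<open>poly_value p\<close> are
  available.\<close>

lemma ex_finite_equations:
  fixes I :: "'n::finite entry_poly set"
  shows "\<exists>F\<subseteq>I. finite F \<and> (\<forall>g :: real^'n^'n. (\<forall>p\<in>F. poly_value p g = 0) \<longrightarrow> (\<forall>p\<in>I. poly_value p g = 0))"
proof -
  define C :: "(real^'n^'n \<Rightarrow> real) set" where "C = range (\<lambda>c g. c)"
  have C: "subring_set C"
    unfolding subring_set_def C_def by (auto simp: plus_fun_def times_fun_def one_fun_def fun_Compl_def)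
  have C_ideal: "b \<in> ideal_gen C F" if "(\<lambda>g. c) \<in> F" "c \<noteq> 0" "b \<in> C" for b F c
  proof -
    from that(3) obtain d where b: "b = (\<lambda>g. d)" by (auto simp: C_def)
    have "0 + (\<lambda>g. d / c) * (\<lambda>g. c) \<in> ideal_gen C F"
      using that(1) by (intro ideal_gen.intros) (auto simp: C_def)
    moreover have "0 + (\<lambda>g. d / c) * (\<lambda>g. c) = b"
      using that(2) b by (auto simp: times_fun_def)
    ultimately show ?thesis by simp
  qed
  have noethC: "noetherian C"
    unfolding noetherian_def
  proof (intro allI impI)
    fix I assume I: "I \<subseteq> C"
    show "\<exists>F\<subseteq>I. finite F \<and> I \<subseteq> ideal_gen C F"
    proof (cases "I \<subseteq> {0}")
      case True
      then have "I \<subseteq> ideal_gen C {}" using ideal_gen.zero[of C "{}"] by auto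
      then show ?thesis by blast
    next
      case False
      then obtain b where b: "b \<in> I" "b \<noteq> 0" by blast
      then obtain c where c: "b = (\<lambda>g. c)" using I by (auto simp: C_def)
      then have "c \<noteq> 0" using b(2) by (auto simp: zero_fun_def)
      then have "I \<subseteq> ideal_gen C {b}" using C_ideal[of c "{b}"] c I by blast
      then show ?thesis using b(1) by blast
    qed
  qed
  have "\<exists>T. subring_set T \<and> noetherian T \<and> C \<subseteq> T \<and> E \<subseteq> T" if "finite E" for E
    using that
  proof induction
    case empty
    then show ?case using C noethC by blast
  next
    case (insert e E)
    then obtain T where "subring_set T" "noetherian T" "C \<subseteq> T" "E \<subseteq> T" by blast
    with subring_set_adjoin[of T e] noetherian_adjoin[of T e] show ?case
      by (intro exI[of _ "adjoin T e"]) blast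
  qed
  from this[of "range (\<lambda>ij g. g $ fst ij $ snd ij)"] obtain T where T: "subring_set T" "noetherian T"
    "C \<subseteq> T" "range (\<lambda>ij g. g $ fst ij $ snd ij) \<subseteq> T" by auto
  have const: "(\<lambda>g. c) \<in> T" for c using T(3) by (auto simp: C_def)
  have entry: "(\<lambda>g. g $ i $ j) \<in> T" for i j using T(4) by (auto simp: image_subset_iff)
  have monomial: "matrix_monomial m \<in> T" for m
  proof -
    have eq: "matrix_monomial m = (\<Prod>ij\<in>Poly_Mapping.keys m.
        (\<lambda>g :: real^'n^'n. g $ fst ij $ snd ij) ^ Poly_Mapping.lookup m ij)"
    proof
      fix g :: "real^'n^'n"
      have pow: "(f ^ k) g = f g ^ k" for f :: "real^'n^'n \<Rightarrow> real" and k
        by (induction k) (auto simp: times_fun_def one_fun_def)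
      have prod: "(\<Prod>ij\<in>A. h ij) g = (\<Prod>ij\<in>A. h ij g)"
        for A and h :: "'n \<times> 'n \<Rightarrow> real^'n^'n \<Rightarrow> real"
        by (induction A rule: infinite_finite_induct) (auto simp: times_fun_def one_fun_def)
      show "matrix_monomial m g = (\<Prod>ij\<in>Poly_Mapping.keys m.
        (\<lambda>g. g $ fst ij $ snd ij) ^ Poly_Mapping.lookup m ij) g"
        by (simp add: matrix_monomial_def prod pow case_prod_unfold)
    qed
    show ?thesis unfolding eq by (intro subring_set_prod[OF T(1)] subring_set_power[OF T(1)] entry)
  qed
  have value_mem: "poly_value p \<in> T" for p :: "'n entry_poly"
  proof -
    have sum: "(\<Sum>m\<in>A. h m) g = (\<Sum>m\<in>A. h m g)"
      for A and h :: "('n \<times> 'n \<Rightarrow>\<^sub>0 nat) \<Rightarrow> real^'n^'n \<Rightarrow> real" and g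
      by (induction A rule: infinite_finite_induct) (auto simp: plus_fun_def zero_fun_def)
    have "poly_value p = (\<Sum>m\<in>Poly_Mapping.keys p.
        (\<lambda>g :: real^'n^'n. of_int (Poly_Mapping.lookup p m)) * matrix_monomial m)"
    proof
      fix g :: "real^'n^'n"
      show "poly_value p g = (\<Sum>m\<in>Poly_Mapping.keys p.
        (\<lambda>g. of_int (Poly_Mapping.lookup p m)) * matrix_monomial m) g"
        by (simp add: poly_value_monomial sum times_fun_def)
    qed
    then show ?thesis
      by (simp only:) (intro subring_set_sum[OF T(1)] subring_setD(5)[OF T(1)] monomial const)
  qed
  have "poly_value ` I \<subseteq> T" using value_mem by auto
  from mp[OF spec[OF T(2)[unfolded noetherian_def]] this]
  obtain F where F: "F \<subseteq> poly_value ` I" "finite F" "poly_value ` I \<subseteq> ideal_gen T F"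
    by (elim exE conjE) (rule that)
  from finite_subset_image[OF F(2,1)]
  obtain F' where F': "F' \<subseteq> I" "finite F'" "F = poly_value ` F'"
    by (elim exE conjE) (rule that)
  have "poly_value p g = 0" if g: "\<forall>q\<in>F'. poly_value q g = 0" and p: "p \<in> I"
    for p and g :: "real^'n^'n"
  proof -
    have "f g = 0" if "f \<in> ideal_gen T F" for f
      using that
    proof induction
      case (step y a b)
      then show ?case using g F'(3) by (auto simp: plus_fun_def times_fun_def)
    qed (simp add: zero_fun_def)
    then show ?thesis using F(3)[unfolded image_subset_iff] p by (simp only:)
  qed
  then show ?thesis using F'(1,2) by (intro exI[of _ F'] conjI allI impI ballI)
qed

text \<open>Coefficients from the whole ring are needed, because translation by a matrix of the
  closure does not preserve integral polynomials. The inductive form gives composition with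
  polynomial maps at once.\<close>

inductive_set poly_funs :: "('k::comm_ring_1^'n::finite^'n \<Rightarrow> 'k) set" where
  const: "(\<lambda>g. c) \<in> poly_funs"
| entry: "(\<lambda>g. g $ i $ j) \<in> poly_funs"
| add: "f \<in> poly_funs \<Longrightarrow> h \<in> poly_funs \<Longrightarrow> (\<lambda>g. f g + h g) \<in> poly_funs"
| mult: "f \<in> poly_funs \<Longrightarrow> h \<in> poly_funs \<Longrightarrow> (\<lambda>g. f g * h g) \<in> poly_funs"

lemma poly_funs_sum: "(\<And>i. i \<in> A \<Longrightarrow> f i \<in> poly_funs) \<Longrightarrow> (\<lambda>g. \<Sum>i\<in>A. f i g) \<in> poly_funs"
  by (induction A rule: infinite_finite_induct) (auto intro: poly_funs.intros)

lemma poly_funs_prod: "(\<And>i. i \<in> A \<Longrightarrow> f i \<in> poly_funs) \<Longrightarrow> (\<lambda>g. \<Prod>i\<in>A. f i g) \<in> poly_funs"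
  by (induction A rule: infinite_finite_induct) (auto intro: poly_funs.intros)

lemma poly_funs_power: "f \<in> poly_funs \<Longrightarrow> (\<lambda>g. f g ^ n) \<in> poly_funs"
  by (induction n) (auto intro: poly_funs.intros)

lemma poly_value_poly_funs: "poly_value p \<in> poly_funs"
  unfolding poly_value_def[abs_def] case_prod_unfold
  by (intro poly_funs_sum poly_funs.intros poly_funs_prod poly_funs_power)

lemma poly_funs_comp:
  assumes "f \<in> poly_funs" "\<And>i j. (\<lambda>g. \<phi> g $ i $ j) \<in> poly_funs"
  shows "(\<lambda>g. f (\<phi> g)) \<in> poly_funs"
  using assms(1)
proof induction
  case (const c)
  show ?case by (rule poly_funs.const)
next
  case (entry i j)
  show ?case by (rule assms(2))
next
  case (add f h)
  show ?case by (rule poly_funs.add[OF add.IH])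
next
  case (mult f h)
  show ?case by (rule poly_funs.mult[OF mult.IH])
qed

lemma det_poly_funs:
  assumes "\<And>i j. (\<lambda>g. \<phi> g $ i $ j) \<in> poly_funs"
  shows "(\<lambda>g. det (\<phi> g)) \<in> poly_funs"
  unfolding det_def by (intro poly_funs_sum poly_funs.intros poly_funs_prod assms)

lemma matrix_monomial_UNIV:
  "matrix_monomial m g = (\<Prod>ij\<in>UNIV. (g $ fst ij $ snd ij) ^ Poly_Mapping.lookup m ij)"
  unfolding matrix_monomial_def case_prod_unfold prod.collapse
  by (rule prod.mono_neutral_left) (auto simp: in_keys_iff)

lemma matrix_monomial_add: "matrix_monomial (m + m') g = matrix_monomial m g * matrix_monomial m' g"
  by (simp add: matrix_monomial_UNIV lookup_add power_add prod.distrib)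

text \<open>The normal form makes the coefficients accessible for their expansion over the
  rationals. A product is regrouped by the sums of the exponents.\<close>

lemma poly_funs_expand:
  assumes "f \<in> poly_funs"
  shows "\<exists>M c. finite M \<and> (\<forall>g. f g = (\<Sum>m\<in>M. c m * matrix_monomial m g))"
  using assms
proof induction
  case (const c)
  have "c = (\<Sum>m\<in>{0}. c * matrix_monomial m g)" for g
    by (simp add: matrix_monomial_UNIV)
  then have "finite {0} \<and> (\<forall>g. c = (\<Sum>m\<in>{0}. (\<lambda>_. c) m * matrix_monomial m g))"
    by (intro conjI allI finite.insertI finite.emptyI)
  then have "\<exists>c'. finite {0} \<and> (\<forall>g. c = (\<Sum>m\<in>{0}. c' m * matrix_monomial m g))"
    by (rule exI[of _ "\<lambda>_. c"])
  then show ?case by (rule exI[of _ "{0}"])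
next
  case (entry i j)
  have "g $ i $ j = (\<Sum>m\<in>{Poly_Mapping.single (i, j) 1}. 1 * matrix_monomial m g)" for g :: "'a^'b^'b"
    by (simp add: matrix_monomial_def)
  then have "finite {Poly_Mapping.single (i, j) 1} \<and> (\<forall>g :: 'a^'b^'b. g $ i $ j =
      (\<Sum>m\<in>{Poly_Mapping.single (i, j) 1}. (\<lambda>_. 1) m * matrix_monomial m g))"
    by (intro conjI allI finite.insertI finite.emptyI)
  then have "\<exists>c. finite {Poly_Mapping.single (i, j) 1} \<and> (\<forall>g :: 'a^'b^'b. g $ i $ j =
      (\<Sum>m\<in>{Poly_Mapping.single (i, j) 1}. c m * matrix_monomial m g))"
    by (rule exI[of _ "\<lambda>_. 1"])
  then show ?case by (rule exI[of _ "{Poly_Mapping.single (i, j) 1}"])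
next
  case (add f h)
  then obtain M c M' c' where M: "finite M" "\<And>g. f g = (\<Sum>m\<in>M. c m * matrix_monomial m g)"
    "finite M'" "\<And>g. h g = (\<Sum>m\<in>M'. c' m * matrix_monomial m g)"
    by (elim exE conjE) (simp only:)
  have "f g + h g = (\<Sum>m\<in>M \<union> M'. ((if m \<in> M then c m else 0) + (if m \<in> M' then c' m else 0)) *
      matrix_monomial m g)" for g
  proof -
    have "f g = (\<Sum>m\<in>M \<union> M'. (if m \<in> M then c m else 0) * matrix_monomial m g)"
      unfolding M(2) by (rule sum.mono_neutral_cong_left) (use M in auto)
    moreover have "h g = (\<Sum>m\<in>M \<union> M'. (if m \<in> M' then c' m else 0) * matrix_monomial m g)"
      unfolding M(4) by (rule sum.mono_neutral_cong_left) (use M in auto)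
    ultimately show ?thesis by (simp only: sum.distrib[symmetric] distrib_right)
  qed
  then have "finite (M \<union> M') \<and> (\<forall>g. f g + h g = (\<Sum>m\<in>M \<union> M'.
      ((if m \<in> M then c m else 0) + (if m \<in> M' then c' m else 0)) * matrix_monomial m g))"
    using M(1,3) by (intro conjI finite_UnI allI)
  from exI[of "\<lambda>d. finite (M \<union> M') \<and> (\<forall>g. f g + h g = (\<Sum>m\<in>M \<union> M'. d m * matrix_monomial m g))", OF this]
  show ?case by (rule exI[of _ "M \<union> M'"])
next
  case (mult f h)
  then obtain M c M' c' where M: "finite M" "\<And>g. f g = (\<Sum>m\<in>M. c m * matrix_monomial m g)"
    "finite M'" "\<And>g. h g = (\<Sum>m\<in>M'. c' m * matrix_monomial m g)"
    by (elim exE conjE) (simp only:)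
  let ?plus = "\<lambda>p. fst p + snd p"
  let ?d = "\<lambda>k. \<Sum>p\<in>{p \<in> M \<times> M'. ?plus p = k}. c (fst p) * c' (snd p)"
  have "f g * h g = (\<Sum>k\<in>?plus ` (M \<times> M'). ?d k * matrix_monomial k g)" for g
  proof -
    have "f g * h g = (\<Sum>p\<in>M \<times> M'. c (fst p) * c' (snd p) * matrix_monomial (?plus p) g)"
      unfolding M(2,4) sum_product sum.cartesian_product
      by (simp add: case_prod_unfold matrix_monomial_add algebra_simps)
    also have "\<dots> = (\<Sum>k\<in>?plus ` (M \<times> M'). \<Sum>p\<in>{p \<in> M \<times> M'. ?plus p = k}.
        c (fst p) * c' (snd p) * matrix_monomial (?plus p) g)"
      using M by (intro sum.group[symmetric]) auto
    also have "\<dots> = (\<Sum>k\<in>?plus ` (M \<times> M'). ?d k * matrix_monomial k g)"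
      by (intro sum.cong refl) (simp add: sum_distrib_right)
    finally show ?thesis .
  qed
  then have "finite (?plus ` (M \<times> M')) \<and>
      (\<forall>g. f g * h g = (\<Sum>k\<in>?plus ` (M \<times> M'). ?d k * matrix_monomial k g))"
    using M(1,3) by (intro conjI finite_imageI finite_cartesian_product allI)
  from exI[of "\<lambda>d. finite (?plus ` (M \<times> M')) \<and>
      (\<forall>g. f g * h g = (\<Sum>k\<in>?plus ` (M \<times> M'). d k * matrix_monomial k g))", OF this]
  show ?case by (rule exI[of _ "?plus ` (M \<times> M')"])
qed

section \<open>The Zariski closure of a group of integer matrices\<close>

definition of_int_matrix :: "int^'n^'n \<Rightarrow> 'k::comm_ring_1^'n::finite^'n" where
  "of_int_matrix M = (\<chi> i j. of_int (M $ i $ j))"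

lemma of_int_matrix_mult: "of_int_matrix (A ** B) = of_int_matrix A ** of_int_matrix B"
  by (simp add: of_int_matrix_def matrix_matrix_mult_def vec_eq_iff)

lemma of_int_matrix_one: "of_int_matrix (mat 1) = mat 1"
  by (simp add: of_int_matrix_def mat_def vec_eq_iff)

lemma det_of_int_matrix: "det (of_int_matrix M) = of_int (det M)"
  by (simp add: of_int_matrix_def det_def)

lemma poly_value_of_int_matrix: "poly_value p (of_int_matrix M) = of_int (poly_value p M)"
  by (simp add: poly_value_def of_int_matrix_def case_prod_unfold)

text \<open>The ring is a type variable, as closures of the same integer matrices are taken over the
  complex numbers and over the reals.\<close>

definition zariski_closure :: "(int^'n^'n) set \<Rightarrow> ('k::comm_ring_1^'n::finite^'n) set" where
  "zariski_closure Z =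
    {g. \<forall>f\<in>poly_funs. (\<forall>M\<in>Z. f (of_int_matrix M) = 0) \<longrightarrow> f g = 0}"

lemma zariski_closureD:
  assumes "g \<in> zariski_closure Z" "f \<in> poly_funs" "\<And>M. M \<in> Z \<Longrightarrow> f (of_int_matrix M) = 0"
  shows "f g = 0"
proof -
  have "\<forall>f\<in>poly_funs. (\<forall>M\<in>Z. f (of_int_matrix M) = 0) \<longrightarrow> f g = 0"
    using assms(1) unfolding zariski_closure_def by (rule CollectD)
  from mp[OF bspec[OF this assms(2)] ballI[OF assms(3)]] show ?thesis .
qed

lemma zariski_closureI:
  "(\<And>f. f \<in> poly_funs \<Longrightarrow> (\<And>M. M \<in> Z \<Longrightarrow> f (of_int_matrix M) = 0) \<Longrightarrow> f g = 0) \<Longrightarrow> g \<in> zariski_closure Z"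
  unfolding zariski_closure_def by (intro CollectI ballI impI) blast

lemma zariski_closure_superset: "M \<in> Z \<Longrightarrow> of_int_matrix M \<in> zariski_closure Z"
  by (rule zariski_closureI) simp

lemma matrix_mult_poly_funs:
  "(\<lambda>x. (x ** B) $ i $ j) \<in> poly_funs" "(\<lambda>x. (B ** x) $ i $ j) \<in> poly_funs"
proof -
  have "(\<lambda>x. \<Sum>k\<in>UNIV. x $ i $ k * B $ k $ j) \<in> poly_funs"
    by (rule poly_funs_sum, rule poly_funs.mult[OF poly_funs.entry poly_funs.const])
  then show "(\<lambda>x. (x ** B) $ i $ j) \<in> poly_funs" by (simp add: matrix_matrix_mult_def)
  have "(\<lambda>x. \<Sum>k\<in>UNIV. B $ i $ k * x $ k $ j) \<in> poly_funs"
    by (rule poly_funs_sum, rule poly_funs.mult[OF poly_funs.const poly_funs.entry])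
  then show "(\<lambda>x. (B ** x) $ i $ j) \<in> poly_funs" by (simp add: matrix_matrix_mult_def)
qed

text \<open>The usual two steps: for \<open>N\<close> in \<open>Z\<close> the right translate of
  \<open>f\<close> by \<open>N\<close> vanishes on \<open>Z\<close>, hence at \<open>g\<close>; so
  the left translate of \<open>f\<close> by \<open>g\<close> vanishes on \<open>Z\<close>, hence at
  \<open>h\<close>.\<close>

lemma zariski_closure_mult:
  assumes Z: "\<And>A B. A \<in> Z \<Longrightarrow> B \<in> Z \<Longrightarrow> A ** B \<in> Z"
    and g: "g \<in> zariski_closure Z" and h: "h \<in> zariski_closure Z"
  shows "g ** h \<in> zariski_closure Z"
proof (rule zariski_closureI)
  fix f :: "'b^'a^'a \<Rightarrow> 'b" assume f: "f \<in> poly_funs" and 0: "\<And>M. M \<in> Z \<Longrightarrow> f (of_int_matrix M) = 0"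
  have "f (g ** of_int_matrix N) = 0" if N: "N \<in> Z" for N
  proof -
    have "(\<lambda>x. f (x ** of_int_matrix N)) \<in> poly_funs"
      by (rule poly_funs_comp[OF f matrix_mult_poly_funs(1)])
    then show ?thesis
    proof (rule zariski_closureD[OF g])
      show "f (of_int_matrix M ** of_int_matrix N) = 0" if "M \<in> Z" for M
        using 0[OF Z[OF that N]] by (simp add: of_int_matrix_mult)
    qed
  qed
  with poly_funs_comp[OF f matrix_mult_poly_funs(2)] show "f (g ** h) = 0"
    by (rule zariski_closureD[OF h])
qed

lemma zariski_closure_det:
  assumes "\<And>M. M \<in> Z \<Longrightarrow> det M = 1" "g \<in> zariski_closure Z" shows "det g = 1"
proof -
  have "(\<lambda>g. det g + (- 1)) \<in> poly_funs"
    by (rule poly_funs.add[OF det_poly_funs[OF poly_funs.entry] poly_funs.const])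
  then have "det g + (- 1) = 0"
    by (rule zariski_closureD[OF assms(2)]) (simp add: det_of_int_matrix assms(1))
  then show ?thesis by simp
qed

text \<open>Cramer's rule for the columns of the inverse. The entries are polynomials in those of
  \<open>A\<close>, so the inverse of a matrix of determinant 1 is accessible to closure arguments
  and to codes.\<close>

definition adjugate :: "'k::comm_ring_1^'n::finite^'n \<Rightarrow> 'k^'n^'n" where
  "adjugate A = (\<chi> k j. det (\<chi> i l. if l = k then axis j 1 $ i else A $ i $ l))"

lemma adjugate_inverse:
  fixes A :: "'k::field^'n^'n"
  assumes "det A = 1"
  shows "A ** adjugate A = mat 1" "adjugate A ** A = mat 1"
proof -
  have "A *v (\<chi> k. adjugate A $ k $ j) = axis j 1" for j
    using assms by (subst cramer) (auto simp: adjugate_def)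
  then have "(\<Sum>k\<in>UNIV. A $ i $ k * adjugate A $ k $ j) = axis j 1 $ i" for i j
    by (metis (no_types, lifting) matrix_vector_mult_def vec_lambda_beta sum.cong)
  then show "A ** adjugate A = mat 1"
    by (simp add: matrix_matrix_mult_def mat_def vec_eq_iff axis_def)
  then show "adjugate A ** A = mat 1" by (simp add: matrix_left_right_inverse)
qed

lemma adjugate_poly_funs: "(\<lambda>g. adjugate g $ k $ j) \<in> poly_funs"
  unfolding adjugate_def vec_lambda_beta
proof (rule det_poly_funs)
  fix i l
  show "(\<lambda>g. (\<chi> i l. if l = k then axis j 1 $ i else g $ i $ l) $ i $ l) \<in> poly_funs"
    by (cases "l = k") (simp_all add: poly_funs.const poly_funs.entry)
qed

text \<open>On \<open>Z\<close> the adjugate is the inverse and stays in \<open>Z\<close>, so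
  composition with it preserves the polynomial functions that vanish on \<open>Z\<close>.\<close>

lemma zariski_closure_adjugate:
  fixes g :: "'k::field^'n^'n"
  assumes Z: "\<And>M. M \<in> Z \<Longrightarrow> det M = 1" "\<And>M. M \<in> Z \<Longrightarrow> \<exists>N\<in>Z. M ** N = mat 1"
    and g: "g \<in> zariski_closure Z"
  shows "adjugate g \<in> zariski_closure Z"
proof (rule zariski_closureI)
  fix f :: "'k^'n^'n \<Rightarrow> 'k" assume f: "f \<in> poly_funs" and 0: "\<And>M. M \<in> Z \<Longrightarrow> f (of_int_matrix M) = 0"
  have "f (adjugate (of_int_matrix M)) = 0" if M: "M \<in> Z" for M
  proof -
    obtain N where N: "N \<in> Z" "M ** N = mat 1" using Z(2)[OF M] by blast
    let ?M = "of_int_matrix M :: 'k^'n^'n" and ?N = "of_int_matrix N :: 'k^'n^'n"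
    have "det ?M = 1" using Z(1)[OF M] by (simp add: det_of_int_matrix)
    note adj = adjugate_inverse[OF this]
    have "adjugate ?M = adjugate ?M ** (?M ** ?N)"
      using N(2) by (simp flip: of_int_matrix_mult add: of_int_matrix_one)
    also have "\<dots> = ?N" using adj(2) by (simp add: matrix_mul_assoc)
    finally show ?thesis using 0[OF N(1)] by simp
  qed
  with poly_funs_comp[OF f adjugate_poly_funs] show "f (adjugate g) = 0"
    by (rule zariski_closureD[OF g])
qed

section \<open>From integral to real equations of a set of integer matrices\<close>

lemma rat_common_denominator:
  fixes q :: "'a \<Rightarrow> rat"
  assumes "finite A" shows "\<exists>N z. N \<noteq> (0 :: int) \<and> (\<forall>a\<in>A. of_int (z a) = of_int N * q a)"
  using assms
proof induction
  case empty
  show ?case by (intro exI[of _ 1]) auto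
next
  case (insert a A)
  then obtain N z where N: "N \<noteq> 0" "\<forall>a\<in>A. of_int (z a) = of_int N * q a" by blast
  obtain u v where uv: "quotient_of (q a) = (u, v)" by fastforce
  then have v: "v \<noteq> 0" "q a = of_int u / of_int v"
    using quotient_of_denom_pos[OF uv] quotient_of_div[OF uv] by auto
  show ?case
    by (intro exI[of _ "N * v"] exI[of _ "\<lambda>b. if b = a then N * u else v * z b"])
      (use N v in auto)
qed

text \<open>The real coefficients of a polynomial are expanded in a basis of the reals over the
  rationals.\<close>

lemma integer_equations_suffice:
  fixes g :: "real^'n^'n" and Z :: "(int^'n^'n) set"
  assumes g: "\<And>p. (\<forall>M\<in>Z. poly_value p M = 0) \<Longrightarrow> poly_value p g = 0"
  shows "g \<in> zariski_closure Z"
proof (rule zariski_closureI)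
  fix f :: "real^'n^'n \<Rightarrow> real" assume f: "f \<in> poly_funs" and 0: "\<And>M. M \<in> Z \<Longrightarrow> f (of_int_matrix M) = 0"
  obtain A c where A: "finite A" "\<And>g. f g = (\<Sum>m\<in>A. c m * matrix_monomial m g)"
    using poly_funs_expand[OF f] by (elim exE conjE) (simp only:)
  interpret rat: vector_space "\<lambda>(q :: rat) (x :: real). of_rat q * x"
    by unfold_locales (simp_all add: algebra_simps of_rat_add of_rat_mult)
  define B where "B = rat.extend_basis {}"
  have indep: "rat.independent B" and span: "x \<in> rat.span B" for x
    unfolding B_def using rat.independent_extend_basis[OF rat.independent_empty]
      rat.span_extend_basis[OF rat.independent_empty] by auto
  let ?r = "rat.representation B"
  define Bf where "Bf = (\<Union>m\<in>A. {b. ?r (c m) b \<noteq> 0})"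
  have finBf: "finite Bf" unfolding Bf_def using A(1) rat.finite_representation by auto
  have expand: "c m = (\<Sum>b\<in>Bf. of_rat (?r (c m) b) * b)" if "m \<in> A" for m
  proof -
    have "c m = (\<Sum>b | ?r (c m) b \<noteq> 0. of_rat (?r (c m) b) * b)"
      using rat.sum_nonzero_representation_eq[OF indep span] by simp
    also have "\<dots> = (\<Sum>b\<in>Bf. of_rat (?r (c m) b) * b)"
      using that finBf by (intro sum.mono_neutral_left) (auto simp: Bf_def)
    finally show ?thesis .
  qed
  have scale: "?r (of_rat q * x) b = q * ?r x b" for q x b
    using fun_cong[OF rat.representation_scale[OF indep span]] .
  \<comment> \<open>For each basis element \<open>b\<close> the \<open>b\<close>-coordinates of the
    coefficients form a rational polynomial; cleared of denominators it is integral and vanishes on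
    \<open>Z\<close>, hence at \<open>g\<close>.\<close>
  have coord: "(\<Sum>m\<in>A. of_rat (?r (c m) b) * matrix_monomial m g) = 0" for b
  proof -
    obtain N z where N: "N \<noteq> (0 :: int)" "\<And>m. m \<in> A \<Longrightarrow> of_int (z m) = of_int N * ?r (c m) b"
      using rat_common_denominator[OF A(1), of "\<lambda>m. ?r (c m) b"] by blast
    define p where "p = (\<Sum>m\<in>A. Poly_Mapping.single m (z m))"
    have lookup_p: "Poly_Mapping.lookup p m = (if m \<in> A then z m else 0)" for m
      using A(1) by (simp add: p_def lookup_sum lookup_single when_def)
    have value_p: "poly_value p h = (\<Sum>m\<in>A. of_int (z m) * matrix_monomial m h)"
      for h :: "'k::comm_ring_1^'n^'n"
      unfolding poly_value_monomial
      by (rule sum.mono_neutral_cong_left) (auto simp: A(1) in_keys_iff lookup_p split: if_splits)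
    have "poly_value p M = 0" if M: "M \<in> Z" for M
    proof -
      have mono: "matrix_monomial m (of_int_matrix M) = (of_int (matrix_monomial m M) :: 'x :: comm_ring_1)" for m
        by (simp add: matrix_monomial_def of_int_matrix_def case_prod_unfold)
      \<comment> \<open>At an integer matrix the monomials are integers, so taking the coordinate,
        which is linear over the rationals, commutes with evaluation.\<close>
      have "0 = ?r (f (of_int_matrix M)) b" using 0 M rat.representation_zero by simp
      also have "f (of_int_matrix M) = (\<Sum>m\<in>A. of_rat (of_int (matrix_monomial m M)) * c m)"
        unfolding A(2) by (simp add: mono mult.commute)
      also have "?r \<dots> b = (\<Sum>m\<in>A. of_int (matrix_monomial m M) * ?r (c m) b)"
        unfolding rat.representation_sum[OF indep span] scale by (rule refl)
      finally have "0 = of_int N * (\<Sum>m\<in>A. of_int (matrix_monomial m M) * ?r (c m) b)" by simp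
      also have "\<dots> = (\<Sum>m\<in>A. of_int (matrix_monomial m M) * of_int (z m))"
        unfolding sum_distrib_left by (intro sum.cong refl) (simp add: N(2))
      also have "\<dots> = of_int (poly_value p M)"
        unfolding value_p by (simp add: mult.commute)
      finally show ?thesis by simp
    qed
    then have "poly_value p g = 0" using g by blast
    then have "0 = (\<Sum>m\<in>A. of_int (z m) * matrix_monomial m g)" unfolding value_p by simp
    also have "\<dots> = (\<Sum>m\<in>A. of_int N * (of_rat (?r (c m) b) * matrix_monomial m g))"
    proof (intro sum.cong refl)
      fix m assume "m \<in> A"
      have "real_of_int (z m) = of_rat (of_int (z m))" by simp
      also have "\<dots> = of_int N * of_rat (?r (c m) b)"
        unfolding N(2)[OF \<open>m \<in> A\<close>] by (simp add: of_rat_mult)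
      finally show "of_int (z m) * matrix_monomial m g = of_int N * (of_rat (?r (c m) b) * matrix_monomial m g)"
        by simp
    qed
    finally show ?thesis using N(1) by (simp flip: sum_distrib_left)
  qed
  have "f g = (\<Sum>m\<in>A. \<Sum>b\<in>Bf. b * (of_rat (?r (c m) b) * matrix_monomial m g))"
    unfolding A(2)
  proof (intro sum.cong refl)
    fix m assume "m \<in> A"
    show "c m * matrix_monomial m g = (\<Sum>b\<in>Bf. b * (of_rat (?r (c m) b) * matrix_monomial m g))"
      by (subst expand[OF \<open>m \<in> A\<close>]) (simp add: sum_distrib_left sum_distrib_right mult_ac)
  qed
  also have "\<dots> = (\<Sum>b\<in>Bf. b * (\<Sum>m\<in>A. of_rat (?r (c m) b) * matrix_monomial m g))"
    by (subst sum.swap) (simp add: sum_distrib_left)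
  finally show "f g = 0" by (simp add: coord)
qed

section \<open>Chevalley groups over the reals\<close>

text \<open>The exponential of \<open>t\<close> times a nilpotent matrix whose \<open>k\<close>-th
  divided power is \<open>N k\<close>. Integrality of the \<open>N k\<close> gives the formula a
  meaning over every commutative ring.\<close>

definition unipotent :: "nat \<Rightarrow> (nat \<Rightarrow> int^'n^'n) \<Rightarrow> 'k \<Rightarrow> 'k::comm_ring_1^'n::finite^'n" where
  "unipotent K N t = (\<chi> i j. \<Sum>k<K. t ^ k * of_int (N k $ i $ j))"

lemma of_int_unipotent: "of_int_matrix (unipotent K N s) = unipotent K N (of_int s)"
  by (simp add: of_int_matrix_def unipotent_def vec_eq_iff)

text \<open>Terms with \<open>j + k\<close> at least \<open>K\<close> vanish, so the square of
  indices can be cut to a triangle, where the rule for products of divided powers produces the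
  binomial expansion of \<open>(s + t) ^ n\<close>.\<close>

lemma unipotent_add:
  fixes s t :: "'k::comm_ring_1"
  assumes N: "\<And>j k. N j ** N k = (\<chi> i l. of_nat ((j + k) choose j) * N (j + k) $ i $ l)"
    and K: "\<And>k. k \<ge> K \<Longrightarrow> N k = 0"
  shows "unipotent K N s ** unipotent K N t = unipotent K N (s + t)"
proof -
  have "(unipotent K N s ** unipotent K N t) $ i $ l = unipotent K N (s + t) $ i $ l" for i l
  proof -
    let ?g = "\<lambda>j k. of_nat ((j + k) choose j) * s ^ j * t ^ k * of_int (N (j + k) $ i $ l)"
    have Ni: "(\<Sum>m\<in>UNIV. of_int (N j $ i $ m) * of_int (N k $ m $ l) :: 'k) =
        of_nat ((j + k) choose j) * of_int (N (j + k) $ i $ l)" for j k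
    proof -
      have "(N j ** N k) $ i $ l = of_nat ((j + k) choose j) * N (j + k) $ i $ l"
        by (simp add: N)
      then have "of_int (\<Sum>m\<in>UNIV. N j $ i $ m * N k $ m $ l) =
          (of_int (of_nat ((j + k) choose j) * N (j + k) $ i $ l) :: 'k)"
        by (simp add: matrix_matrix_mult_def)
      then show ?thesis by simp
    qed
    have "(unipotent K N s ** unipotent K N t) $ i $ l =
        (\<Sum>m\<in>UNIV. \<Sum>j<K. \<Sum>k<K. s ^ j * t ^ k * (of_int (N j $ i $ m) * of_int (N k $ m $ l)))"
      by (simp add: matrix_matrix_mult_def unipotent_def sum_product algebra_simps)
    also have "\<dots> = (\<Sum>j<K. \<Sum>m\<in>UNIV. \<Sum>k<K. s ^ j * t ^ k * (of_int (N j $ i $ m) * of_int (N k $ m $ l)))"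
      by (rule sum.swap)
    also have "\<dots> = (\<Sum>j<K. \<Sum>k<K. \<Sum>m\<in>UNIV. s ^ j * t ^ k * (of_int (N j $ i $ m) * of_int (N k $ m $ l)))"
      by (intro sum.cong refl sum.swap)
    also have "\<dots> = (\<Sum>j<K. \<Sum>k<K. s ^ j * t ^ k * (\<Sum>m\<in>UNIV. of_int (N j $ i $ m) * of_int (N k $ m $ l)))"
      by (simp only: sum_distrib_left)
    also have "\<dots> = (\<Sum>p\<in>{..<K} \<times> {..<K}. ?g (fst p) (snd p))"
      by (simp add: Ni sum.cartesian_product case_prod_unfold algebra_simps)
    also have "\<dots> = (\<Sum>p\<in>{(j, k). j + k < K}. ?g (fst p) (snd p))"
    proof (rule sum.mono_neutral_right)
      show "\<forall>p\<in>{..<K} \<times> {..<K} - {(j, k). j + k < K}. ?g (fst p) (snd p) = 0"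
      proof
        fix p assume "p \<in> {..<K} \<times> {..<K} - {(j, k). j + k < K}"
        then have "K \<le> fst p + snd p" by (cases p) auto
        then show "?g (fst p) (snd p) = 0" by (simp add: K)
      qed
    qed auto
    also have "\<dots> = (\<Sum>n<K. \<Sum>j\<le>n. ?g j (n - j))"
      using sum.triangle_reindex[of ?g K] by (simp add: case_prod_unfold)
    also have "\<dots> = (\<Sum>n<K. (s + t) ^ n * of_int (N n $ i $ l))"
    proof (intro sum.cong refl)
      fix n
      have "(\<Sum>j\<le>n. ?g j (n - j)) = (\<Sum>j\<le>n. of_nat (n choose j) * s ^ j * t ^ (n - j)) * of_int (N n $ i $ l)"
        unfolding sum_distrib_right by (intro sum.cong refl) simp
      then show "(\<Sum>j\<le>n. ?g j (n - j)) = (s + t) ^ n * of_int (N n $ i $ l)"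
        by (simp add: binomial_ring)
    qed
    finally show ?thesis by (simp add: unipotent_def)
  qed
  then show ?thesis by (simp add: vec_eq_iff)
qed

lemma unipotent_zero: "0 < K \<Longrightarrow> N 0 = mat 1 \<Longrightarrow> unipotent K N 0 = mat 1"
proof -
  assume K: "0 < K" and N: "N 0 = mat 1"
  have "(\<Sum>k<K. 0 ^ k * of_int (N k $ i $ j)) = (of_int (N 0 $ i $ j) :: 'b)" for i j
  proof -
    have "(\<Sum>k<K. 0 ^ k * of_int (N k $ i $ j)) = (\<Sum>k<K. if k = 0 then of_int (N k $ i $ j) else (0 :: 'b))"
      by (intro sum.cong refl) (simp add: power_0_left)
    then show ?thesis using K by simp
  qed
  then show ?thesis by (simp add: unipotent_def N vec_eq_iff mat_def)
qed

text \<open>Reduces questions on a one-parameter group to polynomials in one variable, namely its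
  determinant and the density of the integral parameters.\<close>

lemma poly_funs_unipotent:
  assumes "f \<in> poly_funs" shows "\<exists>p. \<forall>t. f (unipotent K N t) = poly p t"
  using assms
proof induction
  case (const c)
  show ?case by (intro exI[of _ "[:c:]"]) simp
next
  case (entry i j)
  show ?case
    by (intro exI[of _ "\<Sum>k<K. monom (of_int (N k $ i $ j)) k"])
      (simp add: unipotent_def poly_sum poly_monom mult.commute)
next
  case (add f h)
  from add.IH(1) obtain p where p: "\<forall>t. f (unipotent K N t) = poly p t" by (elim exE) (rule that)
  from add.IH(2) obtain q where q: "\<forall>t. h (unipotent K N t) = poly q t" by (elim exE) (rule that)
  show ?case by (rule exI[of _ "p + q"]) (simp add: p q)
next
  case (mult f h)
  from mult.IH(1) obtain p where p: "\<forall>t. f (unipotent K N t) = poly p t" by (elim exE) (rule that)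
  from mult.IH(2) obtain q where q: "\<forall>t. h (unipotent K N t) = poly q t" by (elim exE) (rule that)
  show ?case by (rule exI[of _ "p * q"]) (simp add: p q)
qed

text \<open>The determinant is a polynomial \<open>p\<close> in the parameter, and its product with
  the polynomial for the negated parameter is 1; comparing degrees shows that \<open>p\<close> is
  constant.\<close>

lemma det_unipotent:
  fixes t :: complex
  assumes "unipotent K N 0 = (mat 1 :: complex^'n^'n)"
    and "\<And>s t :: complex. unipotent K N s ** unipotent K N t = unipotent K N (s + t)"
  shows "det (unipotent K N t :: complex^'n^'n) = 1"
proof -
  have "(\<lambda>g :: complex^'n^'n. det g) \<in> poly_funs" by (intro det_poly_funs poly_funs.intros)
  from poly_funs_unipotent[OF this, of K N]
  obtain p where p: "\<And>t. det (unipotent K N t :: complex^'n^'n) = poly p t"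
    by (elim exE) (simp only:)
  let ?q = "pcompose p [:0, - 1:]"
  have "poly (p * ?q) = poly 1"
  proof
    fix t
    have "det (unipotent K N t ** unipotent K N (- t) :: complex^'n^'n) = 1"
      unfolding assms(2) by (simp add: assms(1))
    then show "poly (p * ?q) t = poly 1 t" by (simp add: poly_pcompose det_mul p)
  qed
  then have pq: "p * ?q = 1" by (simp only: poly_eq_poly_eq_iff)
  then have "p \<noteq> 0" "?q \<noteq> 0" by auto
  then have "degree p + degree ?q = 0" using pq degree_mult_eq[of p ?q] by simp
  then have "degree p = 0" by simp
  then obtain c where "p = [:c:]" by (rule degree_eq_zeroE)
  moreover have "poly p 0 = 1" using p[of 0] assms(1) by simp
  ultimately show ?thesis using p by simp
qed

section \<open>The group generated by the root elements with integral parameters\<close>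

inductive_set monoid_span :: "(int^'n::finite^'n) set \<Rightarrow> (int^'n^'n) set" for S where
  one: "mat 1 \<in> monoid_span S"
| mult: "A \<in> monoid_span S \<Longrightarrow> B \<in> S \<Longrightarrow> A ** B \<in> monoid_span S"

lemma monoid_span_mult:
  assumes "A \<in> monoid_span S" "B \<in> monoid_span S" shows "A ** B \<in> monoid_span S"
  using assms(2)
proof induction
  case (mult B C)
  from monoid_span.mult[OF mult.IH mult.hyps(2)] show ?case by (simp add: matrix_mul_assoc)
qed (simp add: assms(1))

lemma monoid_span_base: "B \<in> S \<Longrightarrow> B \<in> monoid_span S"
  using monoid_span.mult[OF monoid_span.one] by fastforce

locale integral_generators =
  fixes \<Phi> :: "'e set" and K :: "'e \<Rightarrow> nat" and N :: "'e \<Rightarrow> nat \<Rightarrow> int^'n::finite^'n"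
  assumes N_mult: "\<And>\<alpha> j k. \<alpha> \<in> \<Phi> \<Longrightarrow> N \<alpha> j ** N \<alpha> k = (\<chi> i l. of_nat ((j + k) choose j) * N \<alpha> (j + k) $ i $ l)"
    and N_zero: "\<And>\<alpha> k. \<alpha> \<in> \<Phi> \<Longrightarrow> k \<ge> K \<alpha> \<Longrightarrow> N \<alpha> k = 0"
    and N_one: "\<And>\<alpha>. \<alpha> \<in> \<Phi> \<Longrightarrow> N \<alpha> 0 = mat 1" and K_pos: "\<And>\<alpha>. \<alpha> \<in> \<Phi> \<Longrightarrow> 0 < K \<alpha>"
begin

abbreviation elem :: "'e \<Rightarrow> 'k::comm_ring_1 \<Rightarrow> 'k^'n^'n" where
  "elem \<alpha> \<equiv> unipotent (K \<alpha>) (N \<alpha>)"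

definition int_group :: "(int^'n^'n) set" where
  "int_group = monoid_span {elem \<alpha> s | \<alpha> s. \<alpha> \<in> \<Phi>}"

lemma elem_add: "\<alpha> \<in> \<Phi> \<Longrightarrow> elem \<alpha> s ** elem \<alpha> t = elem \<alpha> (s + t)"
  by (rule unipotent_add) (auto simp: N_mult N_zero)

lemma elem_zero: "\<alpha> \<in> \<Phi> \<Longrightarrow> elem \<alpha> 0 = mat 1"
  by (rule unipotent_zero) (auto simp: N_one K_pos)

lemma det_elem_complex: "\<alpha> \<in> \<Phi> \<Longrightarrow> det (elem \<alpha> (t :: complex)) = 1"
  by (rule det_unipotent) (auto simp: elem_zero elem_add)

lemma det_elem_int: "\<alpha> \<in> \<Phi> \<Longrightarrow> det (elem \<alpha> (s :: int)) = 1"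
proof -
  assume \<alpha>: "\<alpha> \<in> \<Phi>"
  have "of_int (det (elem \<alpha> s)) = det (of_int_matrix (elem \<alpha> s) :: complex^'n^'n)"
    by (simp add: det_of_int_matrix)
  also have "\<dots> = 1" by (simp only: of_int_unipotent det_elem_complex[OF \<alpha>])
  finally show ?thesis by simp
qed

lemma int_group_mult: "A \<in> int_group \<Longrightarrow> B \<in> int_group \<Longrightarrow> A ** B \<in> int_group"
  unfolding int_group_def by (rule monoid_span_mult)

lemma det_int_group: "A \<in> int_group \<Longrightarrow> det A = 1"
  unfolding int_group_def
  by (induction rule: monoid_span.induct) (auto simp: det_mul det_elem_int)

text \<open>The monoid is a group because \<open>elem \<alpha> (- s)\<close> is again a generator
  and inverts \<open>elem \<alpha> s\<close>.\<close>

lemma int_group_inverse: "A \<in> int_group \<Longrightarrow> \<exists>B\<in>int_group. A ** B = mat 1"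
  unfolding int_group_def
proof (induction rule: monoid_span.induct)
  case one
  show ?case by (rule bexI[of _ "mat 1"]) (auto intro: monoid_span.one)
next
  case (mult A B)
  from mult.IH obtain A' where A': "A' \<in> monoid_span {elem \<alpha> s | \<alpha> s. \<alpha> \<in> \<Phi>}" "A ** A' = mat 1"
    by (elim bexE) (rule that)
  from mult.hyps(2) obtain \<alpha> s where B: "\<alpha> \<in> \<Phi>" "B = elem \<alpha> s" by auto
  have "elem \<alpha> (- s) ** A' \<in> monoid_span {elem \<alpha> s | \<alpha> s. \<alpha> \<in> \<Phi>}"
    using B(1) by (intro monoid_span_mult monoid_span_base A'(1)) blast
  moreover have "(A ** B) ** (elem \<alpha> (- s) ** A') = A ** (B ** elem \<alpha> (- s)) ** A'"
    by (simp add: matrix_mul_assoc)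
  moreover have "B ** elem \<alpha> (- s) = mat 1" using B by (simp add: elem_add elem_zero)
  ultimately show ?case using A'(2) by (intro bexI[of _ "elem \<alpha> (- s) ** A'"]) simp_all
qed

text \<open>Along the parameter, a polynomial function that vanishes on \<open>int_group\<close> is
  a polynomial in one variable with all integers among its zeros, hence 0.\<close>

lemma elem_closure: "\<alpha> \<in> \<Phi> \<Longrightarrow> elem \<alpha> (t :: complex) \<in> zariski_closure int_group"
proof (rule zariski_closureI)
  fix f :: "complex^'n^'n \<Rightarrow> complex"
  assume \<alpha>: "\<alpha> \<in> \<Phi>" and f: "f \<in> poly_funs" "\<And>M. M \<in> int_group \<Longrightarrow> f (of_int_matrix M) = 0"
  from poly_funs_unipotent[OF f(1), of "K \<alpha>" "N \<alpha>"]
  obtain p where p: "\<And>t. f (elem \<alpha> t) = poly p t" by (elim exE) (simp only:)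
  have "poly p (of_int s) = 0" for s :: int
  proof -
    have "elem \<alpha> s \<in> int_group" unfolding int_group_def using \<alpha> by (intro monoid_span_base) blast
    then have "f (of_int_matrix (elem \<alpha> s)) = 0" by (rule f(2))
    then show ?thesis by (simp add: of_int_unipotent p)
  qed
  then have "range (of_int :: int \<Rightarrow> complex) \<subseteq> {x. poly p x = 0}" by auto
  moreover have "infinite (range (of_int :: int \<Rightarrow> complex))"
  proof
    assume "finite (range (of_int :: int \<Rightarrow> complex))"
    then have "finite (UNIV :: int set)" by (rule finite_imageD) (simp add: inj_on_def)
    then show False by simp
  qed
  ultimately have "infinite {x. poly p x = 0}" by (rule infinite_super)
  then have "p = 0" using poly_roots_finite[of p] by (rule contrapos_np)
  then show "f (elem \<alpha> t) = 0" by (simp add: p)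
qed

lemma elementary_closure:
  "generate (matrix_monoid {g. det g = 1}) {elem \<alpha> (t :: complex) | \<alpha> t. \<alpha> \<in> \<Phi>} \<subseteq> zariski_closure int_group"
proof
  let ?G = "matrix_monoid {g :: complex^'n^'n. det g = 1}"
  fix g assume "g \<in> generate ?G {elem \<alpha> (t :: complex) | \<alpha> t. \<alpha> \<in> \<Phi>}"
  then show "g \<in> zariski_closure int_group"
  proof induction
    case one
    have "mat 1 \<in> int_group" unfolding int_group_def by (rule monoid_span.one)
    from zariski_closure_superset[OF this] show ?case by (simp add: matrix_monoid_def of_int_matrix_one)
  next
    case (incl h)
    then show ?case using elem_closure by auto
  next
    case (inv h)
    then obtain \<alpha> t where h: "\<alpha> \<in> \<Phi>" "h = elem \<alpha> t" by auto
    have unit: "elem \<alpha> t ** elem \<alpha> (- t) = mat 1" "elem \<alpha> (- t) ** elem \<alpha> t = mat 1"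
      using h(1) by (simp_all add: elem_add elem_zero)
    have "inv\<^bsub>?G\<^esub> h = elem \<alpha> (- t)"
      unfolding m_inv_def
    proof (rule the_equality)
      fix y assume "y \<in> carrier ?G \<and> h \<otimes>\<^bsub>?G\<^esub> y = \<one>\<^bsub>?G\<^esub> \<and> y \<otimes>\<^bsub>?G\<^esub> h = \<one>\<^bsub>?G\<^esub>"
      then have "elem \<alpha> t ** y = mat 1" by (simp add: matrix_monoid_def h)
      then have "elem \<alpha> (- t) ** (elem \<alpha> t ** y) = elem \<alpha> (- t)" by simp
      then show "y = elem \<alpha> (- t)" by (simp add: matrix_mul_assoc unit)
    qed (use h unit in \<open>simp add: matrix_monoid_def det_elem_complex\<close>)
    then show ?case using elem_closure[OF h(1)] by simp
  next
    case (eng h1 h2)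
    then show ?case using zariski_closure_mult[OF int_group_mult] by (simp add: matrix_monoid_def)
  qed
qed

text \<open>Together with \<open>elementary_closure\<close> this shows that the complex group and
  \<open>int_group\<close> satisfy the same integral equations.\<close>

lemma int_group_elementary:
  "M \<in> int_group \<Longrightarrow> (of_int_matrix M :: complex^'n^'n) \<in>
    generate (matrix_monoid {g. det g = 1}) {elem \<alpha> t | \<alpha> t. \<alpha> \<in> \<Phi>}"
  unfolding int_group_def
proof (induction rule: monoid_span.induct)
  case one
  show ?case using generate.one[of "matrix_monoid {g :: complex^'n^'n. det g = 1}"]
    by (simp add: of_int_matrix_one matrix_monoid_def)
next
  case (mult A B)
  from mult.hyps(2) obtain \<alpha> s where B: "\<alpha> \<in> \<Phi>" "B = elem \<alpha> s" by auto
  have "(of_int_matrix B :: complex^'n^'n) \<in>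
      generate (matrix_monoid {g. det g = 1}) {elem \<alpha> t | \<alpha> t. \<alpha> \<in> \<Phi>}"
    using B by (intro generate.incl) (auto simp: of_int_unipotent)
  from generate.eng[OF mult.IH this] show ?case
    by (simp add: matrix_monoid_def of_int_matrix_mult)
qed

end

subsection \<open>Matrices of the divided powers\<close>

context
  fixes scaleV :: "complex \<Rightarrow> 'v::ab_group_add \<Rightarrow> 'v" and b :: "'n::finite \<Rightarrow> 'v"
  assumes vs: "vector_space scaleV" and inj_b: "inj b"
    and indep: "\<not> module.dependent scaleV (range b)" and span: "module.span scaleV (range b) = UNIV"
begin

interpretation V: vector_space scaleV by (rule vs)

abbreviation coord :: "'v \<Rightarrow> 'n \<Rightarrow> complex" where
  "coord v i \<equiv> V.representation (range b) v (b i)"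

lemma in_span: "v \<in> V.span (range b)"
  by (simp add: span)

lemma coord_expand: "(\<Sum>i\<in>UNIV. scaleV (coord v i) (b i)) = v"
proof -
  from V.sum_representation_eq[OF indep in_span, of "range b"]
  have "(\<Sum>u\<in>range b. scaleV (V.representation (range b) v u) u) = v" by simp
  then show ?thesis by (simp add: sum.reindex[OF inj_b])
qed

lemma coord_sum: "coord (\<Sum>j\<in>A. f j) i = (\<Sum>j\<in>A. coord (f j) i)"
  using fun_cong[OF V.representation_sum[OF indep in_span]] .

lemma coord_scale: "coord (scaleV c v) i = c * coord v i"
  using fun_cong[OF V.representation_scale[OF indep in_span]] .

lemma coord_basis: "coord (b j) i = (if i = j then 1 else 0)"
  unfolding V.representation_basis[OF indep rangeI] by (simp add: inj_eq[OF inj_b])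

lemma matrix_in_basis_comp:
  assumes f: "Vector_Spaces.linear scaleV scaleV f"
  shows "matrix_in_basis scaleV b (\<lambda>v. f (g v)) = matrix_in_basis scaleV b f ** matrix_in_basis scaleV b g"
proof -
  interpret f: Vector_Spaces.linear scaleV scaleV f by (rule f)
  have expand: "coord (f v) i = (\<Sum>k\<in>UNIV. coord (f (b k)) i * coord v k)" for v i
  proof -
    have "f v = f (\<Sum>k\<in>UNIV. scaleV (coord v k) (b k))" by (simp only: coord_expand)
    also have "\<dots> = (\<Sum>k\<in>UNIV. scaleV (coord v k) (f (b k)))" by (simp only: f.sum f.scale)
    finally show ?thesis by (simp only: coord_sum coord_scale mult.commute)
  qed
  have "coord (f (g (b j))) i = (\<Sum>k\<in>UNIV. coord (f (b k)) i * coord (g (b j)) k)" for i j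
    by (rule expand)
  then show ?thesis unfolding matrix_in_basis_def matrix_matrix_mult_def by simp
qed

lemma coord_integer_span:
  assumes "v \<in> integer_span scaleV b" shows "\<exists>k. coord v i = of_int k"
proof -
  obtain k where "v = (\<Sum>i\<in>UNIV. scaleV (of_int (k i)) (b i))"
    using assms by (auto simp: integer_span_def)
  then have "coord v i = of_int (k i)"
    by (simp add: coord_sum coord_scale coord_basis if_distrib cong: if_cong)
  then show ?thesis by blast
qed

lemma basis_in_integer_span: "b j \<in> integer_span scaleV b"
proof -
  have "b j = (\<Sum>i\<in>UNIV. scaleV (of_int (if i = j then 1 else 0)) (b i))"
    by (simp add: if_distrib[of of_int] if_distrib[of "\<lambda>c. scaleV c _"] cong: if_cong)
  then show ?thesis unfolding integer_span_def by (intro range_eqI[where x = "\<lambda>i. if i = j then 1 else 0"])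
qed

text \<open>Admissibility, applied to the basis vectors, makes each entry of the matrix of
  \<open>X ^^ m\<close> an integral multiple of \<open>fact m\<close>; these multipliers are the
  entries of \<open>N m\<close>.\<close>

lemma divided_powers:
  assumes X: "Vector_Spaces.linear scaleV scaleV X"
    and adm: "\<And>m v. v \<in> integer_span scaleV b \<Longrightarrow> scaleV (1 / fact m) ((X ^^ m) v) \<in> integer_span scaleV b"
  shows "\<exists>K N. (\<forall>j k. N j ** N k = (\<chi> i l. of_nat ((j + k) choose j) * N (j + k) $ i $ l)) \<and>
    (\<forall>k\<ge>K. N k = 0) \<and> N 0 = (mat 1 :: int^'n^'n) \<and> 0 < K \<and>
    (\<forall>t. exp_matrix scaleV b X t = unipotent K N t)"
proof -
  let ?M = "\<lambda>m. matrix_in_basis scaleV b (X ^^ m)"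
  have int: "\<exists>z. ?M m $ i $ j = fact m * of_int z" for m i j
  proof -
    obtain z where "coord (scaleV (1 / fact m) ((X ^^ m) (b j))) i = of_int z"
      using coord_integer_span[OF adm[OF basis_in_integer_span]] by blast
    then show ?thesis
      by (intro exI[of _ z]) (simp add: coord_scale matrix_in_basis_def field_simps)
  qed
  define N where "N m = (\<chi> i j. SOME z. ?M m $ i $ j = fact m * of_int z)" for m
  have M: "?M m $ i $ j = fact m * of_int (N m $ i $ j)" for m i j
    unfolding N_def vec_lambda_beta by (rule someI_ex[OF int])
  have lin: "Vector_Spaces.linear scaleV scaleV (X ^^ m)" for m
  proof (induction m)
    case (Suc m)
    show ?case unfolding funpow.simps by (rule Vector_Spaces.linear_compose[OF Suc X])
  qed (simp add: V.linear_id[unfolded id_def] id_def)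
  have M_add: "?M (j + k) = ?M j ** ?M k" for j k
    using matrix_in_basis_comp[OF lin[of j], of "X ^^ k"] by (simp add: funpow_add o_def)
  have M0: "?M 0 = mat 1"
    by (simp add: matrix_in_basis_def coord_basis mat_def vec_eq_iff)
  have N_mult: "N j ** N k = (\<chi> i l. of_nat ((j + k) choose j) * N (j + k) $ i $ l)" for j k
  proof -
    have "(N j ** N k) $ i $ l = of_nat ((j + k) choose j) * N (j + k) $ i $ l" for i l
    proof -
      have "fact j * fact k * complex_of_int ((N j ** N k) $ i $ l) = (?M j ** ?M k) $ i $ l"
        by (simp add: matrix_matrix_mult_def M sum_distrib_left algebra_simps)
      also have "\<dots> = fact (j + k) * of_int (N (j + k) $ i $ l)"
        using M[of "j + k" i l] by (simp add: M_add)
      also have "fact (j + k) = (fact j * fact k * of_nat ((j + k) choose j) :: complex)"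
      proof -
        have "fact j * fact k * ((j + k) choose j) = (fact (j + k) :: nat)"
          using binomial_fact_lemma[of j "j + k"] by simp
        then show ?thesis by (metis of_nat_fact of_nat_mult)
      qed
      finally have "complex_of_int ((N j ** N k) $ i $ l) =
          complex_of_int (of_nat ((j + k) choose j) * N (j + k) $ i $ l)" by simp
      then show ?thesis by (simp only: of_int_eq_iff)
    qed
    then show ?thesis by (simp add: vec_eq_iff)
  qed
  \<comment> \<open>The constant bounds every absolute row sum of the matrix of \<open>X\<close>, so
    the entries for \<open>X ^^ m\<close> have norm at most \<open>c ^ m\<close>. Once this is below
    \<open>fact m\<close>, an integral multiple of \<open>fact m\<close> must be 0.\<close>
  define c where "c = (\<Sum>i\<in>UNIV. \<Sum>j\<in>UNIV. norm (?M 1 $ i $ j))"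
  have row: "(\<Sum>k\<in>UNIV. norm (?M 1 $ i $ k)) \<le> c" for i
    unfolding c_def by (rule member_le_sum) (auto intro: sum_nonneg)
  have bound: "norm (?M m $ i $ j) \<le> c ^ m" for m i j
  proof (induction m arbitrary: i)
    case 0
    show ?case unfolding M0 by (simp add: mat_def)
  next
    case (Suc m)
    have "norm (?M (Suc m) $ i $ j) \<le> (\<Sum>k\<in>UNIV. norm (?M 1 $ i $ k) * norm (?M m $ k $ j))"
      using M_add[of 1 m] by (simp add: matrix_matrix_mult_def del: funpow.simps)
        (intro sum_norm_le, simp add: norm_mult)
    also have "\<dots> \<le> (\<Sum>k\<in>UNIV. norm (?M 1 $ i $ k) * c ^ m)"
      by (intro sum_mono mult_left_mono Suc) auto
    also have "\<dots> \<le> c * c ^ m"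
    proof -
      have "c \<ge> 0" unfolding c_def by (intro sum_nonneg) auto
      then show ?thesis unfolding sum_distrib_right[symmetric] by (intro mult_right_mono row) auto
    qed
    finally show ?case unfolding power_Suc .
  qed
  have "(\<lambda>m. inverse (fact m) * c ^ m) \<longlonglongrightarrow> 0" by (rule summable_LIMSEQ_zero[OF summable_exp])
  from order_tendstoD(2)[OF this, of 1] obtain K where K: "\<And>m. m \<ge> K \<Longrightarrow> inverse (fact m) * c ^ m < 1"
    by (auto simp: eventually_sequentially)
  have N_zero: "N m = 0" if "m \<ge> Suc K" for m
  proof -
    have "N m $ i $ j = 0" for i j
    proof -
      have "real_of_int \<bar>N m $ i $ j\<bar> * fact m = norm (?M m $ i $ j)"
        by (simp add: M norm_mult)
      also have "\<dots> \<le> c ^ m" by (rule bound)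
      also have "\<dots> < fact m" using K[of m] that by (simp add: field_simps)
      finally have "real_of_int \<bar>N m $ i $ j\<bar> < 1" by simp
      then show ?thesis by linarith
    qed
    then show ?thesis by (simp add: vec_eq_iff)
  qed
  have N0: "N 0 = mat 1"
  proof -
    have "N 0 $ i $ j = (if i = j then 1 else 0)" for i j
    proof -
      have "complex_of_int (N 0 $ i $ j) = (if i = j then 1 else 0)"
        using M[of 0 i j] unfolding M0 by (simp add: mat_def)
      then show ?thesis by (cases "i = j") simp_all
    qed
    then show ?thesis by (simp add: vec_eq_iff mat_def)
  qed
  \<comment> \<open>The cut-off is \<open>Suc K\<close> because it has to be positive:
    \<open>N 0\<close> is not zero.\<close>
  have "exp_matrix scaleV b X t = unipotent (Suc K) N t" for t
  proof -
    have "exp_matrix scaleV b X t = (\<Sum>k<Suc K. \<chi> i j. t ^ k / fact k * ?M k $ i $ j)"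
      unfolding exp_matrix_def
      by (rule suminf_finite) (auto simp: M N_zero vec_eq_iff)
    also have "\<dots> = unipotent (Suc K) N t"
      by (simp add: vec_eq_iff unipotent_def M del: sum.lessThan_Suc)
    finally show ?thesis .
  qed
  then show ?thesis using N_mult N_zero N0 by (intro exI[of _ "Suc K"] exI[of _ N]) auto
qed

end

text \<open>An integral polynomial vanishes on the complex group if and only if it vanishes on
  \<open>int_group\<close>. The real points are therefore cut out by the integral equations of
  \<open>int_group\<close>, and by \<open>integer_equations_suffice\<close> these define its real
  closure.\<close>

theorem chevalley_points_closure:
  fixes scaleV :: "complex \<Rightarrow> 'v::ab_group_add \<Rightarrow> 'v" and b :: "'n::finite \<Rightarrow> 'v"
  assumes vs: "vector_space scaleV" and X: "\<And>\<alpha>. \<alpha> \<in> \<Phi> \<Longrightarrow> Vector_Spaces.linear scaleV scaleV (X \<alpha>)"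
    and adm: "admissible_basis scaleV \<Phi> X b"
  shows "\<exists>Z. (\<forall>A\<in>Z. \<forall>B\<in>Z. A ** B \<in> Z) \<and> (\<forall>A\<in>Z. det A = 1) \<and> (\<forall>A\<in>Z. \<exists>B\<in>Z. A ** B = mat 1) \<and>
    mat 1 \<in> Z \<and> chevalley_points scaleV \<Phi> X b (UNIV :: real set) = zariski_closure Z"
proof -
  have "\<forall>\<alpha>\<in>\<Phi>. \<exists>K N. (\<forall>j k. N j ** N k = (\<chi> i l. of_nat ((j + k) choose j) * N (j + k) $ i $ l)) \<and>
    (\<forall>k\<ge>K. N k = 0) \<and> N 0 = (mat 1 :: int^'n^'n) \<and> 0 < K \<and>
    (\<forall>t. exp_matrix scaleV b (X \<alpha>) t = unipotent K N t)" (is "\<forall>\<alpha>\<in>\<Phi>. ?P \<alpha>")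
  proof
    fix \<alpha> assume \<alpha>: "\<alpha> \<in> \<Phi>"
    have b: "inj b" "\<not> module.dependent scaleV (range b)" "module.span scaleV (range b) = UNIV"
      "\<And>m v. v \<in> integer_span scaleV b \<Longrightarrow> scaleV (1 / fact m) ((X \<alpha> ^^ m) v) \<in> integer_span scaleV b"
      using adm \<alpha> by (simp_all add: admissible_basis_def)
    show "?P \<alpha>" by (rule divided_powers[OF vs b(1-3) X[OF \<alpha>] b(4)])
  qed
  from bchoice[OF this] obtain K where "\<forall>\<alpha>\<in>\<Phi>. \<exists>N.
    (\<forall>j k. N j ** N k = (\<chi> i l. of_nat ((j + k) choose j) * N (j + k) $ i $ l)) \<and>
    (\<forall>k\<ge>K \<alpha>. N k = 0) \<and> N 0 = (mat 1 :: int^'n^'n) \<and> 0 < K \<alpha> \<and>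
    (\<forall>t. exp_matrix scaleV b (X \<alpha>) t = unipotent (K \<alpha>) N t)" by (elim exE) (rule that)
  from bchoice[OF this] obtain N where "\<forall>\<alpha>\<in>\<Phi>.
    (\<forall>j k. N \<alpha> j ** N \<alpha> k = (\<chi> i l. of_nat ((j + k) choose j) * N \<alpha> (j + k) $ i $ l)) \<and>
    (\<forall>k\<ge>K \<alpha>. N \<alpha> k = 0) \<and> N \<alpha> 0 = (mat 1 :: int^'n^'n) \<and> 0 < K \<alpha> \<and>
    (\<forall>t. exp_matrix scaleV b (X \<alpha>) t = unipotent (K \<alpha>) (N \<alpha>) t)"
    by (elim exE) (rule that)
  note KN = bspec[OF this]
  interpret integral_generators \<Phi> K N
  proof
    fix \<alpha> j k assume \<alpha>: "\<alpha> \<in> \<Phi>"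
    show "N \<alpha> j ** N \<alpha> k = (\<chi> i l. of_nat ((j + k) choose j) * N \<alpha> (j + k) $ i $ l)"
      using KN[OF \<alpha>, THEN conjunct1, THEN spec, THEN spec] .
  next
    fix \<alpha> k assume \<alpha>: "\<alpha> \<in> \<Phi>" and k: "k \<ge> K \<alpha>"
    show "N \<alpha> k = 0" using KN[OF \<alpha>, THEN conjunct2, THEN conjunct1, THEN spec, THEN mp, OF k] .
  next
    fix \<alpha> assume \<alpha>: "\<alpha> \<in> \<Phi>"
    show "N \<alpha> 0 = mat 1" using KN[OF \<alpha>, THEN conjunct2, THEN conjunct2, THEN conjunct1] .
    show "0 < K \<alpha>" using KN[OF \<alpha>, THEN conjunct2, THEN conjunct2, THEN conjunct2, THEN conjunct1] .
  qed
  have E: "elementary_group scaleV \<Phi> X b =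
      generate (matrix_monoid {g. det g = 1}) {elem \<alpha> t | \<alpha> t. \<alpha> \<in> \<Phi>}"
  proof -
    have "{exp_matrix scaleV b (X \<alpha>) t | \<alpha> t. \<alpha> \<in> \<Phi>} =
      {elem \<alpha> t | \<alpha> t. \<alpha> \<in> \<Phi>}"
    proof (intro Collect_cong ex_cong1)
      fix g \<alpha> t
      have "exp_matrix scaleV b (X \<alpha>) t = elem \<alpha> t" if \<alpha>: "\<alpha> \<in> \<Phi>"
        using KN[OF \<alpha>, THEN conjunct2, THEN conjunct2, THEN conjunct2, THEN conjunct2, THEN spec] .
      then show "(g = exp_matrix scaleV b (X \<alpha>) t \<and> \<alpha> \<in> \<Phi>) = (g = elem \<alpha> t \<and> \<alpha> \<in> \<Phi>)"
        by (cases "\<alpha> \<in> \<Phi>") simp_all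
    qed
    then show ?thesis by (simp add: elementary_group_def)
  qed
  have vanish: "(\<forall>h\<in>elementary_group scaleV \<Phi> X b. poly_value p h = 0) \<longleftrightarrow>
      (\<forall>M\<in>int_group. poly_value p M = 0)" for p
  proof
    assume *: "\<forall>h\<in>elementary_group scaleV \<Phi> X b. poly_value p h = 0"
    show "\<forall>M\<in>int_group. poly_value p M = 0"
    proof
      fix M assume "M \<in> int_group"
      from bspec[OF *[unfolded E] int_group_elementary[OF this]]
      have "poly_value p (of_int_matrix M :: complex^'n^'n) = 0" .
      then show "poly_value p M = 0" by (simp add: poly_value_of_int_matrix)
    qed
  next
    assume *: "\<forall>M\<in>int_group. poly_value p M = 0"
    show "\<forall>h\<in>elementary_group scaleV \<Phi> X b. poly_value p h = 0"
      unfolding E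
    proof
      fix h :: "complex^'n^'n"
      assume "h \<in> generate (matrix_monoid {g. det g = 1}) {elem \<alpha> t | \<alpha> t. \<alpha> \<in> \<Phi>}"
      from subsetD[OF elementary_closure this] poly_value_poly_funs
      show "poly_value p h = 0"
        by (rule zariski_closureD) (simp add: poly_value_of_int_matrix bspec[OF *])
    qed
  qed
  have sub: "g \<in> zariski_closure int_group" if "g \<in> chevalley_points scaleV \<Phi> X b UNIV" for g :: "real^'n^'n"
  proof (rule integer_equations_suffice)
    fix p :: "'n entry_poly"
    assume "\<forall>M\<in>int_group. poly_value p M = 0"
    from that[unfolded chevalley_points_def vanish, THEN CollectD, THEN conjunct2, THEN conjunct2,
        THEN spec, THEN mp, OF this]
    show "poly_value p g = 0" .
  qed
  have sup: "g \<in> chevalley_points scaleV \<Phi> X b UNIV" if g: "g \<in> zariski_closure int_group"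
    for g :: "real^'n^'n"
  proof -
    have "poly_value p g = 0" if p: "\<forall>M\<in>int_group. poly_value p M = 0" for p
    proof -
      have "\<forall>M\<in>int_group. poly_value p (of_int_matrix M :: real^'n^'n) = 0"
        using p by (simp add: poly_value_of_int_matrix)
      then show ?thesis by (intro zariski_closureD[OF g poly_value_poly_funs]) auto
    qed
    then show ?thesis using zariski_closure_det[OF det_int_group g]
      unfolding chevalley_points_def vanish by (intro CollectI conjI allI impI UNIV_I)
  qed
  have "chevalley_points scaleV \<Phi> X b (UNIV :: real set) = zariski_closure int_group"
  proof
    show "chevalley_points scaleV \<Phi> X b (UNIV :: real set) \<subseteq> zariski_closure int_group"
    proof
      fix g :: "real^'n^'n" assume "g \<in> chevalley_points scaleV \<Phi> X b UNIV"
      then show "g \<in> zariski_closure int_group" by (rule sub)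
    qed
    show "zariski_closure int_group \<subseteq> chevalley_points scaleV \<Phi> X b (UNIV :: real set)"
    proof
      fix g :: "real^'n^'n" assume "g \<in> zariski_closure int_group"
      then show "g \<in> chevalley_points scaleV \<Phi> X b UNIV" by (rule sup)
    qed
  qed
  moreover have "mat 1 \<in> int_group" unfolding int_group_def by (rule monoid_span.one)
  ultimately show ?thesis
    by (intro exI[of _ int_group] conjI ballI int_group_mult det_int_group int_group_inverse)
qed

section \<open>Interpreting the group in the ordered field of reals\<close>

text \<open>Determinants, adjugates and values of integral polynomials are built by these
  operations. The predicate is instantiated twice: to real numbers with computable codes, and to
  functions given by computable real terms.\<close>

definition closed_functions :: "(('a \<Rightarrow> real) \<Rightarrow> bool) \<Rightarrow> bool" where
  "closed_functions P \<longleftrightarrow> (\<forall>k :: int. P (\<lambda>x. of_int k)) \<and>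
    (\<forall>f g. P f \<longrightarrow> P g \<longrightarrow> P (\<lambda>x. f x + g x)) \<and> (\<forall>f g. P f \<longrightarrow> P g \<longrightarrow> P (\<lambda>x. f x * g x))"

lemma closed_functionsD:
  assumes "closed_functions P"
  shows "P (\<lambda>x. of_int k)" "P f \<Longrightarrow> P g \<Longrightarrow> P (\<lambda>x. f x + g x)" "P f \<Longrightarrow> P g \<Longrightarrow> P (\<lambda>x. f x * g x)"
proof -
  note closed = assms[unfolded closed_functions_def]
  show "P (\<lambda>x. of_int k)" by (rule conjunct1[OF closed, THEN spec])
  show "P f \<Longrightarrow> P g \<Longrightarrow> P (\<lambda>x. f x + g x)"
    by (rule conjunct1[OF conjunct2[OF closed], THEN spec, THEN spec, THEN mp, THEN mp])
  show "P f \<Longrightarrow> P g \<Longrightarrow> P (\<lambda>x. f x * g x)"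
    by (rule conjunct2[OF conjunct2[OF closed], THEN spec, THEN spec, THEN mp, THEN mp])
qed

lemma closed_functions_01:
  assumes "closed_functions P" shows "P (\<lambda>x. 0)" "P (\<lambda>x. 1)"
  using closed_functionsD(1)[OF assms, of 0] closed_functionsD(1)[OF assms, of 1]
  by (simp_all only: of_int_0 of_int_1)

lemma closed_functions_sum:
  assumes P: "closed_functions P" and f: "\<And>i. i \<in> A \<Longrightarrow> P (f i)"
  shows "P (\<lambda>x. \<Sum>i\<in>A. f i x)"
proof (cases "finite A")
  case True
  have "B \<subseteq> A \<longrightarrow> P (\<lambda>x. \<Sum>i\<in>B. f i x)" if "finite B" for B
    using that
  proof (induction B rule: finite_induct)
    case empty
    show ?case unfolding sum.empty by (rule impI) (rule closed_functions_01[OF P])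
  next
    case (insert i B)
    show ?case
    proof
      assume sub: "insert i B \<subseteq> A"
      then have "i \<in> A" "B \<subseteq> A" by simp_all
      from closed_functionsD(2)[OF P, OF f[OF this(1)] mp[OF insert.IH this(2)]]
      show "P (\<lambda>x. \<Sum>i\<in>insert i B. f i x)" unfolding sum.insert[OF insert.hyps] .
    qed
  qed
  from mp[OF this[OF True] order.refl] show ?thesis .
next
  case False
  show ?thesis unfolding sum.infinite[OF False] by (rule closed_functions_01[OF P])
qed
lemma closed_functions_prod:
  assumes P: "closed_functions P" and f: "\<And>i. i \<in> A \<Longrightarrow> P (f i)"
  shows "P (\<lambda>x. \<Prod>i\<in>A. f i x)"
proof (cases "finite A")
  case True
  have "B \<subseteq> A \<longrightarrow> P (\<lambda>x. \<Prod>i\<in>B. f i x)" if "finite B" for B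
    using that
  proof (induction B rule: finite_induct)
    case empty
    show ?case unfolding prod.empty by (rule impI) (rule closed_functions_01[OF P])
  next
    case (insert i B)
    show ?case
    proof
      assume sub: "insert i B \<subseteq> A"
      then have "i \<in> A" "B \<subseteq> A" by simp_all
      from closed_functionsD(3)[OF P, OF f[OF this(1)] mp[OF insert.IH this(2)]]
      show "P (\<lambda>x. \<Prod>i\<in>insert i B. f i x)" unfolding prod.insert[OF insert.hyps] .
    qed
  qed
  from mp[OF this[OF True] order.refl] show ?thesis .
next
  case False
  show ?thesis unfolding prod.infinite[OF False] by (rule closed_functions_01[OF P])
qed
lemma closed_functions_power:
  assumes P: "closed_functions P" and "P f" shows "P (\<lambda>x. f x ^ n)"
proof (induction n)
  case (Suc n)
  from closed_functionsD(3)[OF P, OF assms(2) Suc] show ?case by (simp only: power_Suc)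
qed (simp only: power_0 closed_functions_01[OF P])

lemma closed_functions_det:
  assumes P: "closed_functions P" and f: "\<And>i j. P (\<lambda>x. M x $ i $ j)"
  shows "P (\<lambda>x. det (M x))"
  unfolding det_def
  by (rule closed_functions_sum[OF P], rule closed_functionsD(3)[OF P],
      rule closed_functionsD(1)[OF P], rule closed_functions_prod[OF P], rule f)

lemma closed_functions_adjugate:
  assumes P: "closed_functions P" and f: "\<And>i j. P (\<lambda>x. M x $ i $ j)"
  shows "P (\<lambda>x. adjugate (M x) $ k $ j)"
  unfolding adjugate_def vec_lambda_beta
proof (rule closed_functions_det[OF P])
  fix i l
  have "P (\<lambda>x. if l = k then axis j 1 $ i else M x $ i $ l)"
  proof (cases "l = k")
    case True
    have "P (\<lambda>x. axis j 1 $ i)"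
      by (cases "i = j") (simp_all add: axis_def closed_functions_01[OF P])
    then show ?thesis using True by simp
  next
    case False
    then show ?thesis by (simp only: if_False f)
  qed
  then show "P (\<lambda>x. (\<chi> i l. if l = k then axis j 1 $ i else M x $ i $ l) $ i $ l)"
    by (simp only: vec_lambda_beta)
qed

lemma closed_functions_poly_value:
  assumes P: "closed_functions P" and f: "\<And>i j. P (\<lambda>x. M x $ i $ j)"
  shows "P (\<lambda>x. poly_value p (M x))"
  unfolding poly_value_def case_prod_unfold
  by (rule closed_functions_sum[OF P], rule closed_functionsD(3)[OF P],
      rule closed_functionsD(1)[OF P], rule closed_functions_prod[OF P],
      rule closed_functions_power[OF P], rule f)

text \<open>The list is fixed, so each of its members may come with its own algorithm. This admits
  index functions and equations that are merely known to exist.\<close>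

lemma computable_const_list:
  fixes f :: "'a::encodable \<Rightarrow> 'c \<Rightarrow> 'b::encodable"
  assumes "\<And>r. r \<in> set L \<Longrightarrow> computable (\<lambda>x. f x r)"
  shows "computable (\<lambda>x. map (f x) L)"
  using assms
proof (induction L)
  case (Cons r L)
  have "computable (\<lambda>x. f x r # map (f x) L)"
    by (rule computable_Cons) (simp_all add: Cons)
  then show ?case by simp
qed (simp add: computable_const)

lemma computable_prod_encode [computable_intros]:
  fixes f g :: "'a::encodable \<Rightarrow> nat"
  assumes "computable f" "computable g" shows "computable (\<lambda>x. prod_encode (f x, g x))"
  using computable_enc[OF computable_Pair[OF assms]] by (simp add: enc_prod_def)

section \<open>Free variables, and equation systems as existential sentences\<close>

lemma satisfies_cong:
  assumes "\<And>i. i \<in> free_vars p \<Longrightarrow> e i = e' i"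
  shows "satisfies H c e p = satisfies H c e' p"
  using assms
proof (induction p arbitrary: e e')
  case (Equal s t)
  have "term_value H c e u = term_value H c e' u" if "\<And>i. i \<in> term_vars u \<Longrightarrow> e i = e' i" for u
    using that by (induction u) simp_all
  from this[of s] this[of t] Equal show ?case by simp
next
  case (Neg p)
  from Neg.IH[of e e'] Neg.prems show ?case by simp
next
  case (Conj p q)
  from Conj.IH(1)[of e e'] Conj.IH(2)[of e e'] Conj.prems show ?case by simp
next
  case (Exists i p)
  have "satisfies H c (e(i := a)) p = satisfies H c (e'(i := a)) p" for a
    by (rule Exists.IH) (use Exists.prems in auto)
  then show ?case by simp
qed

primrec term_var_list :: "gterm \<Rightarrow> nat list" where
  "term_var_list (Var i) = [i]"
| "term_var_list (Const k) = []"
| "term_var_list One = []"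
| "term_var_list (Inverse t) = term_var_list t"
| "term_var_list (Times s t) = term_var_list s @ term_var_list t"

primrec free_var_list :: "gformula \<Rightarrow> nat list" where
  "free_var_list (Equal s t) = term_var_list s @ term_var_list t"
| "free_var_list (Neg p) = free_var_list p"
| "free_var_list (Conj p q) = free_var_list p @ free_var_list q"
| "free_var_list (Exists i p) = filter (\<lambda>j. j \<noteq> i) (free_var_list p)"

lemma set_term_var_list: "set (term_var_list t) = term_vars t"
  by (induction t) auto

lemma set_free_var_list: "set (free_var_list p) = free_vars p"
  by (induction p) (auto simp: set_term_var_list)

lemma computable_term_var_list: "computable term_var_list"
  by (rule computable_rec_gterm[OF _ _ _ _ term_var_list.simps(1,2,4,5)]) (intro computable_intros)+

lemma computable_free_var_list: "computable free_var_list"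
  by (rule computable_rec_gformula[OF _ _ _ _ free_var_list.simps])
    (intro computable_intros computable_comp[OF computable_term_var_list])+

text \<open>Reduces the Diophantine problem to the truth of sentences; \<open>Equal One One\<close>
  is the empty conjunction.\<close>

definition system_formula :: "equation_system \<Rightarrow> gformula" where
  "system_formula E = foldr Exists (concat (map (\<lambda>q. term_var_list (fst q) @ term_var_list (snd q)) E))
    (foldr (\<lambda>q p. Conj (Equal (fst q) (snd q)) p) E (Equal One One))"

lemma computable_system_formula: "computable system_formula"
  unfolding system_formula_def
  by (intro computable_intros computable_comp[OF computable_term_var_list])

lemma satisfies_foldr_Exists:
  "satisfies H c e (foldr Exists L p) \<longleftrightarrow>
    (\<exists>u. (\<forall>i\<in>set L. u i \<in> carrier H) \<and> satisfies H c (\<lambda>i. if i \<in> set L then u i else e i) p)"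
proof (induction L arbitrary: e)
  case (Cons i L)
  show ?case
  proof
    assume "satisfies H c e (foldr Exists (i # L) p)"
    then obtain a where a: "a \<in> carrier H" "satisfies H c (e(i := a)) (foldr Exists L p)" by auto
    from a(2)[unfolded Cons] obtain u where u: "(\<forall>j\<in>set L. u j \<in> carrier H) \<and>
      satisfies H c (\<lambda>j. if j \<in> set L then u j else (e(i := a)) j) p" by (elim exE) (rule that)
    have "(\<lambda>j. if j \<in> set L then u j else (e(i := a)) j) =
        (\<lambda>j. if j \<in> set (i # L) then if j \<in> set L then u j else a else e j)" by auto
    with a(1) u have "(\<forall>j\<in>set (i # L). (if j \<in> set L then u j else a) \<in> carrier H) \<and>
        satisfies H c (\<lambda>j. if j \<in> set (i # L) then if j \<in> set L then u j else a else e j) p" by simp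
    then show "\<exists>u. (\<forall>j\<in>set (i # L). u j \<in> carrier H) \<and>
        satisfies H c (\<lambda>j. if j \<in> set (i # L) then u j else e j) p"
      by (rule exI[of _ "\<lambda>j. if j \<in> set L then u j else a"])
  next
    assume "\<exists>u. (\<forall>j\<in>set (i # L). u j \<in> carrier H) \<and>
        satisfies H c (\<lambda>j. if j \<in> set (i # L) then u j else e j) p"
    then obtain u where u: "(\<forall>j\<in>set (i # L). u j \<in> carrier H) \<and>
        satisfies H c (\<lambda>j. if j \<in> set (i # L) then u j else e j) p" by (elim exE) (rule that)
    have "(\<lambda>j. if j \<in> set (i # L) then u j else e j) =
        (\<lambda>j. if j \<in> set L then u j else (e(i := u i)) j)" by auto
    with u have "(\<forall>j\<in>set L. u j \<in> carrier H) \<and>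
        satisfies H c (\<lambda>j. if j \<in> set L then u j else (e(i := u i)) j) p" by simp
    then have "satisfies H c (e(i := u i)) (foldr Exists L p)" unfolding Cons by (rule exI[of _ u])
    moreover have "u i \<in> carrier H" using u by simp
    ultimately show "satisfies H c e (foldr Exists (i # L) p)" by auto
  qed
qed simp

lemma satisfies_system_formula:
  assumes e: "range e \<subseteq> carrier H"
  shows "satisfies H c e (system_formula E) \<longleftrightarrow> solvable_system H c E"
proof -
  let ?p = "foldr (\<lambda>q p. Conj (Equal (fst q) (snd q)) p) E (Equal One One)"
  let ?L = "concat (map (\<lambda>q. term_var_list (fst q) @ term_var_list (snd q)) E)"
  have sat: "satisfies H c e' ?p \<longleftrightarrow> (\<forall>(s, t)\<in>set E. term_value H c e' s = term_value H c e' t)" for e'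
    by (induction E) auto
  have free: "free_vars ?p \<subseteq> set ?L" by (induction E) (auto simp: set_term_var_list)
  show ?thesis
  proof
    assume "satisfies H c e (system_formula E)"
    from this[unfolded system_formula_def satisfies_foldr_Exists]
    obtain u where u: "(\<forall>i\<in>set ?L. u i \<in> carrier H) \<and>
      satisfies H c (\<lambda>i. if i \<in> set ?L then u i else e i) ?p" by (elim exE) (rule that)
    let ?e = "\<lambda>i. if i \<in> set ?L then u i else e i"
    have "range ?e \<subseteq> carrier H"
    proof
      fix y assume "y \<in> range ?e"
      then obtain i where "y = ?e i" by (elim rangeE)
      moreover have "e i \<in> carrier H" using e by (rule subsetD) simp
      ultimately show "y \<in> carrier H" using bspec[OF conjunct1[OF u], of i] by presburger
    qed
    with conjunct2[OF u, unfolded sat] show "solvable_system H c E"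
      unfolding solvable_system_def by (intro exI[of _ ?e] conjI)
  next
    assume "solvable_system H c E"
    from this[unfolded solvable_system_def] obtain u where
      u': "range u \<subseteq> carrier H \<and> (\<forall>(s, t)\<in>set E. term_value H c u s = term_value H c u t)"
      by (elim exE) (rule that)
    then have u: "range u \<subseteq> carrier H" "satisfies H c u ?p" unfolding sat by simp_all
    have "satisfies H c (\<lambda>i. if i \<in> set ?L then u i else e i) ?p = satisfies H c u ?p"
    proof (rule satisfies_cong)
      fix i assume "i \<in> free_vars ?p"
      then have "i \<in> set ?L" using free by (rule subsetD[rotated])
      then show "(if i \<in> set ?L then u i else e i) = u i" by (rule if_P)
    qed
    moreover have "\<forall>i\<in>set ?L. u i \<in> carrier H"
      by (intro ballI subsetD[OF u(1)] rangeI)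
    ultimately show "satisfies H c e (system_formula E)"
      unfolding system_formula_def satisfies_foldr_Exists using u(2) by (intro exI[of _ u] conjI) simp_all
  qed
qed

text \<open>\<open>\<iota>\<close> numbers the rows and columns, \<open>R r c\<close> and
  \<open>S r c\<close> give codes of the entries of a constant and of its inverse, and the terms
  \<open>\<tau> i\<close> vanish exactly if the first block of the \<open>i\<close>-th group
  variable is a member of \<open>G\<close>.\<close>

locale coded_group = coded_reals +
  fixes n :: nat and \<iota> :: "nat \<Rightarrow> 'n::finite" and \<mu> :: "nat \<Rightarrow> real^'n^'n" and G :: "(real^'n^'n) set"
    and R S :: "nat \<Rightarrow> nat \<Rightarrow> nat \<Rightarrow> nat" and \<tau> :: "nat \<Rightarrow> rterm list"
    and add_ix mul_ix :: "nat \<Rightarrow> nat \<Rightarrow> nat"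
  assumes bij: "bij_betw \<iota> {..<n} UNIV"
    and G_mult: "\<And>g h. g \<in> G \<Longrightarrow> h \<in> G \<Longrightarrow> g ** h \<in> G" and G_one: "mat 1 \<in> G"
    and G_adjugate: "\<And>g. g \<in> G \<Longrightarrow> adjugate g \<in> G" and G_det: "\<And>g. g \<in> G \<Longrightarrow> det g = 1"
    and \<mu>_G: "\<And>k. \<mu> k \<in> G"
    and R: "\<And>r c. computable (R r c)" "\<And>r c k. \<nu> (R r c k) = \<mu> k $ \<iota> r $ \<iota> c"
    and S: "\<And>r c. computable (S r c)" "\<And>r c k. \<nu> (S r c k) = adjugate (\<mu> k) $ \<iota> r $ \<iota> c"
    and add_ix: "computable (\<lambda>p. add_ix (fst p) (snd p))" "\<And>i j. \<nu> (add_ix i j) = \<nu> i + \<nu> j"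
    and mul_ix: "computable (\<lambda>p. mul_ix (fst p) (snd p))" "\<And>i j. \<nu> (mul_ix i j) = \<nu> i * \<nu> j"
    and computable_eq_ix: "computable (\<lambda>p. \<nu> (fst p) = \<nu> (snd p))"
    and computable_less_ix: "computable (\<lambda>p. \<nu> (fst p) < \<nu> (snd p))"
    and \<tau>: "computable \<tau>" "\<And>w i. (\<forall>t\<in>set (\<tau> i). rvalue w t = 0) \<longleftrightarrow>
      (\<chi> j k. w (prod_encode (i, prod_encode (0, prod_encode
        (inv_into {..<n} \<iota> j, inv_into {..<n} \<iota> k))))) \<in> G"
begin

abbreviation "\<iota>' \<equiv> inv_into {..<n} \<iota>"

lemma \<iota>'_less: "\<iota>' j < n" and \<iota>_\<iota>': "\<iota> (\<iota>' j) = j" and \<iota>'_\<iota>: "r < n \<Longrightarrow> \<iota>' (\<iota> r) = r"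
proof -
  have j: "j \<in> \<iota> ` {..<n}" for j using bij by (simp add: bij_betw_def)
  show "\<iota>' j < n" using inv_into_into[OF j] by simp
  show "\<iota> (\<iota>' j) = j" by (rule f_inv_into_f[OF j])
  show "r < n \<Longrightarrow> \<iota>' (\<iota> r) = r" using bij by (simp add: bij_betw_def inv_into_f_f)
qed

lemma sum_\<iota>: "(\<Sum>k<n. f (\<iota> k)) = (\<Sum>j\<in>UNIV. f j)"
  by (rule sum.reindex_bij_betw[OF bij])

subsection \<open>Matrices of terms\<close>

definition ent :: "rterm list list \<Rightarrow> nat \<Rightarrow> nat \<Rightarrow> rterm" where
  "ent M r c = nth_or tzero (nth_or [] M r) c"

definition mk :: "(nat \<Rightarrow> nat \<Rightarrow> rterm) \<Rightarrow> rterm list list" where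
  "mk f = map (\<lambda>r. map (\<lambda>c. f r c) [0..<n]) [0..<n]"

definition to_matrix :: "(nat \<Rightarrow> real) \<Rightarrow> rterm list list \<Rightarrow> real^'n^'n" where
  "to_matrix w M = (\<chi> i j. rvalue w (ent M (\<iota>' i) (\<iota>' j)))"

lemma ent_mk: "r < n \<Longrightarrow> c < n \<Longrightarrow> ent (mk f) r c = f r c"
  by (simp add: ent_def mk_def nth_or_eq)

lemma to_matrix_mk: "to_matrix w (mk f) = (\<chi> i j. rvalue w (f (\<iota>' i) (\<iota>' j)))"
  by (simp add: to_matrix_def ent_mk \<iota>'_less)

lemma computable_ent [computable_intros]:
  "computable M \<Longrightarrow> computable r \<Longrightarrow> computable c \<Longrightarrow> computable (\<lambda>x. ent (M x) (r x) (c x))"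
  unfolding ent_def by (intro computable_intros)

definition lmul :: "rterm list list \<Rightarrow> rterm list list \<Rightarrow> rterm list list" where
  "lmul A B = mk (\<lambda>r c. foldr (\<lambda>k t. RAdd (RMul (ent A r k) (ent B k c)) t) [0..<n] tzero)"

lemma to_matrix_lmul: "to_matrix w (lmul A B) = to_matrix w A ** to_matrix w B"
proof -
  have "rvalue w (foldr (\<lambda>k t. RAdd (f k) t) L tzero) = (\<Sum>k\<leftarrow>L. rvalue w (f k))"
    for f and L :: "nat list"
    by (induction L) simp_all
  then have fold: "rvalue w (foldr (\<lambda>k t. RAdd (f k) t) [0..<n] tzero) = (\<Sum>k<n. rvalue w (f k))" for f
    by (simp add: interv_sum_list_conv_sum_set_nat atLeast0LessThan)
  have "(\<Sum>k<n. rvalue w (ent A r k) * rvalue w (ent B k c)) =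
      (\<Sum>j\<in>UNIV. rvalue w (ent A r (\<iota>' j)) * rvalue w (ent B (\<iota>' j) c))" for r c
    unfolding sum_\<iota>[symmetric] by (intro sum.cong refl) (simp add: \<iota>'_\<iota>)
  then show ?thesis
    unfolding lmul_def to_matrix_mk fold
    by (simp add: to_matrix_def matrix_matrix_mult_def)
qed

lemma computable_lmul [computable_intros]:
  assumes "computable A" "computable B" shows "computable (\<lambda>x. lmul (A x) (B x))"
proof -
  have "computable (\<lambda>p. lmul (fst p) (snd p))"
    unfolding lmul_def mk_def by (intro computable_intros)
  from computable_comp2[OF this assms] show ?thesis .
qed

text \<open>The real variable for the entry in row \<open>r\<close> and column \<open>c\<close> of
  the \<open>i\<close>-th group variable; \<open>fl\<close> is 0 for the matrix and 1 for its
  inverse.\<close>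

definition vcode :: "nat \<Rightarrow> nat \<Rightarrow> nat \<Rightarrow> nat \<Rightarrow> nat" where
  "vcode i fl r c = prod_encode (i, prod_encode (fl, prod_encode (r, c)))"

lemma vcode_cases: "\<exists>i fl r c. v = vcode i fl r c"
  unfolding vcode_def by (metis prod_decode_inverse surj_pair)

definition varm :: "nat \<Rightarrow> nat \<Rightarrow> rterm list list" where
  "varm fl i = mk (\<lambda>r c. RVar (vcode i fl r c))"

definition onem :: "rterm list list" where
  "onem = mk (\<lambda>r c. if r = c then RConst one_ix else tzero)"

lemma to_matrix_onem: "to_matrix w onem = mat 1"
proof -
  have "\<iota>' i = \<iota>' j \<longleftrightarrow> i = j" for i j by (metis \<iota>_\<iota>')
  then show ?thesis unfolding onem_def to_matrix_mk by (simp add: mat_def vec_eq_iff)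
qed

text \<open>The second component is the matrix of the inverse, which is why the factors of a product
  appear there in reverse order.\<close>

primrec term_matrices :: "gterm \<Rightarrow> rterm list list \<times> rterm list list" where
  "term_matrices (Var i) = (varm 0 i, varm 1 i)"
| "term_matrices (Const k) = (mk (\<lambda>r c. RConst (R r c k)), mk (\<lambda>r c. RConst (S r c k)))"
| "term_matrices One = (onem, onem)"
| "term_matrices (Inverse t) = (snd (term_matrices t), fst (term_matrices t))"
| "term_matrices (Times s t) = (lmul (fst (term_matrices s)) (fst (term_matrices t)),
     lmul (snd (term_matrices t)) (snd (term_matrices s)))"

lemma computable_varm [computable_intros]:
  "computable i \<Longrightarrow> computable (\<lambda>x. varm fl (i x))"
proof -
  assume i: "computable i"
  have "computable (\<lambda>i. varm fl i)"
    unfolding varm_def mk_def vcode_def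
    by (intro computable_const_list computable_intros)
  from computable_comp[OF this i] show ?thesis .
qed

lemma computable_term_matrices: "computable term_matrices"
proof (rule computable_rec_gterm[OF _ _ _ _ term_matrices.simps(1,2,4,5)])
  show "computable (\<lambda>k. (mk (\<lambda>r c. RConst (R r c k)), mk (\<lambda>r c. RConst (S r c k))))"
    unfolding mk_def
    by (intro computable_Pair computable_const_list computable_rterm_intros R S)
qed (intro computable_intros)+

text \<open>Numbers that belong to no block get the value 0, so that a group assignment determines
  the whole real assignment and a change at \<open>i\<close> affects only the blocks of
  \<open>i\<close>.\<close>

definition env_of :: "(nat \<Rightarrow> real^'n^'n) \<Rightarrow> nat \<Rightarrow> real" where
  "env_of e v = (let i = fst (prod_decode v); q = snd (prod_decode v); fl = fst (prod_decode q);
      r = fst (prod_decode (snd (prod_decode q))); c = snd (prod_decode (snd (prod_decode q)))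
    in if r < n \<and> c < n \<and> fl \<le> 1
      then (if fl = 0 then e i else adjugate (e i)) $ \<iota> r $ \<iota> c else 0)"

lemma env_of_vcode: "env_of e (vcode i fl r c) = (if r < n \<and> c < n \<and> fl \<le> 1
    then (if fl = 0 then e i else adjugate (e i)) $ \<iota> r $ \<iota> c else 0)"
  by (simp add: env_of_def vcode_def)

lemma to_matrix_varm_env:
  "to_matrix (env_of e) (varm 0 i) = e i" "to_matrix (env_of e) (varm 1 i) = adjugate (e i)"
  unfolding varm_def to_matrix_mk by (simp_all add: env_of_vcode \<iota>'_less \<iota>_\<iota>' vec_eq_iff)

lemma G_inverse: "g \<in> G \<Longrightarrow> g ** adjugate g = mat 1" "g \<in> G \<Longrightarrow> adjugate g ** g = mat 1"
  using adjugate_inverse[OF G_det] by blast+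

lemma adjugate_unique:
  assumes "g \<in> G" "g ** h = mat 1" shows "h = adjugate g"
proof -
  have "h = adjugate g ** g ** h" using G_inverse(2)[OF assms(1)] by simp
  also have "\<dots> = adjugate g ** (g ** h)" by (simp only: matrix_mul_assoc)
  finally show ?thesis using assms(2) by simp
qed

lemma inv_matrix_monoid: "g \<in> G \<Longrightarrow> inv\<^bsub>matrix_monoid G\<^esub> g = adjugate g"
  unfolding m_inv_def
proof (rule the_equality)
  assume g: "g \<in> G"
  show "adjugate g \<in> carrier (matrix_monoid G) \<and> g \<otimes>\<^bsub>matrix_monoid G\<^esub> adjugate g = \<one>\<^bsub>matrix_monoid G\<^esub> \<and>
      adjugate g \<otimes>\<^bsub>matrix_monoid G\<^esub> g = \<one>\<^bsub>matrix_monoid G\<^esub>"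
    using G_adjugate[OF g] G_inverse[OF g] by (simp add: matrix_monoid_def)
  fix y assume "y \<in> carrier (matrix_monoid G) \<and> g \<otimes>\<^bsub>matrix_monoid G\<^esub> y = \<one>\<^bsub>matrix_monoid G\<^esub> \<and>
      y \<otimes>\<^bsub>matrix_monoid G\<^esub> g = \<one>\<^bsub>matrix_monoid G\<^esub>"
  then show "y = adjugate g" by (intro adjugate_unique[OF g]) (simp add: matrix_monoid_def)
qed

lemma term_matrices_value:
  assumes e: "\<And>i. e i \<in> G"
  shows "term_value (matrix_monoid G) \<mu> e t \<in> G \<and>
    to_matrix (env_of e) (fst (term_matrices t)) = term_value (matrix_monoid G) \<mu> e t \<and>
    to_matrix (env_of e) (snd (term_matrices t)) = adjugate (term_value (matrix_monoid G) \<mu> e t)"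
proof (induction t)
  case (Var i)
  show ?case by (simp add: e to_matrix_varm_env del: One_nat_def)
next
  case (Const k)
  show ?case by (simp add: \<mu>_G to_matrix_mk R S \<iota>_\<iota>' vec_eq_iff)
next
  case One
  show ?case using adjugate_unique[OF G_one, of "mat 1"] G_one
    by (simp add: matrix_monoid_def to_matrix_onem)
next
  case (Inverse t)
  let ?g = "term_value (matrix_monoid G) \<mu> e t"
  have g: "?g \<in> G" using Inverse by blast
  have "?g = adjugate (adjugate ?g)" by (rule adjugate_unique[OF G_adjugate[OF g] G_inverse(2)[OF g]])
  then show ?case using Inverse by (simp add: inv_matrix_monoid[OF g] G_adjugate[OF g])
next
  case (Times s t)
  let ?g = "term_value (matrix_monoid G) \<mu> e s" and ?h = "term_value (matrix_monoid G) \<mu> e t"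
  have gh: "?g \<in> G" "?h \<in> G" using Times by blast+
  have "(?g ** ?h) ** (adjugate ?h ** adjugate ?g) = ?g ** (?h ** adjugate ?h) ** adjugate ?g"
    by (simp only: matrix_mul_assoc)
  also have "\<dots> = mat 1" by (simp add: G_inverse gh)
  finally have "adjugate ?h ** adjugate ?g = adjugate (?g ** ?h)"
    by (rule adjugate_unique[OF G_mult[OF gh]])
  then show ?case using Times G_mult[OF gh] by (simp add: to_matrix_lmul matrix_monoid_def)
qed

subsection \<open>Translation of formulas\<close>

definition q_all :: "rterm list \<Rightarrow> rterm list \<times> nat list list" where
  "q_all ts = foldr (\<lambda>t \<phi>. q_and (q_zero t) \<phi>) ts ([], [[]])"

lemma holds_q_all: "holds w (q_all ts) \<longleftrightarrow> (\<forall>t\<in>set ts. rvalue w t = 0)"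
  unfolding q_all_def by (induction ts) (simp_all add: holds_def[of w "([], [[]])"])

lemma computable_q_all [computable_intros]: "computable f \<Longrightarrow> computable (\<lambda>x. q_all (f x))"
  unfolding q_all_def by (intro computable_intros)

definition index_pairs :: "(nat \<times> nat) list" where
  "index_pairs = concat (map (\<lambda>r. map (\<lambda>c. (r, c)) [0..<n]) [0..<n])"

lemma set_index_pairs: "set index_pairs = {..<n} \<times> {..<n}"
  unfolding index_pairs_def by auto

definition q_eq :: "rterm list list \<Rightarrow> rterm list list \<Rightarrow> rterm list \<times> nat list list" where
  "q_eq A B = q_all (map (\<lambda>p. RAdd (ent A (fst p) (snd p)) (tminus (ent B (fst p) (snd p)))) index_pairs)"

lemma holds_q_eq: "holds w (q_eq A B) \<longleftrightarrow> to_matrix w A = to_matrix w B"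
proof -
  have "holds w (q_eq A B) \<longleftrightarrow> (\<forall>r<n. \<forall>c<n. rvalue w (ent A r c) = rvalue w (ent B r c))"
    by (auto simp: q_eq_def holds_q_all set_index_pairs)
  also have "\<dots> \<longleftrightarrow> (\<forall>i j. rvalue w (ent A (\<iota>' i) (\<iota>' j)) = rvalue w (ent B (\<iota>' i) (\<iota>' j)))"
    using \<iota>'_less \<iota>'_\<iota> by metis
  finally show ?thesis by (simp add: to_matrix_def vec_eq_iff)
qed

lemma computable_q_eq [computable_intros]:
  assumes "computable A" "computable B" shows "computable (\<lambda>x. q_eq (A x) (B x))"
proof -
  have "computable (\<lambda>p. q_eq (fst p) (snd p))" unfolding q_eq_def by (intro computable_intros)
  from computable_comp2[OF this assms] show ?thesis .
qed

text \<open>For \<open>g\<close> in \<open>G\<close> the equation \<open>g ** h = mat 1\<close>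
  forces \<open>h\<close> to be the adjugate, so one matrix equation fixes the second block.\<close>

definition q_member :: "nat \<Rightarrow> rterm list \<times> nat list list" where
  "q_member i = q_and (q_all (\<tau> i)) (q_eq (lmul (varm 0 i) (varm 1 i)) onem)"

lemma holds_q_member: "holds w (q_member i) \<longleftrightarrow>
    to_matrix w (varm 0 i) \<in> G \<and> to_matrix w (varm 1 i) = adjugate (to_matrix w (varm 0 i))"
proof -
  have "to_matrix w (varm 0 i) = (\<chi> j k. w (vcode i 0 (\<iota>' j) (\<iota>' k)))"
    unfolding varm_def to_matrix_mk by simp
  then have "holds w (q_member i) \<longleftrightarrow> to_matrix w (varm 0 i) \<in> G \<and>
      to_matrix w (varm 0 i) ** to_matrix w (varm 1 i) = mat 1"
    unfolding q_member_def holds_q_and holds_q_all \<tau>(2) holds_q_eq to_matrix_lmul to_matrix_onem vcode_def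
    by simp
  then show ?thesis using adjugate_unique G_inverse(1) by metis
qed

lemma computable_q_member: "computable q_member"
  unfolding q_member_def by (intro computable_intros \<tau>(1))

definition block_vars :: "nat \<Rightarrow> nat list" where
  "block_vars i = map (\<lambda>q. prod_encode (i, prod_encode (fst q, prod_encode (snd q))))
    (map (Pair 0) index_pairs @ map (Pair 1) index_pairs)"

lemma set_block_vars: "vcode i' fl r c \<in> set (block_vars i) \<longleftrightarrow> i' = i \<and> fl \<le> 1 \<and> r < n \<and> c < n"
  by (auto simp: block_vars_def set_index_pairs vcode_def prod_encode_eq image_iff le_Suc_eq)

lemma computable_block_vars: "computable block_vars"
  unfolding block_vars_def by (intro computable_const_list computable_intros)

primrec translate :: "gformula \<Rightarrow> rterm list \<times> nat list list" where
  "translate (Equal s t) = q_eq (fst (term_matrices s)) (fst (term_matrices t))"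
| "translate (Neg p) = q_not (translate p)"
| "translate (Conj p q) = q_and (translate p) (translate q)"
| "translate (Exists i p) = foldr q_ex (block_vars i) (q_and (q_member i) (translate p))"

lemma computable_translate: "computable translate"
  by (rule computable_rec_gformula[OF _ _ _ _ translate.simps])
    (intro computable_intros computable_comp[OF computable_term_matrices]
      computable_comp[OF computable_block_vars] computable_comp[OF computable_q_member])+

lemma holds_foldr_q_ex:
  "holds w (foldr q_ex L \<phi>) \<longleftrightarrow> (\<exists>u. holds (\<lambda>v. if v \<in> set L then u v else w v) \<phi>)"
proof (induction L arbitrary: w)
  case (Cons i L)
  have "holds w (foldr q_ex (i # L) \<phi>) \<longleftrightarrow>
      (\<exists>a u. holds (\<lambda>v. if v \<in> set L then u v else (w(i := a)) v) \<phi>)"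
    by (simp add: holds_q_ex Cons)
  also have "\<dots> \<longleftrightarrow> (\<exists>u. holds (\<lambda>v. if v \<in> set (i # L) then u v else w v) \<phi>)"
  proof
    assume "\<exists>a u. holds (\<lambda>v. if v \<in> set L then u v else (w(i := a)) v) \<phi>"
    then obtain a u where *: "holds (\<lambda>v. if v \<in> set L then u v else (w(i := a)) v) \<phi>"
      by (elim exE) (rule that)
    have "(\<lambda>v. if v \<in> set L then u v else (w(i := a)) v) =
        (\<lambda>v. if v \<in> set (i # L) then if v \<in> set L then u v else a else w v)" by auto
    with * have "holds (\<lambda>v. if v \<in> set (i # L) then if v \<in> set L then u v else a else w v) \<phi>" by simp
    then show "\<exists>u. holds (\<lambda>v. if v \<in> set (i # L) then u v else w v) \<phi>"
      by (rule exI[of _ "\<lambda>v. if v \<in> set L then u v else a"])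
  next
    assume "\<exists>u. holds (\<lambda>v. if v \<in> set (i # L) then u v else w v) \<phi>"
    then obtain u where *: "holds (\<lambda>v. if v \<in> set (i # L) then u v else w v) \<phi>"
      by (elim exE) (rule that)
    have "(\<lambda>v. if v \<in> set (i # L) then u v else w v) =
        (\<lambda>v. if v \<in> set L then u v else (w(i := u i)) v)" by auto
    with * have "holds (\<lambda>v. if v \<in> set L then u v else (w(i := u i)) v) \<phi>" by simp
    then have "\<exists>u'. holds (\<lambda>v. if v \<in> set L then u' v else (w(i := u i)) v) \<phi>" by (rule exI[of _ u])
    then show "\<exists>a u. holds (\<lambda>v. if v \<in> set L then u v else (w(i := a)) v) \<phi>" by (rule exI[of _ "u i"])
  qed
  finally show ?case .
qed simp

lemma env_of_update: "env_of (e(i := a)) =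
    (\<lambda>v. if v \<in> set (block_vars i) then env_of (e(i := a)) v else env_of e v)"
proof
  fix v
  obtain i' fl r c where "v = vcode i' fl r c" using vcode_cases by blast
  then show "env_of (e(i := a)) v =
      (if v \<in> set (block_vars i) then env_of (e(i := a)) v else env_of e v)"
    by (simp add: set_block_vars env_of_vcode)
qed

text \<open>Real values for the two blocks of \<open>i\<close> that satisfy
  \<open>q_member i\<close> amount to one element of the group; this matches the quantifiers on both
  sides.\<close>

lemma holds_translate:
  assumes "\<And>i. e i \<in> G"
  shows "holds (env_of e) (translate p) \<longleftrightarrow> satisfies (matrix_monoid G) \<mu> e p"
  using assms
proof (induction p arbitrary: e)
  case (Equal s t)
  then show ?case using term_matrices_value[of e s] term_matrices_value[of e t]
    by (simp add: holds_q_eq)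
next
  case (Exists i p)
  let ?w = "\<lambda>u v. if v \<in> set (block_vars i) then u v else env_of e v"
  have "holds (env_of e) (translate (Exists i p)) \<longleftrightarrow>
      (\<exists>u. holds (?w u) (q_member i) \<and> holds (?w u) (translate p))"
    by (simp add: holds_foldr_q_ex)
  also have "\<dots> \<longleftrightarrow> (\<exists>a\<in>G. holds (env_of (e(i := a))) (translate p))"
  proof
    assume "\<exists>u. holds (?w u) (q_member i) \<and> holds (?w u) (translate p)"
    then obtain u where u: "holds (?w u) (q_member i)" "holds (?w u) (translate p)" by blast
    define a where "a = to_matrix (?w u) (varm 0 i)"
    have a: "a \<in> G" "to_matrix (?w u) (varm 1 i) = adjugate a"
      using u(1) unfolding holds_q_member a_def by auto
    have entry: "?w u (vcode i fl r c) = to_matrix (?w u) (varm fl i) $ \<iota> r $ \<iota> c"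
      if "r < n" "c < n" for fl r c
      unfolding varm_def to_matrix_mk by (simp add: \<iota>'_\<iota> that)
    have "?w u = env_of (e(i := a))"
    proof
      fix v
      obtain i' fl r c where v: "v = vcode i' fl r c" using vcode_cases by blast
      show "?w u v = env_of (e(i := a)) v"
      proof (cases "v \<in> set (block_vars i)")
        case True
        then have *: "i' = i" "fl \<le> 1" "r < n" "c < n" unfolding v set_block_vars by auto
        then have "fl = 0 \<or> fl = 1" by linarith
        then have "to_matrix (?w u) (varm fl i) = (if fl = 0 then a else adjugate a)"
          using a(2) by (auto simp: a_def)
        from entry[OF *(3,4), of fl, unfolded this]
        show ?thesis unfolding v *(1) env_of_vcode using *(2-4) by (simp only: fun_upd_same if_True simp_thms)
      next
        case False
        then show ?thesis using fun_cong[OF env_of_update[of e i a], of v] by simp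
      qed
    qed
    then show "\<exists>a\<in>G. holds (env_of (e(i := a))) (translate p)" using u(2) a(1) by auto
  next
    assume "\<exists>a\<in>G. holds (env_of (e(i := a))) (translate p)"
    then obtain a where a: "a \<in> G" "holds (env_of (e(i := a))) (translate p)" by blast
    have "holds (env_of (e(i := a))) (q_member i)"
      unfolding holds_q_member to_matrix_varm_env using a(1) by simp
    then show "\<exists>u. holds (?w u) (q_member i) \<and> holds (?w u) (translate p)"
      using a(2) env_of_update[of e i a] by (intro exI[of _ "env_of (e(i := a))"]) simp
  qed
  also have "\<dots> \<longleftrightarrow> (\<exists>a\<in>G. satisfies (matrix_monoid G) \<mu> (e(i := a)) p)"
  proof (intro bex_cong refl)
    fix a assume "a \<in> G"
    then show "holds (env_of (e(i := a))) (translate p) = satisfies (matrix_monoid G) \<mu> (e(i := a)) p"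
      by (intro Exists.IH) (simp add: Exists.prems)
  qed
  finally show ?case by (simp add: matrix_monoid_def)
qed simp_all

subsection \<open>Evaluation of sentences\<close>

text \<open>Variables are read under the assignment of \<open>mat 1\<close> to every group variable,
  where all real values are 0 or 1. The evaluation is thus total, and a sentence has the same truth
  value under every assignment.\<close>

primrec term_ix :: "rterm \<Rightarrow> nat" where
  "term_ix (RVar v) = (let q = snd (prod_decode v); s = snd (prod_decode q)
    in if fst (prod_decode s) = snd (prod_decode s) \<and> fst (prod_decode s) < n \<and> fst (prod_decode q) \<le> 1
      then one_ix else zero_ix)"
| "term_ix (RConst k) = k"
| "term_ix (RAdd s t) = add_ix (term_ix s) (term_ix t)"
| "term_ix (RMul s t) = mul_ix (term_ix s) (term_ix t)"

lemma computable_term_ix: "computable term_ix"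
proof -
  have "computable (\<lambda>p :: nat \<times> rterm. term_ix (snd p))"
  proof (rule computable_rec_rterm[where f = "\<lambda>x :: nat. term_ix"
        and A = "\<lambda>x v. if fst (prod_decode (snd (prod_decode (snd (prod_decode v))))) =
            snd (prod_decode (snd (prod_decode (snd (prod_decode v))))) \<and>
            fst (prod_decode (snd (prod_decode (snd (prod_decode v))))) < n \<and>
            fst (prod_decode (snd (prod_decode v))) \<le> 1 then one_ix else zero_ix"
        and B = "\<lambda>x k. k" and C = "\<lambda>x. add_ix" and D = "\<lambda>x. mul_ix"], goal_cases)
    case 1
    show ?case by (intro computable_intros)
  next
    case 2
    show ?case by (intro computable_intros)
  next
    case 3
    show ?case by (intro computable_comp2[OF add_ix(1)] computable_intros)
  next
    case 4
    show ?case by (intro computable_comp2[OF mul_ix(1)] computable_intros)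
  qed (simp_all add: Let_def)
  from computable_comp[OF this computable_Pair[OF computable_const[of 0] computable_id]]
  show ?thesis by (simp only: snd_conv)
qed

lemma term_ix: "\<nu> (term_ix t) = rvalue (env_of (\<lambda>_. mat 1)) t"
proof (induction t)
  case (RVar v)
  obtain i fl r c where v: "v = vcode i fl r c" using vcode_cases by blast
  have one: "adjugate (mat 1 :: real^'n^'n) = mat 1"
    using adjugate_unique[OF G_one, of "mat 1"] by simp
  have inj: "\<iota> r = \<iota> c \<longleftrightarrow> r = c" if "r < n" "c < n" using that \<iota>'_\<iota> by metis
  have ix: "term_ix (RVar v) = (if r = c \<and> r < n \<and> fl \<le> 1 then one_ix else zero_ix)"
    by (simp add: v vcode_def)
  have "(if fl = 0 then mat 1 else adjugate (mat 1)) = (mat 1 :: real^'n^'n)" by (simp add: one)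
  then show ?case unfolding ix unfolding rvalue.simps v env_of_vcode by (auto simp: mat_def inj)
qed (simp_all add: add_ix mul_ix)

definition sign_ix :: "nat \<Rightarrow> nat" where
  "sign_ix i = (if \<nu> i = \<nu> zero_ix then 0 else if \<nu> zero_ix < \<nu> i then 1 else 2)"

definition decide :: "rterm list \<times> nat list list \<Rightarrow> bool" where
  "decide \<phi> \<longleftrightarrow> map (\<lambda>t. sign_ix (term_ix t)) (fst \<phi>) \<in> set (snd \<phi>)"

lemma decide: "decide \<phi> \<longleftrightarrow> holds (env_of (\<lambda>_. mat 1)) \<phi>"
proof -
  have "sign_ix (term_ix t) = sign_code (rvalue (env_of (\<lambda>_. mat 1)) t)" for t
    unfolding sign_ix_def sign_code_def term_ix code_values by (rule refl)
  then show ?thesis by (simp add: decide_def holds_def)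
qed

lemma computable_decide: "computable decide"
  unfolding decide_def sign_ix_def
  by (intro computable_intros computable_comp[OF computable_term_ix]
      computable_comp2[OF computable_eq_ix] computable_comp2[OF computable_less_ix])

theorem theory_decidable: "theory_decidable (matrix_monoid G) \<mu>"
proof -
  let ?H = "matrix_monoid G"
  have carrier: "carrier ?H = G" by (simp add: matrix_monoid_def)
  have "theory_of ?H \<mu> = {p. free_var_list p = [] \<and> decide (translate p)}"
  proof (rule Set.set_eqI)
    fix p
    have "(\<forall>e. range e \<subseteq> G \<longrightarrow> satisfies ?H \<mu> e p) \<longleftrightarrow> satisfies ?H \<mu> (\<lambda>_. mat 1) p"
      if closed: "free_vars p = {}"
    proof
      assume "\<forall>e. range e \<subseteq> G \<longrightarrow> satisfies ?H \<mu> e p"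
      from mp[OF spec[OF this, of "\<lambda>_. mat 1"]] show "satisfies ?H \<mu> (\<lambda>_. mat 1) p"
        using G_one by simp
    next
      assume sat: "satisfies ?H \<mu> (\<lambda>_. mat 1) p"
      show "\<forall>e. range e \<subseteq> G \<longrightarrow> satisfies ?H \<mu> e p"
      proof (intro allI impI)
        fix e
        have "satisfies ?H \<mu> e p = satisfies ?H \<mu> (\<lambda>_. mat 1) p"
          by (rule satisfies_cong) (simp add: closed)
        with sat show "satisfies ?H \<mu> e p" by (rule iffD2[rotated])
      qed
    qed
    moreover have "free_vars p = {} \<longleftrightarrow> free_var_list p = []"
      unfolding set_free_var_list[symmetric] by simp
    moreover have "decide (translate p) \<longleftrightarrow> satisfies ?H \<mu> (\<lambda>_. mat 1) p"
      unfolding decide using G_one by (intro holds_translate)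
    ultimately show "p \<in> theory_of ?H \<mu> \<longleftrightarrow> p \<in> {p. free_var_list p = [] \<and> decide (translate p)}"
      unfolding theory_of_def carrier by auto
  qed
  then have eq: "formula_code ` theory_of ?H \<mu> = enc ` {p. free_var_list p = [] \<and> decide (translate p)}"
    by (simp only: enc_gformula_def)
  show ?thesis unfolding theory_decidable_def eq
    by (intro decidable_setI computable_enc_image computable_intros
        computable_comp[OF computable_decide] computable_free_var_list computable_translate)
qed

theorem diophantine_decidable: "diophantine_decidable (matrix_monoid G) \<mu>"
proof -
  let ?H = "matrix_monoid G"
  have carrier: "carrier ?H = G" by (simp add: matrix_monoid_def)
  have solv: "solvable_system ?H \<mu> E \<longleftrightarrow> decide (translate (system_formula E))" for E
  proof -
    have "decide (translate (system_formula E)) \<longleftrightarrow> satisfies ?H \<mu> (\<lambda>_. mat 1) (system_formula E)"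
      unfolding decide using G_one by (intro holds_translate)
    also have "\<dots> \<longleftrightarrow> solvable_system ?H \<mu> E"
      by (rule satisfies_system_formula) (use G_one carrier in auto)
    finally show ?thesis by simp
  qed
  have code: "system_code E = enc E" for E
    unfolding system_code_def enc_list_def enc_prod_def enc_gterm_def case_prod_unfold ..
  have eq: "system_code ` {E. solvable_system ?H \<mu> E} = enc ` {E. decide (translate (system_formula E))}"
    unfolding solv code ..
  show ?thesis unfolding diophantine_decidable_def eq
    by (intro decidable_setI computable_enc_image computable_comp[OF computable_decide]
        computable_comp[OF computable_translate] computable_system_formula)
qed

end

section \<open>Decidability\<close>

lemma computable_recursive_1: "recursive 1 r \<Longrightarrow> computable (\<lambda>m. r [m])"
proof -
  assume r: "recursive 1 r"
  have "recursive 1 (\<lambda>xs. r [xs ! 0])"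
    by (rule recursive.ext[OF r]) (auto simp: length_Suc_conv)
  then show ?thesis unfolding computable_nat_iff unary_recursive_def .
qed

lemma computable_recursive_2: "recursive 2 r \<Longrightarrow> computable (\<lambda>p. r [fst p, snd p])"
proof -
  assume r: "recursive 2 r"
  have "recursive 2 (\<lambda>xs. r [xs ! 0, xs ! 1])"
    by (rule recursive.ext[OF r]) (auto simp: length_Suc_conv numeral_2_eq_2)
  then have "binary_recursive (\<lambda>x y. r [x, y])" unfolding binary_recursive_def .
  then show ?thesis
    by (rule computable_binary) (simp_all add: computable_fst[OF computable_id] computable_snd[OF computable_id])
qed

lemma computable_decidable_2:
  assumes "decidable_pred 2 (\<lambda>xs. Q (xs ! 0) (xs ! 1))"
  shows "computable (\<lambda>p. Q (fst p) (snd p))"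
proof -
  have "binary_recursive (\<lambda>x y. if Q x y then 1 else 0)"
    using assms unfolding binary_recursive_def decidable_pred_def .
  then show ?thesis
    by (rule computable_binary)
      (simp_all add: enc_bool_def computable_fst[OF computable_id] computable_snd[OF computable_id])
qed

lemma real_subfield_of_int:
  assumes "real_subfield A" shows "of_int k \<in> A"
proof -
  have A: "0 \<in> A" "1 \<in> A" "\<And>x y. x \<in> A \<Longrightarrow> y \<in> A \<Longrightarrow> x + y \<in> A" "\<And>x. x \<in> A \<Longrightarrow> - x \<in> A"
    using assms unfolding real_subfield_def by blast+
  have nat: "of_nat m \<in> A" for m by (induction m) (simp_all add: A)
  show ?thesis
  proof (cases k)
    case (nonneg m)
    then show ?thesis using nat[of m] by simp
  next
    case (neg m)
    then show ?thesis using A(4)[OF nat[of "Suc m"]] by simp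
  qed
qed

text \<open>Integral equations are the ones to which \<open>ex_finite_equations\<close> applies;
  that they determine the real closure is \<open>integer_equations_suffice\<close>.\<close>

lemma zariski_closure_equations:
  "(zariski_closure Z :: (real^'n::finite^'n) set) =
    {g. \<forall>p\<in>{p. \<forall>M\<in>Z. poly_value p M = 0}. poly_value p g = 0}"
proof (rule Set.set_eqI, unfold mem_Collect_eq, rule iffI)
  fix g :: "real^'n^'n"
  {
    assume g: "g \<in> zariski_closure Z"
    show "\<forall>p\<in>{p. \<forall>M\<in>Z. poly_value p M = 0}. poly_value p g = 0"
    proof
      fix p :: "'n entry_poly" assume "p \<in> {p. \<forall>M\<in>Z. poly_value p M = 0}"
      then have "\<forall>M\<in>Z. poly_value p M = 0" by (rule CollectD)
      from g poly_value_poly_funs show "poly_value p g = 0"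
        by (rule zariski_closureD) (simp add: poly_value_of_int_matrix bspec[OF \<open>\<forall>M\<in>Z. _\<close>])
    qed
  next
    assume *: "\<forall>p\<in>{p. \<forall>M\<in>Z. poly_value p M = 0}. poly_value p g = 0"
    show "g \<in> zariski_closure Z"
      by (rule integer_equations_suffice) (rule bspec[OF *], rule CollectI)
  }
qed

text \<open>Collects the data of \<open>coded_group\<close>. Codes of 0, 1 and -1 exist because a
  subfield contains the integers; the index functions and the terms of the equations are chosen
  separately for each matrix position and each polynomial.\<close>

theorem zariski_closure_decidable:
  fixes Z :: "(int^'n::finite^'n) set" and \<mu> :: "nat \<Rightarrow> real^'n^'n"
  assumes Z: "\<And>A B. A \<in> Z \<Longrightarrow> B \<in> Z \<Longrightarrow> A ** B \<in> Z" "\<And>A. A \<in> Z \<Longrightarrow> det A = 1"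
      "\<And>A. A \<in> Z \<Longrightarrow> \<exists>B\<in>Z. A ** B = mat 1" "mat 1 \<in> Z"
    and A: "real_subfield A" "computable_enumeration \<nu> A"
    and \<mu>: "\<And>k. \<mu> k \<in> zariski_closure Z"
      "\<And>i j. \<exists>r. recursive 1 r \<and> (\<forall>m. \<mu> m $ i $ j = \<nu> (r [m]))"
  shows "theory_decidable (matrix_monoid (zariski_closure Z)) \<mu> \<and>
    diophantine_decidable (matrix_monoid (zariski_closure Z)) \<mu>"
proof -
  have int: "\<exists>k. \<nu> k = of_int j" for j
  proof -
    have "of_int j \<in> range \<nu>"
      using real_subfield_of_int[OF A(1)] A(2) by (simp add: computable_enumeration_def)
    then show ?thesis by auto
  qed
  obtain z u m where "\<nu> z = of_int 0" "\<nu> u = of_int 1" "\<nu> m = of_int (- 1)"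
    using int[of 0] int[of 1] int[of "- 1"] by blast
  then interpret coded_reals \<nu> z u m by unfold_locales simp_all
  from A(2)[unfolded computable_enumeration_def]
  have "\<exists>r. recursive 2 r \<and> (\<forall>i j. \<nu> i + \<nu> j = \<nu> (r [i, j]))" by (elim conjE)
  then obtain ra where ra: "recursive 2 ra" "\<And>i j. \<nu> i + \<nu> j = \<nu> (ra [i, j])"
    by (elim exE conjE) (simp only:)
  from A(2)[unfolded computable_enumeration_def]
  have "\<exists>r. recursive 2 r \<and> (\<forall>i j. \<nu> i * \<nu> j = \<nu> (r [i, j]))" by (elim conjE)
  then obtain rm where rm: "recursive 2 rm" "\<And>i j. \<nu> i * \<nu> j = \<nu> (rm [i, j])"
    by (elim exE conjE) (simp only:)
  obtain \<iota> :: "nat \<Rightarrow> 'n" where \<iota>: "bij_betw \<iota> {..<CARD('n)} UNIV"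
    using ex_bij_betw_nat_finite[OF finite[of "UNIV :: 'n set"]] by (auto simp: atLeast0LessThan)
  let ?G = "zariski_closure Z :: (real^'n^'n) set"

  \<comment> \<open>\<open>P f\<close> says that \<open>f m\<close> has a code computable from the
    number \<open>m\<close> of a constant. It holds for the entries of \<open>\<mu> m\<close> and,
    by closure, for those of the adjugate.\<close>
  define P where "P f \<longleftrightarrow> (\<exists>r. computable r \<and> (\<forall>m. f m = \<nu> (r m)))" for f :: "nat \<Rightarrow> real"
  have P: "closed_functions P"
    unfolding closed_functions_def
  proof (intro conjI allI impI)
    fix k :: int
    obtain c where "\<nu> c = of_int k" using int by blast
    then have "computable (\<lambda>m :: nat. c) \<and> (\<forall>m :: nat. of_int k = \<nu> c)" by (simp add: computable_const)
    then show "P (\<lambda>x. of_int k)" unfolding P_def by (rule exI[of _ "\<lambda>m. c"])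
  next
    fix f g assume "P f" "P g"
    from \<open>P f\<close>[unfolded P_def] obtain r where r: "computable r \<and> (\<forall>m. f m = \<nu> (r m))"
      by (elim exE) (rule that)
    from \<open>P g\<close>[unfolded P_def] obtain s where s: "computable s \<and> (\<forall>m. g m = \<nu> (s m))"
      by (elim exE) (rule that)
    note pair = computable_Pair[OF conjunct1[OF r] conjunct1[OF s]]
    have "computable (\<lambda>m. ra [r m, s m]) \<and> (\<forall>m. f m + g m = \<nu> (ra [r m, s m]))"
      using computable_comp[OF computable_recursive_2[OF ra(1)] pair] r s by (simp add: ra)
    then show "P (\<lambda>x. f x + g x)" unfolding P_def by (rule exI[of _ "\<lambda>m. ra [r m, s m]"])
    have "computable (\<lambda>m. rm [r m, s m]) \<and> (\<forall>m. f m * g m = \<nu> (rm [r m, s m]))"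
      using computable_comp[OF computable_recursive_2[OF rm(1)] pair] r s by (simp add: rm)
    then show "P (\<lambda>x. f x * g x)" unfolding P_def by (rule exI[of _ "\<lambda>m. rm [r m, s m]"])
  qed
  have P_\<mu>: "P (\<lambda>m. \<mu> m $ i $ j)" for i j
  proof -
    from \<mu>(2)[of i j] obtain r where "recursive 1 r \<and> (\<forall>m. \<mu> m $ i $ j = \<nu> (r [m]))"
      by (elim exE) (rule that)
    then have "computable (\<lambda>m. r [m]) \<and> (\<forall>m. \<mu> m $ i $ j = \<nu> (r [m]))"
      using computable_recursive_1 by simp
    then show ?thesis unfolding P_def by (rule exI[of _ "\<lambda>m. r [m]"])
  qed
  have P_adj: "P (\<lambda>m. adjugate (\<mu> m) $ i $ j)" for i j
    by (rule closed_functions_adjugate[OF P]) (rule P_\<mu>)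
  define R where "R r c = (SOME f. computable f \<and> (\<forall>k. \<mu> k $ \<iota> r $ \<iota> c = \<nu> (f k)))" for r c
  define S where "S r c = (SOME f. computable f \<and> (\<forall>k. adjugate (\<mu> k) $ \<iota> r $ \<iota> c = \<nu> (f k)))" for r c
  have R: "computable (R r c) \<and> (\<forall>k. \<mu> k $ \<iota> r $ \<iota> c = \<nu> (R r c k))" for r c
    unfolding R_def by (rule someI_ex[OF P_\<mu>[unfolded P_def]])
  have S: "computable (S r c) \<and> (\<forall>k. adjugate (\<mu> k) $ \<iota> r $ \<iota> c = \<nu> (S r c k))" for r c
    unfolding S_def by (rule someI_ex[OF P_adj[unfolded P_def]])

  define block :: "nat \<times> (nat \<Rightarrow> real) \<Rightarrow> real^'n^'n" where
    "block x = (\<chi> j k. snd x (prod_encode (fst x, prod_encode (0, prod_encode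
      (inv_into {..<CARD('n)} \<iota> j, inv_into {..<CARD('n)} \<iota> k)))))" for x
  \<comment> \<open>\<open>Q f\<close> says that \<open>f\<close> is given by real terms computable
    from the number \<open>i\<close> of a group variable. It holds for the entries of the first
    block of \<open>i\<close>, hence for integral polynomials in them.\<close>
  define Q where "Q f \<longleftrightarrow> (\<exists>t. computable t \<and> (\<forall>i w. f (i, w) = rvalue w (t i)))"
    for f :: "nat \<times> (nat \<Rightarrow> real) \<Rightarrow> real"
  have Q: "closed_functions Q"
    unfolding closed_functions_def
  proof (intro conjI allI impI)
    fix k :: int
    obtain c where "\<nu> c = of_int k" using int by blast
    then have "computable (\<lambda>m :: nat. RConst c) \<and> (\<forall>(m :: nat) w. of_int k = rvalue w (RConst c))"
      by (simp add: computable_const)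
    then show "Q (\<lambda>x. of_int k)" unfolding Q_def by (rule exI[of _ "\<lambda>m. RConst c"])
  next
    fix f g assume "Q f" "Q g"
    from \<open>Q f\<close>[unfolded Q_def] obtain r where
      r: "computable r \<and> (\<forall>i w. f (i, w) = rvalue w (r i))" by (elim exE) (rule that)
    from \<open>Q g\<close>[unfolded Q_def] obtain s where
      s: "computable s \<and> (\<forall>i w. g (i, w) = rvalue w (s i))" by (elim exE) (rule that)
    have "computable (\<lambda>i. RAdd (r i) (s i)) \<and> (\<forall>i w. f (i, w) + g (i, w) = rvalue w (RAdd (r i) (s i)))"
      using r s by (simp add: computable_rterm_intros)
    then show "Q (\<lambda>x. f x + g x)" unfolding Q_def by (rule exI[of _ "\<lambda>i. RAdd (r i) (s i)"])
    have "computable (\<lambda>i. RMul (r i) (s i)) \<and> (\<forall>i w. f (i, w) * g (i, w) = rvalue w (RMul (r i) (s i)))"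
      using r s by (simp add: computable_rterm_intros)
    then show "Q (\<lambda>x. f x * g x)" unfolding Q_def by (rule exI[of _ "\<lambda>i. RMul (r i) (s i)"])
  qed
  have Q_entry: "Q (\<lambda>x. block x $ j $ k)" for j k
    unfolding Q_def
    by (rule exI[of _ "\<lambda>i. RVar (prod_encode (i, prod_encode (0, prod_encode
        (inv_into {..<CARD('n)} \<iota> j, inv_into {..<CARD('n)} \<iota> k))))"], rule conjI,
      intro computable_intros, simp add: block_def)
  have Q_poly: "Q (\<lambda>x. poly_value p (block x))" for p
    by (rule closed_functions_poly_value[OF Q]) (rule Q_entry)
  define T where "T p = (SOME t. computable t \<and> (\<forall>i w. poly_value p (block (i, w)) = rvalue w (t i)))" for p
  have T: "computable (T p) \<and> (\<forall>i w. poly_value p (block (i, w)) = rvalue w (T p i))" for p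
    unfolding T_def by (rule someI_ex[OF Q_poly[unfolded Q_def]])
  from ex_finite_equations[of "{p. \<forall>M\<in>Z. poly_value p M = 0}"]
  obtain F where F: "F \<subseteq> {p. \<forall>M\<in>Z. poly_value p M = 0} \<and> finite F \<and>
    (\<forall>g :: real^'n^'n. (\<forall>p\<in>F. poly_value p g = 0) \<longrightarrow>
      (\<forall>p\<in>{p. \<forall>M\<in>Z. poly_value p M = 0}. poly_value p g = 0))"
    by (elim exE) (rule that)
  have G_F: "g \<in> ?G \<longleftrightarrow> (\<forall>p\<in>F. poly_value p g = 0)" for g :: "real^'n^'n"
  proof
    assume "g \<in> ?G"
    then have *: "\<forall>p\<in>{p. \<forall>M\<in>Z. poly_value p M = 0}. poly_value p g = 0"
      unfolding zariski_closure_equations by (rule CollectD)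
    show "\<forall>p\<in>F. poly_value p g = 0"
    proof
      fix p assume "p \<in> F"
      from bspec[OF * subsetD[OF conjunct1[OF F] this]] show "poly_value p g = 0" .
    qed
  next
    assume "\<forall>p\<in>F. poly_value p g = 0"
    from conjunct2[OF conjunct2[OF F], THEN spec, THEN mp, OF this]
    show "g \<in> ?G" unfolding zariski_closure_equations by (rule CollectI)
  qed
  obtain Fl where Fl: "set Fl = F" using finite_list[of F] F by auto

  interpret coded_group \<nu> z u m "CARD('n)" \<iota> \<mu> ?G R S "\<lambda>i. map (\<lambda>p. T p i) Fl"
    "\<lambda>i j. ra [i, j]" "\<lambda>i j. rm [i, j]"
  proof unfold_locales
    show "bij_betw \<iota> {..<CARD('n)} UNIV" by (rule \<iota>)
    show "g ** h \<in> ?G" if "g \<in> ?G" "h \<in> ?G" for g h :: "real^'n^'n"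
      by (rule zariski_closure_mult[OF Z(1) that])
    show "mat 1 \<in> ?G" using zariski_closure_superset[OF Z(4)] by (simp add: of_int_matrix_one)
    show "adjugate g \<in> ?G" if "g \<in> ?G" for g :: "real^'n^'n"
      by (rule zariski_closure_adjugate[OF Z(2,3) that])
    show "det g = 1" if "g \<in> ?G" for g :: "real^'n^'n"
      by (rule zariski_closure_det[OF Z(2) that])
    show "\<mu> k \<in> ?G" for k by (rule \<mu>(1))
    show "computable (R r c)" "\<nu> (R r c k) = \<mu> k $ \<iota> r $ \<iota> c" for r c k using R[of r c] by simp_all
    show "computable (S r c)" "\<nu> (S r c k) = adjugate (\<mu> k) $ \<iota> r $ \<iota> c" for r c k
      using S[of r c] by simp_all
    show "computable (\<lambda>p. ra [fst p, snd p])" by (rule computable_recursive_2[OF ra(1)])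
    show "\<nu> (ra [i, j]) = \<nu> i + \<nu> j" for i j by (simp add: ra)
    show "computable (\<lambda>p. rm [fst p, snd p])" by (rule computable_recursive_2[OF rm(1)])
    show "\<nu> (rm [i, j]) = \<nu> i * \<nu> j" for i j by (simp add: rm)
    show "computable (\<lambda>p. \<nu> (fst p) = \<nu> (snd p))" "computable (\<lambda>p. \<nu> (fst p) < \<nu> (snd p))"
      using A(2) unfolding computable_enumeration_def
      by (simp_all add: computable_decidable_2[of "\<lambda>x y. \<nu> x = \<nu> y"]
          computable_decidable_2[of "\<lambda>x y. \<nu> x < \<nu> y"])
    show "computable (\<lambda>i. map (\<lambda>p. T p i) Fl)"
      by (rule computable_const_list) (rule conjunct1[OF T])
    show "(\<forall>t\<in>set (map (\<lambda>p. T p i) Fl). rvalue w t = 0) \<longleftrightarrow>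
      (\<chi> j k. w (prod_encode (i, prod_encode (0, prod_encode
        (inv_into {..<CARD('n)} \<iota> j, inv_into {..<CARD('n)} \<iota> k))))) \<in> ?G" for w i
    proof -
      have "(\<forall>t\<in>set (map (\<lambda>p. T p i) Fl). rvalue w t = 0) \<longleftrightarrow> (\<forall>p\<in>F. poly_value p (block (i, w)) = 0)"
        using T by (simp add: Fl)
      then show ?thesis unfolding G_F[symmetric] by (simp add: block_def)
    qed
  qed
  show ?thesis using theory_decidable diophantine_decidable ..
qed

theorem mainTheorem8:
  fixes \<Phi> :: "'e::euclidean_space set"
    and scaleL :: "complex \<Rightarrow> 'l::ab_group_add \<Rightarrow> 'l"
    and bracket :: "'l \<Rightarrow> 'l \<Rightarrow> 'l"
    and H :: "'l set"
    and \<rho> :: "'e \<Rightarrow> 'l \<Rightarrow> complex"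
    and x :: "'e \<Rightarrow> 'l"
    and scaleV :: "complex \<Rightarrow> 'v::ab_group_add \<Rightarrow> 'v"
    and \<pi> :: "'l \<Rightarrow> 'v \<Rightarrow> 'v"
    and b :: "'n::finite \<Rightarrow> 'v"
    and A :: "real set"
    and \<nu> :: "nat \<Rightarrow> real"
    and \<mu> :: "nat \<Rightarrow> real^'n^'n"
  assumes root_system: "root_system \<Phi>" "indecomposable \<Phi>" "dim \<Phi> > 1"
    and lie_algebra: "complex_lie_algebra scaleL bracket"
      "complex_lie_algebra.semisimple scaleL bracket"
      "complex_lie_algebra.cartan_subalgebra scaleL bracket H"
      "complex_lie_algebra.root_identification scaleL bracket H \<Phi> \<rho>"
      "complex_lie_algebra.chevalley_root_vectors scaleL bracket H \<Phi> \<rho> x"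
    and representation:
      "complex_lie_algebra.faithful_representation scaleL bracket scaleV \<pi>"
      "admissible_basis scaleV \<Phi> (\<pi> \<circ> x) b"
    and subfield: "real_subfield A" "computable_enumeration \<nu> A"
    and enumeration: "proper_enumeration \<nu> (chevalley_points scaleV \<Phi> (\<pi> \<circ> x) b A) \<mu>"
  shows "theory_decidable (chevalley_group scaleV \<Phi> (\<pi> \<circ> x) b (UNIV :: real set)) \<mu> \<and>
         diophantine_decidable (chevalley_group scaleV \<Phi> (\<pi> \<circ> x) b (UNIV :: real set)) \<mu>"
proof -
  note rep = representation(1)[unfolded complex_lie_algebra.faithful_representation_def[OF lie_algebra(1)]]
  have vs: "vector_space scaleV" using rep by (rule conjunct1)
  have lin: "Vector_Spaces.linear scaleV scaleV ((\<pi> \<circ> x) \<alpha>)" for \<alpha>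
    using rep[THEN conjunct2, THEN conjunct1, THEN spec] by (simp only: comp_apply)
  from chevalley_points_closure[OF vs lin representation(2)] obtain Z where
    Z: "(\<forall>A\<in>Z. \<forall>B\<in>Z. A ** B \<in> Z) \<and> (\<forall>A\<in>Z. det A = 1) \<and> (\<forall>A\<in>Z. \<exists>B\<in>Z. A ** B = mat 1) \<and>
      mat 1 \<in> Z \<and> chevalley_points scaleV \<Phi> (\<pi> \<circ> x) b (UNIV :: real set) = zariski_closure Z"
    by (elim exE) (rule that)
  then have closure: "chevalley_points scaleV \<Phi> (\<pi> \<circ> x) b (UNIV :: real set) = zariski_closure Z" by simp
  have "\<mu> k \<in> chevalley_points scaleV \<Phi> (\<pi> \<circ> x) b A" for k
    using enumeration unfolding proper_enumeration_def by auto
  then have "\<mu> k \<in> zariski_closure Z" for k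
    unfolding closure[symmetric] by (simp add: chevalley_points_def)
  then show ?thesis
    unfolding chevalley_group_def closure
    using enumeration Z
    by (intro zariski_closure_decidable[OF _ _ _ _ subfield]) (simp_all add: proper_enumeration_def)
qed

end
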